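(* Let $\mathscr S$ be a rotationally symmetric, non-singular, non-stationary subdivision scheme whose action in an irregular region (a neighbourhood of an extraordinary vertex/face of valence $n$) is described by a matrix sequence $\{S_k\in\mathbb R^{N\times N},\ k\ge 1\}$, and which in regular regions is given by masks $\{\mathbf c^{(k)},\ k\ge1\}$. Let $\bar{\mathscr S}$ be a (rotationally) symmetric, stationary subdivision scheme that in the same irregular region is associated with the matrix $S\in\mathbb R^{N\times N}$ and in regular regions with the mask $\mathbf c$. Assume that: (i) $\bar{\mathscr S}$ is convergent both in regular and in irregular regions; (ii) $\mathscr S$ is asymptotically equivalent to $\bar{\mathscr S}$ in regular regions, i.e. $\sum_{k=1}^{+\infty}\|\mathcal S_{\mathbf c^{(k)}}-\mathcal S_{\mathbf c}\|_\infty<+\infty$; (iii) there are a finite constant $C>0$ and $\sigma>1$ such that $\|S_k-S\|_\infty\le \frac{C}{\sigma^k}$ for all $k\ge 1$. Then, for all initial data $\mathbf d_1\in\mathbb R^{N\times 3}$, the scheme $\mathscr S$ is convergent also in the irregular region. In particular, the limit defining $\boldsymbol\beta_0$ below exists and $$\lim_{k\to+\infty}\ \sup_{(u,v)\in\Omega_{k+1}}\|\mathbf r_{k+1}(u,v)-(\mathbf q_0+\boldsymbol\beta_0)\|_\infty=0$$ (on each of the $n$ sectors), where - $\mathbf q_0=\mathbf d_1^T\tilde{\boldsymbol x}_0\in\mathbb R^3$, with $\tilde{\boldsymbol x}_0\in\mathbb R^N$ such that $S^T\tilde{\boldsymbol x}_0=\tilde{\boldsymbol x}_0$ and $\tilde{\boldsymbol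 x}_0^T\boldsymbol x_0=1$; - $\boldsymbol\beta_0=\big(\lim_{k\to+\infty}\mathbf y_k\big)^T\frac{\boldsymbol x_0}{N}\in\mathbb R^3$, with $\mathbf y_k=\sum_{j=1}^{k}S^{k-j}(S_j-S)S^{(j-1)}\mathbf d_1$, $\boldsymbol x_0=(1,1,\dots,1)^T\in\mathbb R^N$ (so $S\boldsymbol x_0=\boldsymbol x_0$), $S^{(0)}=I$ and $S^{(j)}=S_jS_{j-1}\cdots S_1$ for $j\ge1$.
   Context: **Regular regions.** A (level-dependent, or non-stationary) bivariate subdivision scheme acts on regular regions through real masks $\mathbf c^{(k)}=\{c^{(k)}_{\alpha}\}_{\alpha\in\mathbb Z^2}$, $k\ge1$, all supported in a common finite subset of $\mathbb Z^2$, via $\mathbf f^{(k+1)}=\mathcal S_{\mathbf c^{(k)}}\mathbf f^{(k)}$, $(\mathcal S_{\mathbf c^{(k)}}\mathbf f)_\alpha=\sum_{\beta\in\mathbb Z^2}c^{(k)}_{\alpha-2\beta}f_\beta$. It is stationary if $\mathbf c^{(k)}=\mathbf c$ for all $k$. For a mask $\mathbf a$, $\|\mathcal S_{\mathbf a}\|_\infty=\max\{\sum_{\beta}|a_{\alpha-2\beta}|:\alpha\in\{0,1\}^2\}$ and $\mathcal S_{\mathbf c^{(k)}}-\mathcal S_{\mathbf c}=\mathcal S_{\mathbf c^{(k)}-\mathbf c}$. The scheme is convergent in regular regions if for every bounded $\mathbf f^{(1)}$ on $\mathbb Z^2$ there is $g\in C(\mathbb R^2)$ with $\lim_{\ell\to\infty}\sup_{\alpha}|g(2^{-\ell}\alpha)-f^{(\ell+1)}_\alpha|=0$,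 and $g\ne0$ for at least one $\mathbf f^{(1)}$. For a convergent scheme, $\phi_k$ ($k\ge1$) is the limit function obtained when the masks $\mathbf c^{(k)},\mathbf c^{(k+1)},\dots$ are applied successively to $\boldsymbol\delta=\{\delta_{0,\alpha}\}_\alpha$ placed on $\mathbb Z^2$; in the stationary case it is denoted $\bar\phi$. The scheme is non-singular if it generates the zero limit only from the zero initial sequence and its local matrices $S_k$ (below) are non-singular. **Irregular region.** One isolated extraordinary vertex or face of valence $n$ in a quadrilateral or triangular mesh is considered. Near it, step $k$ of the scheme maps the vector of control points $\mathbf d_k\in\mathbb R^{N\times3}$ to $\mathbf d_{k+1}=S_k\mathbf d_k$. Rotational symmetry means $S_k$ is block-circulant, $S_k=\mathrm{circ}(B_{0,k},\dots,B_{n-1,k})$ (first block row $B_{0,k},\dots,B_{n-1,k}$, each further block row being the cyclic right shift of the previous). For an extraordinary face with $p$ control points per sector, $N=pn$. For an extraordinary vertex, the actual $(pn+1)\times(pn+1)$ matrix $$\tilde S_k=\begin{pmatrix}\tilde\alpha_k&\tilde{\boldsymbol\beta}_k^T&\cdots&\tilde{\boldsymbol\beta}_k^T\\ \tilde{\boldsymbol\gamma}_k&\tilde B_{0,k}&\cdots&\tilde B_{n-1,k}\\ \vdots&&&\vdots\\ \tilde{\boldsymbol\gamma}_k&\tilde B_{1,k}&\cdots&\tilde B_{0,k}\end{pmatrix}$$ is replaced by the block-circulant matrix with blocks $B_{j,k}=\begin{pmatrix}\tilde\alpha_k/n&\tilde{\boldsymbol\beta}_k^T\\ \tilde{\boldsymbol\gamma}_k/n&\tilde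 B_{j,k}\end{pmatrix}$, so $N=n(p+1)$; in that case non-singularity refers to $\tilde S_k$. The stationary scheme is associated in the same way with a single matrix $S$. **Rings.** Put $\Omega=[0,2]^2$, $\tilde\Omega=[0,1]^2$ (quadrilateral case), or $\Omega=\{u,v\ge0,\,u+v\le2\}$, $\tilde\Omega=\{u,v\ge0,\,u+v\le1\}$ (triangular case); $\Omega_k=2^{1-k}\,\overline{\Omega\setminus\tilde\Omega}$ and $\mathbf D_{n,k}=\Omega_k\times\mathbb Z_n$ ($n$ sectors). $\Omega_k$ is a union of 3 cells, so $\mathbf D_{n,k}$ consists of $3n$ cells $\omega_k^{[j]}=2^{1-k}\omega_1^{[j]}$, $j=1,\dots,3n$. The ring $\mathbf r_k:\mathbf D_{n,k}\to\mathbb R^3$ has on each cell the patch $$\mathbf r_k^{[j]}(u,v)=(\mathbf d_k^{[j]})^T\boldsymbol\Phi_k^{[j]}(u,v)=\mathbf d_k^T\boldsymbol\Phi_k(u,v),\qquad (u,v)\in\omega_k^{[j]},$$ where $\mathbf d_k^{[j]}\in\mathbb R^{P\times3}$ consists of $P$ rows of $\mathbf d_k$ (the selection depends on $j$ but not on $k$), and $\boldsymbol\Phi_k^{[j]}$ is the vector of corresponding basic limit functions of level $k$, i.e. of the functions $(u,v)\mapsto\phi_k(2^{k-1}(u,v)-\tau-\alpha)$, in a regular-grid chart of the cell with a fixed offset $\tau\in\mathbb R^2$, $\alpha$ running over a finite set containing all $\alpha\in\mathbb Z^2$ for which the support can meet the cell ($\boldsymbol\Phi_k\in\mathbb R^N$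 is its extension by zeros). For the stationary scheme $\phi_k$ is replaced by $\bar\phi$. $\mathscr S$, assumed convergent in regular regions, is convergent in the irregular region if for all $\mathbf d_1$ there is $\mathbf r_c\in\mathbb R^3$ with $\lim_{k\to\infty}\sup_{(u,v)\in\mathbf D_{n,k}}\|\mathbf r_k(u,v)-\mathbf r_c\|_\infty=0$. **Standing assumption on the stationary scheme.** $S$ has no ineffective eigenvectors (eigenvectors for nonzero eigenvalues that produce the zero ring). Consequently, for a convergent $\bar{\mathscr S}$, $S$ always satisfies: $1$ is an algebraically simple eigenvalue, all other eigenvalues have modulus $<1$, and $S\boldsymbol x_0=\boldsymbol x_0$ with $\boldsymbol x_0=(1,\dots,1)^T$. *)

theory Defs
  imports
    "HOL-Analysis.Infinite_Sum"
    "HOL-Analysis.Elementary_Metric_Spaces"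
    "HOL-Analysis.Product_Vector"
    "HOL-Library.Extended_Real"
    "Jordan_Normal_Form.Char_Poly"
begin

section \<open>Bivariate subdivision in regular regions\<close>

text \<open>Sequences of masks, of matrices and of control points are indexed by the level
  \<open>k \<ge> 1\<close>; their value at \<open>0\<close> is never used. A stationary scheme is the constant sequence.\<close>

type_synonym mask = "int \<times> int \<Rightarrow> real"

definition uniform_support :: "(nat \<Rightarrow> mask) \<Rightarrow> bool" where
  "uniform_support c \<longleftrightarrow> finite (\<Union>k\<in>{1..}. {\<alpha>. c k \<alpha> \<noteq> 0})"

definition subdiv :: "mask \<Rightarrow> (int \<times> int \<Rightarrow> real) \<Rightarrow> int \<times> int \<Rightarrow> real" where
  "subdiv a f \<alpha> = (\<Sum>\<^sub>\<infinity>\<beta>. a (\<alpha> - (\<beta> + \<beta>)) * f \<beta>)"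

definition subdiv_norm :: "mask \<Rightarrow> real" where
  "subdiv_norm a = Max ((\<lambda>\<alpha>. \<Sum>\<^sub>\<infinity>\<beta>. \<bar>a (\<alpha> - (\<beta> + \<beta>))\<bar>) ` ({0, 1} \<times> {0, 1}))"

text \<open>\<open>refine c k f l\<close> applies the \<open>l\<close> masks \<open>c k, c (k+1), \<dots>, c (k+l-1)\<close>
  successively to \<open>f\<close>.\<close>

primrec refine ::
  "(nat \<Rightarrow> mask) \<Rightarrow> nat \<Rightarrow> (int \<times> int \<Rightarrow> real) \<Rightarrow> nat \<Rightarrow> int \<times> int \<Rightarrow> real" where
  "refine c k f 0 = f"
| "refine c k f (Suc l) = subdiv (c (k + l)) (refine c k f l)"

definition grid_pt :: "int \<times> int \<Rightarrow> real \<times> real" where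
  "grid_pt \<alpha> = (real_of_int (fst \<alpha>), real_of_int (snd \<alpha>))"

text \<open>The suprema of distances below are taken in the extended reals, so that they are
  meaningful without a boundedness proviso.\<close>

definition is_limit_function ::
  "(nat \<Rightarrow> mask) \<Rightarrow> nat \<Rightarrow> (int \<times> int \<Rightarrow> real) \<Rightarrow> (real \<times> real \<Rightarrow> real) \<Rightarrow> bool" where
  "is_limit_function c k f g \<longleftrightarrow>
     continuous_on UNIV g \<and>
     (\<lambda>l. SUP \<alpha>. ereal \<bar>g ((1 / 2) ^ l *\<^sub>R grid_pt \<alpha>) - refine c k f l \<alpha>\<bar>) \<longlonglongrightarrow> 0"

definition convergent_regular :: "(nat \<Rightarrow> mask) \<Rightarrow> bool" where
  "convergent_regular c \<longleftrightarrow>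
     (\<forall>f. bounded (range f) \<longrightarrow> (\<exists>g. is_limit_function c 1 f g)) \<and>
     (\<exists>f g. bounded (range f) \<and> is_limit_function c 1 f g \<and> g \<noteq> (\<lambda>_. 0))"

text \<open>\<open>basic_limit c k\<close> is \<open>\<phi>\<^sub>k\<close>; a limit function is unique, being continuous and
  determined at the dyadic points. For a constant mask sequence it does not depend on \<open>k\<close>.\<close>

definition basic_limit :: "(nat \<Rightarrow> mask) \<Rightarrow> nat \<Rightarrow> real \<times> real \<Rightarrow> real" where
  "basic_limit c k = (THE g. is_limit_function c k (\<lambda>\<alpha>. if \<alpha> = 0 then 1 else 0) g)"


section \<open>Local matrices\<close>

datatype irregularity = Extraordinary_Face | Extraordinary_Vertex

text \<open>Blocks are \<open>m \<times> m\<close>; block \<open>(r, s)\<close> is \<open>B ((s - r) mod n)\<close>.\<close>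

definition block_circ :: "nat \<Rightarrow> nat \<Rightarrow> (nat \<Rightarrow> real mat) \<Rightarrow> real mat" where
  "block_circ n m B = mat (n * m) (n * m)
     (\<lambda>(i, j). B ((j div m + n - i div m) mod n) $$ (i mod m, j mod m))"

definition vertex_matrix ::
  "nat \<Rightarrow> nat \<Rightarrow> real \<Rightarrow> real vec \<Rightarrow> real vec \<Rightarrow> (nat \<Rightarrow> real mat) \<Rightarrow> real mat" where
  "vertex_matrix n p a b g B = four_block_mat
     (mat 1 1 (\<lambda>_. a))                        (mat 1 (n * p) (\<lambda>(_, j). b $ (j mod p)))
     (mat (n * p) 1 (\<lambda>(i, _). g $ (i mod p)))  (block_circ n p B)"

definition vertex_block ::
  "nat \<Rightarrow> nat \<Rightarrow> real \<Rightarrow> real vec \<Rightarrow> real vec \<Rightarrow> real mat \<Rightarrow> real mat" where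
  "vertex_block n p a b g B = four_block_mat
     (mat 1 1 (\<lambda>_. a / real n))                  (mat 1 p (\<lambda>(_, j). b $ j))
     (mat p 1 (\<lambda>(i, _). g $ i / real n))          B"

fun block_size :: "irregularity \<Rightarrow> nat \<Rightarrow> nat" where
  "block_size Extraordinary_Face p = p"
| "block_size Extraordinary_Vertex p = p + 1"

text \<open>\<open>local_matrix kind n p A M\<close>: \<open>M\<close> is the block-circulant matrix used in the analysis
  and \<open>A\<close> the matrix actually applied to the distinct control points. They differ only for an
  extraordinary vertex, whose control point is repeated in each of the \<open>n\<close> sectors of \<open>M\<close>.\<close>

fun local_matrix :: "irregularity \<Rightarrow> nat \<Rightarrow> nat \<Rightarrow> real mat \<Rightarrow> real mat \<Rightarrow> bool" where
  "local_matrix Extraordinary_Face n p A M \<longleftrightarrow>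
     A = M \<and> (\<exists>B. (\<forall>j<n. B j \<in> carrier_mat p p) \<and> M = block_circ n p B)"
| "local_matrix Extraordinary_Vertex n p A M \<longleftrightarrow>
     (\<exists>a b g B. b \<in> carrier_vec p \<and> g \<in> carrier_vec p \<and> (\<forall>j<n. B j \<in> carrier_mat p p) \<and>
        A = vertex_matrix n p a b g B \<and>
        M = block_circ n (p + 1) (\<lambda>j. vertex_block n p a b g (B j)))"

definition nonsingular_scheme :: "(nat \<Rightarrow> mask) \<Rightarrow> (nat \<Rightarrow> real mat) \<Rightarrow> bool" where
  "nonsingular_scheme c A \<longleftrightarrow>
     (\<forall>f. bounded (range f) \<and> is_limit_function c 1 f (\<lambda>_. 0) \<longrightarrow> f = (\<lambda>_. 0)) \<and>
     (\<forall>k\<ge>1. invertible_mat (A k))"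

definition mat_norm_inf :: "real mat \<Rightarrow> real" where
  "mat_norm_inf M = Max ((\<lambda>i. \<Sum>j<dim_col M. \<bar>M $$ (i, j)\<bar>) ` {..<dim_row M})"

definition vec_norm_inf :: "real vec \<Rightarrow> real" where
  "vec_norm_inf v = Max ((\<lambda>i. \<bar>v $ i\<bar>) ` {..<dim_vec v})"

definition ones_vec :: "nat \<Rightarrow> real vec" where
  "ones_vec N = vec N (\<lambda>_. 1)"

text \<open>\<open>steps N M j = M j * \<dots> * M 1\<close>, i.e. \<open>S\<^sup>(\<^sup>j\<^sup>)\<close>.\<close>

primrec steps :: "nat \<Rightarrow> (nat \<Rightarrow> real mat) \<Rightarrow> nat \<Rightarrow> real mat" where
  "steps N M 0 = 1\<^sub>m N"
| "steps N M (Suc j) = M (Suc j) * steps N M j"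

text \<open>\<open>ctrl_after M d j\<close> is the vector of control points after \<open>j\<close> steps, i.e.
  \<open>d\<^sub>j\<^sub>+\<^sub>1\<close>.\<close>

primrec ctrl_after :: "(nat \<Rightarrow> real mat) \<Rightarrow> real mat \<Rightarrow> nat \<Rightarrow> real mat" where
  "ctrl_after M d 0 = d"
| "ctrl_after M d (Suc j) = M (Suc j) * ctrl_after M d j"

definition ctrl :: "(nat \<Rightarrow> real mat) \<Rightarrow> real mat \<Rightarrow> nat \<Rightarrow> real mat" where
  "ctrl M d k = ctrl_after M d (k - 1)"


section \<open>Rings\<close>

datatype mesh = Quadrilateral | Triangular

fun sector :: "mesh \<Rightarrow> (real \<times> real) set" where
  "sector Quadrilateral = {0..2} \<times> {0..2}"
| "sector Triangular = {(u, v). 0 \<le> u \<and> 0 \<le> v \<and> u + v \<le> 2}"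

fun inner_sector :: "mesh \<Rightarrow> (real \<times> real) set" where
  "inner_sector Quadrilateral = {0..1} \<times> {0..1}"
| "inner_sector Triangular = {(u, v). 0 \<le> u \<and> 0 \<le> v \<and> u + v \<le> 1}"

definition Omega :: "mesh \<Rightarrow> nat \<Rightarrow> (real \<times> real) set" where
  "Omega T k = (\<lambda>x. (1 / 2) ^ (k - 1) *\<^sub>R x) ` closure (sector T - inner_sector T)"

definition ring_domain :: "mesh \<Rightarrow> nat \<Rightarrow> nat \<Rightarrow> ((real \<times> real) \<times> nat) set" where
  "ring_domain T n k = Omega T k \<times> {..<n}"

text \<open>The three level-one cells of a sector; the \<open>3n\<close> cells of a ring are addressed by a
  sector \<open>i < n\<close> and a cell number \<open>j < 3\<close>.\<close>

fun unit_cell :: "mesh \<Rightarrow> nat \<Rightarrow> (real \<times> real) set" where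
  "unit_cell Quadrilateral j =
     (if j = 0 then {1..2} \<times> {0..1} else if j = 1 then {1..2} \<times> {1..2}
      else if j = 2 then {0..1} \<times> {1..2} else {})"
| "unit_cell Triangular j =
     (if j = 0 then {(u, v). 1 \<le> u \<and> 0 \<le> v \<and> u + v \<le> 2}
      else if j = 1 then {(u, v). u \<le> 1 \<and> v \<le> 1 \<and> 1 \<le> u + v}
      else if j = 2 then {(u, v). 0 \<le> u \<and> 1 \<le> v \<and> u + v \<le> 2} else {})"

definition cell :: "mesh \<Rightarrow> nat \<Rightarrow> nat \<Rightarrow> (real \<times> real) set" where
  "cell T k j = (\<lambda>x. (1 / 2) ^ (k - 1) *\<^sub>R x) ` unit_cell T j"

text \<open>Level-independent description of the patch on a cell: the basis functions of level \<open>k\<close>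
  are \<open>\<phi>\<^sub>k (2\<^sup>k\<^sup>-\<^sup>1 \<chi>(u,v) - \<tau> - \<alpha>)\<close> with the regular-grid chart \<open>\<chi>\<close>, the
  offset \<open>\<tau>\<close> and \<open>\<alpha>\<close> in the finite set \<open>stencil\<close>; the control point belonging to \<open>\<alpha>\<close>
  is row \<open>selection \<alpha>\<close> of the vector of control points.\<close>

record patch_data =
  chart :: "real \<times> real \<Rightarrow> real \<times> real"
  offset :: "real \<times> real"
  stencil :: "(int \<times> int) set"
  selection :: "int \<times> int \<Rightarrow> nat"

definition cell_basis ::
  "(nat \<Rightarrow> real \<times> real \<Rightarrow> real) \<Rightarrow> patch_data \<Rightarrow> nat \<Rightarrow> int \<times> int \<Rightarrow> real \<times> real \<Rightarrow> real" where
  "cell_basis \<phi> pd k \<alpha> x = \<phi> k (2 ^ (k - 1) *\<^sub>R chart pd x - offset pd - grid_pt \<alpha>)"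

text \<open>The chart is an automorphism of the grid fixing the extraordinary point, which covers
  rotated sector coordinates and any choice of diagonals of a triangular grid. The stencil has to
  contain the \<open>\<alpha>\<close> whose basis function is nonzero somewhere on the cell; functions whose closed
  support merely touches the cell in its boundary do not contribute.\<close>

definition admissible_layout ::
  "mesh \<Rightarrow> nat \<Rightarrow> nat \<Rightarrow> nat \<Rightarrow> (nat \<Rightarrow> nat \<Rightarrow> patch_data) \<Rightarrow>
   (nat \<Rightarrow> real \<times> real \<Rightarrow> real) \<Rightarrow> bool" where
  "admissible_layout T n N P L \<phi> \<longleftrightarrow> (\<forall>i<n. \<forall>j<3.
     linear (chart (L i j)) \<and> chart (L i j) ` range grid_pt = range grid_pt \<and>
     finite (stencil (L i j)) \<and> card (stencil (L i j)) = P \<and>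
     inj_on (selection (L i j)) (stencil (L i j)) \<and>
     selection (L i j) ` stencil (L i j) \<subseteq> {..<N} \<and>
     (\<forall>k\<ge>1. \<forall>\<alpha>. (\<exists>x\<in>cell T k j. cell_basis \<phi> (L i j) k \<alpha> x \<noteq> 0) \<longrightarrow> \<alpha> \<in> stencil (L i j)))"

text \<open>The extension by zeros; by injectivity of the selection the sum has at most one term.\<close>

definition patch_basis ::
  "nat \<Rightarrow> (nat \<Rightarrow> real \<times> real \<Rightarrow> real) \<Rightarrow> patch_data \<Rightarrow> nat \<Rightarrow> real \<times> real \<Rightarrow> real vec" where
  "patch_basis N \<phi> pd k x =
     vec N (\<lambda>m. \<Sum>\<alpha> | \<alpha> \<in> stencil pd \<and> selection pd \<alpha> = m. cell_basis \<phi> pd k \<alpha> x)"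

text \<open>On a common boundary of cells the patch of the first one is used. As the patches are
  continuous, this choice does not affect suprema over the ring.\<close>

definition ring_basis ::
  "mesh \<Rightarrow> nat \<Rightarrow> (nat \<Rightarrow> nat \<Rightarrow> patch_data) \<Rightarrow> (nat \<Rightarrow> mask) \<Rightarrow> nat \<Rightarrow>
   (real \<times> real) \<times> nat \<Rightarrow> real vec" where
  "ring_basis T N L c k = (\<lambda>(x, i).
     patch_basis N (basic_limit c) (L i (LEAST j. x \<in> cell T k j)) k x)"

definition subdiv_ring ::
  "mesh \<Rightarrow> nat \<Rightarrow> (nat \<Rightarrow> nat \<Rightarrow> patch_data) \<Rightarrow> (nat \<Rightarrow> mask) \<Rightarrow> (nat \<Rightarrow> real mat) \<Rightarrow>
   real mat \<Rightarrow> nat \<Rightarrow> (real \<times> real) \<times> nat \<Rightarrow> real vec" where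
  "subdiv_ring T N L c M d k z = transpose_mat (ctrl M d k) *\<^sub>v ring_basis T N L c k z"

text \<open>Convergence in the irregular region presupposes convergence in regular regions.\<close>

definition convergent_irregular ::
  "mesh \<Rightarrow> nat \<Rightarrow> nat \<Rightarrow> (nat \<Rightarrow> nat \<Rightarrow> patch_data) \<Rightarrow> (nat \<Rightarrow> mask) \<Rightarrow> (nat \<Rightarrow> real mat) \<Rightarrow> bool"
where
  "convergent_irregular T n N L c M \<longleftrightarrow>
     convergent_regular c \<and>
     (\<forall>d\<in>carrier_mat N 3. \<exists>r\<in>carrier_vec 3.
        (\<lambda>k. SUP z\<in>ring_domain T n k. ereal (vec_norm_inf (subdiv_ring T N L c M d k z - r)))
          \<longlonglongrightarrow> 0)"

text \<open>Eigenvectors may be complex. An eigenvector \<open>v\<close> of a stationary scheme produces the rings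
  \<open>\<lambda>\<^sup>k\<^sup>-\<^sup>1 v\<^sup>T \<Phi>\<^sub>k\<close>, rescaled copies of the first one up to the factor
  \<open>\<lambda>\<^sup>k\<^sup>-\<^sup>1 \<noteq> 0\<close>, so that it suffices to look at \<open>k = 1\<close>.\<close>

definition no_ineffective_eigenvectors ::
  "mesh \<Rightarrow> nat \<Rightarrow> nat \<Rightarrow> (nat \<Rightarrow> nat \<Rightarrow> patch_data) \<Rightarrow> mask \<Rightarrow> real mat \<Rightarrow> bool" where
  "no_ineffective_eigenvectors T n N L a S \<longleftrightarrow>
     (\<forall>ev v. eigenvector (map_mat complex_of_real S) v ev \<and> ev \<noteq> 0 \<longrightarrow>
        (\<exists>z\<in>ring_domain T n 1.
           scalar_prod v (map_vec complex_of_real (ring_basis T N L (\<lambda>_. a) 1 z)) \<noteq> 0))"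


section \<open>The limit point\<close>

definition perturbation_sum ::
  "nat \<Rightarrow> real mat \<Rightarrow> (nat \<Rightarrow> real mat) \<Rightarrow> real mat \<Rightarrow> nat \<Rightarrow> real mat" where
  "perturbation_sum N S M d k = mat N 3 (\<lambda>(r, s).
     \<Sum>j = 1..k. ((S ^\<^sub>m (k - j) * (M j - S) * steps N M (j - 1)) * d) $$ (r, s))"

definition mat_tendsto :: "(nat \<Rightarrow> real mat) \<Rightarrow> real mat \<Rightarrow> bool" where
  "mat_tendsto Y L \<longleftrightarrow>
     (\<forall>r<dim_row L. \<forall>s<dim_col L. (\<lambda>k. Y k $$ (r, s)) \<longlonglongrightarrow> L $$ (r, s))"

definition normalized_left_eigenvector :: "nat \<Rightarrow> real mat \<Rightarrow> real vec \<Rightarrow> bool" where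
  "normalized_left_eigenvector N S xt \<longleftrightarrow>
     xt \<in> carrier_vec N \<and> transpose_mat S *\<^sub>v xt = xt \<and> scalar_prod xt (ones_vec N) = 1"

end

theory Submission
  imports Defs "HOL-Analysis.Uniform_Limit" "Jordan_Normal_Form.Schur_Decomposition"
begin

text \<open>
  Regular regions: locality and convergence for \<open>delta\<close> bound all powers of the stationary
  operator, so that a discrete Gronwall argument bounds the products of the level-dependent
  operators and compares them with the stationary powers. Hence the scheme converges and its
  basic limit functions \<open>\<phi>\<^sub>k\<close> tend uniformly to those of the stationary scheme, which form a
  partition of unity.

  Irregular region: the rings observe the powers of \<open>S\<close>. As every eigenvector with nonzero
  eigenvalue is observable, convergence of the rings forces \<open>S\<^sup>k\<close> to converge to a matrix with
  equal rows \<open>x\<^sup>T\<close>, the normalized left eigenvector. The telescoping identity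
  \<open>S\<^sup>(\<^sup>k\<^sup>) = S\<^sup>k + \<Sum>\<^sub>j S\<^sup>k\<^sup>-\<^sup>j (S\<^sub>j - S) S\<^sup>(\<^sup>j\<^sup>-\<^sup>1\<^sup>)\<close> and Tannery's theorem then give the limit of the control
  points, all of which tend to the same point; by the partition of unity so do the rings.
\<close>

section \<open>Preliminaries\<close>

text \<open>No bound on the eigenvalues of \<open>S\<close> is assumed, so the behaviour of its
  powers has to be extracted from the convergence of the rings. The stationary rings of all levels
  share one basis; their values are therefore fixed linear functionals of the iterates. Such
  functionals could miss a growing or rotating component, and only eigenvectors are known to be
  visible to them. Generalized eigenvectors are not, which is why convergence is propagated along a
  triangular basis, with an inhomogeneous scalar recurrence at each stage. The induction carries a
  geometric rate because for eigenvalues of modulus at least one the deviations of the forcing term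
  are summed up.

  In both regions the comparison rests on a discrete Duhamel formula: a product of perturbed
  operators is a stationary power plus defects transported by stationary powers. It is used twice,
  first to obtain boundedness and then, with boundedness at hand, to estimate or compute the limit.
  The stationary powers are merely bounded and do not contract, so the summability of the defects
  has to supply all the smallness.\<close>

lemma SUP_ereal_tendsto_0_iff:
  fixes h :: "nat \<Rightarrow> 'a \<Rightarrow> real"
  assumes ne: "\<And>l. A l \<noteq> {}" and nn: "\<And>l x. x \<in> A l \<Longrightarrow> 0 \<le> h l x"
  shows "(\<lambda>l. SUP x\<in>A l. ereal (h l x)) \<longlonglongrightarrow> 0 \<longleftrightarrow>
    (\<forall>e>0. \<forall>\<^sub>F l in sequentially. \<forall>x\<in>A l. h l x \<le> e)" (is "?L \<longlonglongrightarrow> 0 \<longleftrightarrow> ?R")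
proof
  assume lim: "?L \<longlonglongrightarrow> 0"
  show ?R
  proof (intro allI impI)
    fix e :: real assume "e > 0"
    then have "\<forall>\<^sub>F l in sequentially. ?L l < ereal e"
      by (intro order_tendstoD(2)[OF lim]) (simp add: zero_ereal_def)
    then show "\<forall>\<^sub>F l in sequentially. \<forall>x\<in>A l. h l x \<le> e"
    proof eventually_elim
      case (elim l)
      show ?case
      proof
        fix x assume "x \<in> A l"
        then have "ereal (h l x) \<le> ?L l" by (rule SUP_upper)
        then have "ereal (h l x) < ereal e" using elim by (rule le_less_trans)
        then show "h l x \<le> e" by simp
      qed
    qed
  qed
next
  assume R: ?R
  show "?L \<longlonglongrightarrow> 0"
  proof (rule order_tendstoI)
    fix a :: ereal assume a: "a < 0"
    \<comment> \<open>An empty supremum would be minus infinity; one element with a nonnegative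
      value bounds it from below.\<close>
    have "a < ?L l" for l
    proof -
      obtain x where x: "x \<in> A l" using ne[of l] by auto
      have "0 \<le> ereal (h l x)" using nn[OF x] by simp
      also have "\<dots> \<le> ?L l" using x by (rule SUP_upper)
      finally show ?thesis using a by (rule less_le_trans[rotated])
    qed
    then show "\<forall>\<^sub>F l in sequentially. a < ?L l" by simp
  next
    fix a :: ereal assume "0 < a"
    then obtain e :: real where e: "0 < ereal e" "ereal e < a" using ereal_dense2 by blast
    then have "\<forall>\<^sub>F l in sequentially. \<forall>x\<in>A l. h l x \<le> e" using R by simp
    then show "\<forall>\<^sub>F l in sequentially. ?L l < a"
    proof eventually_elim
      case (elim l)
      then have "?L l \<le> ereal e" by (intro SUP_least) simp
      then show ?case using e(2) by (rule le_less_trans)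
    qed
  qed
qed

text \<open>\<open>bnd k E\<close> is an abstract assertion that the \<open>k\<close>-th iterate is
  bounded by \<open>E\<close>, so that one induction serves sup norms over the integer grid as well
  as over finitely many components.\<close>

lemma discrete_gronwall:
  fixes b :: "nat \<Rightarrow> real"
  assumes step: "\<And>k E. (\<And>j. j < k \<Longrightarrow> bnd j (E j)) \<Longrightarrow> bnd k (A + (\<Sum>j<k. b j * E j))"
  shows "bnd k (A * (\<Prod>j<k. 1 + b j))"
proof (induction k rule: less_induct)
  case (less k)
  \<comment> \<open>The product bounds solve the recursion in \<open>step\<close> with equality, so
    the induction closes exactly.\<close>
  have telescope: "A + (\<Sum>j<m. b j * (A * (\<Prod>i<j. 1 + b i))) = A * (\<Prod>i<m. 1 + b i)" for m
    by (induction m) (simp_all add: algebra_simps)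
  from step[of k "\<lambda>j. A * (\<Prod>i<j. 1 + b i)"] less show ?case by (simp add: telescope)
qed

lemma prod_one_plus_le_exp:
  fixes b :: "'a \<Rightarrow> real"
  assumes "\<And>j. j \<in> J \<Longrightarrow> 0 \<le> b j"
  shows "(\<Prod>j\<in>J. 1 + b j) \<le> exp (\<Sum>j\<in>J. b j)"
proof (cases "finite J")
  case True
  have "(\<Prod>j\<in>J. 1 + b j) \<le> (\<Prod>j\<in>J. exp (b j))"
    using assms by (intro prod_mono) (auto simp: add_nonneg_nonneg)
  then show ?thesis by (simp add: exp_sum[OF True])
qed simp

section \<open>The subdivision operators\<close>

definition delta :: "int \<times> int \<Rightarrow> real" where
  "delta = (\<lambda>\<alpha>. if \<alpha> = 0 then 1 else 0)"

text \<open>\<open>J\<close> may exceed the set of nonzero terms; a common \<open>J\<close> for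
  several masks or sequences reduces linearity to that of finite sums.\<close>

lemma subdiv_eq_sum:
  assumes "finite J" and "\<And>\<beta>. \<beta> \<notin> J \<Longrightarrow> a (\<alpha> - (\<beta> + \<beta>)) * f \<beta> = 0"
  shows "subdiv a f \<alpha> = (\<Sum>\<beta>\<in>J. a (\<alpha> - (\<beta> + \<beta>)) * f \<beta>)"
proof -
  have "subdiv a f \<alpha> = (\<Sum>\<^sub>\<infinity>\<beta>\<in>J. a (\<alpha> - (\<beta> + \<beta>)) * f \<beta>)"
    unfolding subdiv_def using assms(2) by (intro infsum_cong_neutral) auto
  with assms(1) show ?thesis by simp
qed

lemma finite_support_shift:
  fixes a :: mask
  assumes "finite {\<gamma>. a \<gamma> \<noteq> 0}"
  shows "finite {\<beta>. a (\<alpha> - (\<beta> + \<beta>)) \<noteq> 0}"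
proof -
  have "inj (\<lambda>\<beta> :: int \<times> int. \<alpha> - (\<beta> + \<beta>))"
    by (rule injI) (auto simp: prod_eq_iff)
  from finite_vimageI[OF assms this] show ?thesis by (simp add: vimage_def)
qed

section \<open>Linearity in the data and in the mask\<close>

lemma subdiv_add:
  assumes "finite {\<gamma>. a \<gamma> \<noteq> 0}"
  shows "subdiv a (\<lambda>\<beta>. f \<beta> + g \<beta>) \<alpha> = subdiv a f \<alpha> + subdiv a g \<alpha>"
proof -
  note fin = finite_support_shift[OF assms, of \<alpha>]
  show ?thesis
    by (subst (1 2 3) subdiv_eq_sum[OF fin]) (auto simp: sum.distrib algebra_simps)
qed

lemma subdiv_sum:
  assumes "finite {\<gamma>. a \<gamma> \<noteq> 0}"
  shows "subdiv a (\<lambda>\<beta>. \<Sum>i\<in>K. w i * h i \<beta>) = (\<lambda>\<alpha>. \<Sum>i\<in>K. w i * subdiv a (h i) \<alpha>)"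
proof
  fix \<alpha>
  note fin = finite_support_shift[OF assms, of \<alpha>]
  have "subdiv a (\<lambda>\<beta>. \<Sum>i\<in>K. w i * h i \<beta>) \<alpha>
      = (\<Sum>\<beta>\<in>{\<beta>. a (\<alpha> - (\<beta> + \<beta>)) \<noteq> 0}. \<Sum>i\<in>K. w i * (a (\<alpha> - (\<beta> + \<beta>)) * h i \<beta>))"
    by (subst subdiv_eq_sum[OF fin]) (auto simp: sum_distrib_left intro!: sum.cong)
  also have "\<dots> = (\<Sum>i\<in>K. \<Sum>\<beta>\<in>{\<beta>. a (\<alpha> - (\<beta> + \<beta>)) \<noteq> 0}. w i * (a (\<alpha> - (\<beta> + \<beta>)) * h i \<beta>))"
    by (rule sum.swap)
  also have "\<dots> = (\<Sum>i\<in>K. w i * subdiv a (h i) \<alpha>)"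
    by (intro sum.cong refl, subst subdiv_eq_sum[OF fin]) (auto simp: sum_distrib_left)
  finally show "subdiv a (\<lambda>\<beta>. \<Sum>i\<in>K. w i * h i \<beta>) \<alpha> = (\<Sum>i\<in>K. w i * subdiv a (h i) \<alpha>)" .
qed

lemma subdiv_mask_diff:
  assumes a: "finite {\<gamma>. a \<gamma> \<noteq> 0}" and b: "finite {\<gamma>. b \<gamma> \<noteq> 0}"
  shows "subdiv (\<lambda>\<gamma>. a \<gamma> - b \<gamma>) f \<alpha> = subdiv a f \<alpha> - subdiv b f \<alpha>"
proof -
  note fin = finite_UnI[OF finite_support_shift[OF a, of \<alpha>] finite_support_shift[OF b, of \<alpha>]]
  show ?thesis
    by (subst (1 2 3) subdiv_eq_sum[OF fin]) (auto simp: sum_subtractf algebra_simps)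
qed

text \<open>The row sum depends on \<alpha> only modulo 2: translating \<beta> by \<open>h\<close>
  replaces \<alpha> by its residue \<open>e\<close>, which is one of the four indices in the
  maximum.\<close>

lemma subdiv_norm_ge:
  fixes a :: mask
  assumes fin: "finite {\<gamma>. a \<gamma> \<noteq> 0}"
  shows "(\<Sum>\<beta> | a (\<alpha> - (\<beta> + \<beta>)) \<noteq> 0. \<bar>a (\<alpha> - (\<beta> + \<beta>))\<bar>) \<le> subdiv_norm a"
proof -
  let ?S = "\<lambda>\<alpha>. \<Sum>\<^sub>\<infinity>\<beta>. \<bar>a (\<alpha> - (\<beta> + \<beta>))\<bar>"
  define e where "e = (fst \<alpha> mod 2, snd \<alpha> mod 2)"
  define h where "h = (fst \<alpha> div 2, snd \<alpha> div 2)"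
  have \<alpha>: "\<alpha> = e + (h + h)"
    by (simp add: e_def h_def prod_eq_iff)
  have e: "e \<in> {0, 1} \<times> {0, 1}" by (auto simp: e_def)
  have "(\<Sum>\<beta> | a (\<alpha> - (\<beta> + \<beta>)) \<noteq> 0. \<bar>a (\<alpha> - (\<beta> + \<beta>))\<bar>)
      = (\<Sum>\<^sub>\<infinity>\<beta>\<in>{\<beta>. a (\<alpha> - (\<beta> + \<beta>)) \<noteq> 0}. \<bar>a (\<alpha> - (\<beta> + \<beta>))\<bar>)"
    using finite_support_shift[OF fin, of \<alpha>] by simp
  also have "\<dots> = ?S \<alpha>"
    by (intro infsum_cong_neutral) auto
  also have "bij (\<lambda>\<beta>. \<beta> + h)" by (rule bij_plus_right)
  from infsum_reindex_bij_betw[OF this, of "\<lambda>\<beta>. \<bar>a (\<alpha> - (\<beta> + \<beta>))\<bar>"]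
  have "?S \<alpha> = ?S e" by (simp add: \<alpha> algebra_simps)
  also have "?S e \<le> subdiv_norm a"
    unfolding subdiv_norm_def using e by (intro Max_ge) auto
  finally show ?thesis .
qed

lemma subdiv_norm_nonneg:
  assumes "finite {\<gamma>. a \<gamma> \<noteq> 0}"
  shows "0 \<le> subdiv_norm a"
  by (rule order_trans[OF _ subdiv_norm_ge[OF assms]]) (simp add: sum_nonneg)

lemma abs_subdiv_le:
  assumes fin: "finite {\<gamma>. a \<gamma> \<noteq> 0}" and f: "\<And>\<beta>. \<bar>f \<beta>\<bar> \<le> B"
  shows "\<bar>subdiv a f \<alpha>\<bar> \<le> subdiv_norm a * B"
proof -
  let ?J = "{\<beta>. a (\<alpha> - (\<beta> + \<beta>)) \<noteq> 0}"
  have B: "0 \<le> B" using f[of 0] by linarith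
  have "\<bar>subdiv a f \<alpha>\<bar> \<le> (\<Sum>\<beta>\<in>?J. \<bar>a (\<alpha> - (\<beta> + \<beta>)) * f \<beta>\<bar>)"
    by (subst subdiv_eq_sum[OF finite_support_shift[OF fin]]) auto
  also have "\<dots> \<le> (\<Sum>\<beta>\<in>?J. \<bar>a (\<alpha> - (\<beta> + \<beta>))\<bar> * B)"
    by (intro sum_mono) (simp add: abs_mult f mult_left_mono)
  also have "\<dots> = (\<Sum>\<beta>\<in>?J. \<bar>a (\<alpha> - (\<beta> + \<beta>))\<bar>) * B" by (simp add: sum_distrib_right)
  also have "\<dots> \<le> subdiv_norm a * B" by (rule mult_right_mono[OF subdiv_norm_ge[OF fin] B])
  finally show ?thesis .
qed

section \<open>Iterated refinement and translations\<close>

lemma refine_add: "refine c k f (m + l) = refine c (k + m) (refine c k f m) l"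
  by (induction l) (simp_all add: add.assoc)

lemma refine_const: "refine (\<lambda>_. a) k f l = refine (\<lambda>_. a) k' f l"
  by (induction l) simp_all

lemma refine_sum:
  assumes "\<And>j. j \<ge> k \<Longrightarrow> finite {\<gamma>. c j \<gamma> \<noteq> 0}"
  shows "refine c k (\<lambda>\<beta>. \<Sum>i\<in>K. w i * h i \<beta>) l = (\<lambda>\<alpha>. \<Sum>i\<in>K. w i * refine c k (h i) l \<alpha>)"
  by (induction l) (simp_all add: subdiv_sum[OF assms])

text \<open>The index that the initial grid point \<gamma> has on the grid refined \<open>l\<close>
  times.\<close>

definition dscale :: "nat \<Rightarrow> int \<times> int \<Rightarrow> int \<times> int" where
  "dscale l \<gamma> = (2 ^ l * fst \<gamma>, 2 ^ l * snd \<gamma>)"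

lemma dscale_0 [simp]: "dscale 0 \<gamma> = \<gamma>" by (simp add: dscale_def)

lemma dscale_Suc: "dscale (Suc l) \<gamma> = dscale l \<gamma> + dscale l \<gamma>" by (simp add: dscale_def)

lemma subdiv_translate:
  "subdiv a (\<lambda>\<beta>. f (\<beta> - \<gamma>)) = (\<lambda>\<alpha>. subdiv a f (\<alpha> - (\<gamma> + \<gamma>)))"
proof
  fix \<alpha>
  have "bij (\<lambda>\<beta>. \<beta> + \<gamma>)" by (rule bij_plus_right)
  from infsum_reindex_bij_betw[OF this, of "\<lambda>\<beta>. a (\<alpha> - (\<beta> + \<beta>)) * f (\<beta> - \<gamma>)"]
  show "subdiv a (\<lambda>\<beta>. f (\<beta> - \<gamma>)) \<alpha> = subdiv a f (\<alpha> - (\<gamma> + \<gamma>))"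
    by (simp add: subdiv_def algebra_simps)
qed

lemma refine_translate:
  "refine c k (\<lambda>\<beta>. f (\<beta> - \<gamma>)) l = (\<lambda>\<alpha>. refine c k f l (\<alpha> - dscale l \<gamma>))"
  by (induction l) (simp_all add: dscale_Suc subdiv_translate)

section \<open>Locality\<close>

definition supported_within :: "int \<Rightarrow> mask \<Rightarrow> bool" where
  "supported_within R a \<longleftrightarrow> (\<forall>\<gamma>. a \<gamma> \<noteq> 0 \<longrightarrow> \<bar>fst \<gamma>\<bar> \<le> R \<and> \<bar>snd \<gamma>\<bar> \<le> R)"

lemma supported_within_finite:
  assumes "supported_within R a"
  shows "finite {\<gamma>. a \<gamma> \<noteq> 0}"
proof (rule finite_subset)
  show "{\<gamma>. a \<gamma> \<noteq> 0} \<subseteq> {-R..R} \<times> {-R..R}"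
  proof
    fix \<gamma> assume "\<gamma> \<in> {\<gamma>. a \<gamma> \<noteq> 0}"
    with assms have "\<bar>fst \<gamma>\<bar> \<le> R" "\<bar>snd \<gamma>\<bar> \<le> R"
      unfolding supported_within_def by blast+
    then show "\<gamma> \<in> {-R..R} \<times> {-R..R}" by (auto simp: mem_Times_iff)
  qed
qed simp

lemma uniform_support_within:
  assumes "uniform_support c"
  obtains R where "R \<ge> 0" "\<And>k. k \<ge> 1 \<Longrightarrow> supported_within R (c k)"
proof -
  let ?U = "\<Union>k\<in>{1..}. {\<alpha>. c k \<alpha> \<noteq> 0}"
  define R where "R = (\<Sum>\<gamma>\<in>?U. \<bar>fst \<gamma>\<bar> + \<bar>snd \<gamma>\<bar>)"
  have fin: "finite ?U" using assms by (simp add: uniform_support_def)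
  have "supported_within R (c k)" if "k \<ge> 1" for k
    unfolding supported_within_def
  proof (intro allI impI)
    fix \<gamma> assume "c k \<gamma> \<noteq> 0"
    with that have "\<gamma> \<in> ?U" by auto
    then have "\<bar>fst \<gamma>\<bar> + \<bar>snd \<gamma>\<bar> \<le> R"
      unfolding R_def by (intro member_le_sum[OF _ _ fin]) auto
    then show "\<bar>fst \<gamma>\<bar> \<le> R \<and> \<bar>snd \<gamma>\<bar> \<le> R" by auto
  qed
  moreover have "R \<ge> 0" unfolding R_def by (intro sum_nonneg) auto
  ultimately show thesis using that by blast
qed

text \<open>The initial indices that can influence the value at \<alpha> after \<open>l\<close>
  steps. The reach is the accumulated mask radius
  \<open>R * (1 + 2 + ... + 2 ^ (l - 1))\<close>.\<close>

definition near :: "int \<Rightarrow> nat \<Rightarrow> int \<times> int \<Rightarrow> (int \<times> int) set" where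
  "near R l \<alpha> = {\<beta>. \<bar>2 ^ l * fst \<beta> - fst \<alpha>\<bar> \<le> R * (2 ^ l - 1) \<and>
                    \<bar>2 ^ l * snd \<beta> - snd \<alpha>\<bar> \<le> R * (2 ^ l - 1)}"

lemma refine_local:
  assumes "\<And>j. j \<ge> k \<Longrightarrow> supported_within R (c j)"
    and "\<And>\<beta>. \<beta> \<in> near R l \<alpha> \<Longrightarrow> f \<beta> = g \<beta>"
  shows "refine c k f l \<alpha> = refine c k g l \<alpha>"
  using assms(2)
proof (induction l arbitrary: \<alpha>)
  case 0
  then show ?case by (simp add: near_def)
next
  case (Suc l)
  have sub: "near R l \<gamma> \<subseteq> near R (Suc l) \<alpha>"
    if "\<bar>fst \<alpha> - (fst \<gamma> + fst \<gamma>)\<bar> \<le> R" "\<bar>snd \<alpha> - (snd \<gamma> + snd \<gamma>)\<bar> \<le> R" for \<gamma>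
  proof
    fix \<beta> assume b: "\<beta> \<in> near R l \<gamma>"
    \<comment> \<open>One more step doubles the reach and adds the radius of a mask.\<close>
    have *: "\<bar>2 ^ Suc l * b - a\<bar> \<le> R * (2 ^ Suc l - 1)"
      if "\<bar>2 ^ l * b - g\<bar> \<le> R * (2 ^ l - 1)" "\<bar>a - (g + g)\<bar> \<le> R" for a b g :: int
    proof -
      have triangle: "\<bar>x\<bar> \<le> 2 * \<bar>u\<bar> + \<bar>v\<bar>" if "x = 2 * u - v" for x u v :: int
        using that by linarith
      have "\<bar>2 ^ Suc l * b - a\<bar> \<le> 2 * \<bar>2 ^ l * b - g\<bar> + \<bar>a - (g + g)\<bar>"
        by (rule triangle) simp
      also have "\<dots> \<le> 2 * (R * (2 ^ l - 1)) + R" using that by (intro add_mono mult_left_mono) auto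
      also have "\<dots> = R * (2 ^ Suc l - 1)" by (simp add: algebra_simps)
      finally show ?thesis .
    qed
    from b have "\<bar>2 ^ l * fst \<beta> - fst \<gamma>\<bar> \<le> R * (2 ^ l - 1)" "\<bar>2 ^ l * snd \<beta> - snd \<gamma>\<bar> \<le> R * (2 ^ l - 1)"
      unfolding near_def by blast+
    from *[OF this(1) that(1)] *[OF this(2) that(2)] show "\<beta> \<in> near R (Suc l) \<alpha>"
      unfolding near_def by blast
  qed
  have "subdiv (c (k + l)) (refine c k f l) \<alpha> = subdiv (c (k + l)) (refine c k g l) \<alpha>"
    unfolding subdiv_def
  proof (rule infsum_cong)
    fix \<gamma>
    show "c (k + l) (\<alpha> - (\<gamma> + \<gamma>)) * refine c k f l \<gamma> = c (k + l) (\<alpha> - (\<gamma> + \<gamma>)) * refine c k g l \<gamma>"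
    proof (cases "c (k + l) (\<alpha> - (\<gamma> + \<gamma>)) = 0")
      case False
      then have "\<bar>fst (\<alpha> - (\<gamma> + \<gamma>))\<bar> \<le> R" "\<bar>snd (\<alpha> - (\<gamma> + \<gamma>))\<bar> \<le> R"
        using assms(1)[OF le_add1, of l] unfolding supported_within_def by blast+
      then have "\<bar>fst \<alpha> - (fst \<gamma> + fst \<gamma>)\<bar> \<le> R" "\<bar>snd \<alpha> - (snd \<gamma> + snd \<gamma>)\<bar> \<le> R" by simp_all
      with sub Suc.prems have "refine c k f l \<gamma> = refine c k g l \<gamma>"
        by (intro Suc.IH) blast
      then show ?thesis by simp
    qed simp
  qed
  then show ?case by simp
qed

text \<open>After division by \<open>2 ^ l\<close> the reach is at most \<open>R\<close>, up to the
  rounding of \<open>div\<close>. The size of the box, and with it the number of influencing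
  indices, thus does not grow with \<open>l\<close>.\<close>

lemma near_subset_box:
  assumes "R \<ge> 0"
  shows "near R l \<alpha> \<subseteq> {fst \<alpha> div 2 ^ l - R..fst \<alpha> div 2 ^ l + R + 1} \<times>
                        {snd \<alpha> div 2 ^ l - R..snd \<alpha> div 2 ^ l + R + 1}" 
proof -
  have *: "b \<in> {a div 2 ^ l - R..a div 2 ^ l + R + 1}"
    if le: "\<bar>2 ^ l * b - a\<bar> \<le> R * (2 ^ l - 1)" for a b :: int
  proof -
    define q where "q = (2 :: int) ^ l"
    have q: "q > 0" by (simp add: q_def)
    define r where "r = a mod q"
    have r: "0 \<le> r" "r < q" using q by (simp_all add: r_def)
    have a: "a = q * (a div q) + r" by (simp add: r_def)
    have "q * b \<le> a + R * q" "a - R * q \<le> q * b"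
      using le assms by (auto simp: q_def[symmetric] algebra_simps)
    then have "q * b < q * (a div q + R + 1)" "q * (a div q - R) \<le> q * b"
      using a r by (auto simp: algebra_simps) 
    then show ?thesis using q by (simp add: mult_less_cancel_left mult_le_cancel_left q_def)
  qed
  show ?thesis unfolding near_def using * by auto
qed

lemma finite_near: "R \<ge> 0 \<Longrightarrow> finite (near R l \<alpha>)"
  by (rule finite_subset[OF near_subset_box]) auto

lemma card_near_le:
  assumes "R \<ge> 0"
  shows "real (card (near R l \<alpha>)) \<le> (2 * real_of_int R + 2)\<^sup>2"
proof -
  have "card (near R l \<alpha>) \<le> nat (2 * R + 2) * nat (2 * R + 2)"
    using card_mono[OF _ near_subset_box[OF assms, of l \<alpha>]] by (simp add: card_cartesian_product algebra_simps)
  then have "real (card (near R l \<alpha>)) \<le> real (nat (2 * R + 2) * nat (2 * R + 2))"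
    by (rule of_nat_mono)
  also have "\<dots> = (2 * real_of_int R + 2)\<^sup>2"
    using assms by (simp add: power2_eq_square)
  finally show ?thesis .
qed

text \<open>Any \<open>f\<close> is an infinite combination of translates of \<open>delta\<close>;
  locality allows it to be replaced by a finite one without changing the value at \<alpha>.
  \<open>J\<close> may be larger than necessary, so that it can be kept fixed while \<open>l\<close>
  varies.\<close>

lemma refine_eq_sum:
  assumes "\<And>j. j \<ge> k \<Longrightarrow> supported_within R (c j)" and "finite J" and "near R l \<alpha> \<subseteq> J"
  shows "refine c k f l \<alpha> = (\<Sum>\<beta>\<in>J. f \<beta> * refine c k delta l (\<alpha> - dscale l \<beta>))"
proof -
  have "refine c k f l \<alpha> = refine c k (\<lambda>\<gamma>. \<Sum>\<beta>\<in>J. f \<beta> * delta (\<gamma> - \<beta>)) l \<alpha>"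
  proof (rule refine_local[OF assms(1)])
    fix \<gamma> assume "\<gamma> \<in> near R l \<alpha>"
    then have "\<gamma> \<in> J" using assms(3) by auto
    have "(\<Sum>\<beta>\<in>J. f \<beta> * delta (\<gamma> - \<beta>)) = (\<Sum>\<beta>\<in>J. if \<beta> = \<gamma> then f \<beta> else 0)"
      by (intro sum.cong) (auto simp: delta_def)
    also have "\<dots> = f \<gamma>" using \<open>\<gamma> \<in> J\<close> \<open>finite J\<close> by simp
    finally show "f \<gamma> = (\<Sum>\<beta>\<in>J. f \<beta> * delta (\<gamma> - \<beta>))" by simp
  qed
  then show ?thesis
    by (simp add: refine_sum[OF supported_within_finite[OF assms(1)]] refine_translate)
qed

lemma refine_delta_eq_0:
  assumes "\<And>j. j \<ge> k \<Longrightarrow> supported_within R (c j)"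
    and "\<bar>fst \<alpha>\<bar> > R * (2 ^ l - 1) \<or> \<bar>snd \<alpha>\<bar> > R * (2 ^ l - 1)"
  shows "refine c k delta l \<alpha> = 0"
proof -
  have "refine c k delta l \<alpha> = refine c k (\<lambda>_. 0) l \<alpha>"
  proof (rule refine_local[OF assms(1)])
    fix \<beta> assume "\<beta> \<in> near R l \<alpha>"
    then show "delta \<beta> = 0" using assms(2) by (auto simp: delta_def near_def)
  qed
  also have "refine c k (\<lambda>_. 0) l = (\<lambda>_. 0)"
    by (induction l) (simp_all add: subdiv_def)
  finally show ?thesis by simp
qed

section \<open>Limit functions\<close>

lemma grid_pt_add: "grid_pt (\<alpha> + \<beta>) = grid_pt \<alpha> + grid_pt \<beta>"
  by (simp add: grid_pt_def)

lemma is_limit_function_iff: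
  "is_limit_function c k f g \<longleftrightarrow> continuous_on UNIV g \<and>
     (\<forall>e>0. \<forall>\<^sub>F l in sequentially. \<forall>\<alpha>.
        \<bar>g ((1 / 2) ^ l *\<^sub>R grid_pt \<alpha>) - refine c k f l \<alpha>\<bar> \<le> e)"
  unfolding is_limit_function_def by (subst SUP_ereal_tendsto_0_iff) auto

lemma is_limit_function_const: "is_limit_function (\<lambda>_. a) k f g \<longleftrightarrow> is_limit_function (\<lambda>_. a) k' f g"
  by (simp add: is_limit_function_def refine_const[of a k _ _ k'])

text \<open>The index sequence is left free, so that a point can also be approached through
  neighbouring indices or through indices inherited from the previous level.\<close>

lemma limit_function_along:
  assumes lim: "is_limit_function c k f g"
    and x: "(\<lambda>l. (1 / 2) ^ l *\<^sub>R grid_pt (a l)) \<longlonglongrightarrow> x"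
  shows "(\<lambda>l. refine c k f l (a l)) \<longlonglongrightarrow> g x"
proof -
  have g: "(\<lambda>l. g ((1 / 2) ^ l *\<^sub>R grid_pt (a l))) \<longlonglongrightarrow> g x"
    using lim unfolding is_limit_function_def continuous_on_eq_continuous_at[OF open_UNIV]
    by (intro isCont_tendsto_compose[OF _ x]) blast
  have "(\<lambda>l. g ((1 / 2) ^ l *\<^sub>R grid_pt (a l)) - refine c k f l (a l)) \<longlonglongrightarrow> 0"
  proof (rule LIMSEQ_I)
    fix e :: real assume "e > 0"
    then have "\<forall>\<^sub>F l in sequentially. \<forall>\<alpha>.
        \<bar>g ((1 / 2) ^ l *\<^sub>R grid_pt \<alpha>) - refine c k f l \<alpha>\<bar> \<le> e / 2"
      using lim unfolding is_limit_function_iff by (meson half_gt_zero)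
    then obtain l0 where l0: "\<And>l \<alpha>. l \<ge> l0 \<Longrightarrow> \<bar>g ((1 / 2) ^ l *\<^sub>R grid_pt \<alpha>) - refine c k f l \<alpha>\<bar> \<le> e / 2"
      unfolding eventually_sequentially by blast
    have "norm (g ((1 / 2) ^ l *\<^sub>R grid_pt (a l)) - refine c k f l (a l) - 0) < e" if "l \<ge> l0" for l
      using l0[OF that, of "a l"] \<open>e > 0\<close> unfolding real_norm_def diff_zero by linarith
    then show "\<exists>l0. \<forall>l\<ge>l0. norm (g ((1 / 2) ^ l *\<^sub>R grid_pt (a l)) - refine c k f l (a l) - 0) < e"
      by blast
  qed
  from tendsto_diff[OF g this] show ?thesis by simp
qed

definition dyadic_floor :: "nat \<Rightarrow> real \<times> real \<Rightarrow> int \<times> int" where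
  "dyadic_floor l x = (\<lfloor>2 ^ l * fst x\<rfloor>, \<lfloor>2 ^ l * snd x\<rfloor>)"

lemma dyadic_floor_1_tendsto: "(\<lambda>l. (1 / 2) ^ l * real_of_int \<lfloor>2 ^ l * x\<rfloor>) \<longlonglongrightarrow> x"
proof (rule tendsto_sandwich)
  have "(1 / 2) ^ l * real_of_int \<lfloor>2 ^ l * x\<rfloor> \<le> (1 / 2) ^ l * (2 ^ l * x)" for l
    by (intro mult_left_mono) auto
  then show "\<forall>\<^sub>F l in sequentially. (1 / 2) ^ l * real_of_int \<lfloor>2 ^ l * x\<rfloor> \<le> x"
    by (simp add: power_one_over)
  have "(1 / 2) ^ l * (2 ^ l * x - 1) \<le> (1 / 2) ^ l * real_of_int \<lfloor>2 ^ l * x\<rfloor>" for l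
    by (intro mult_left_mono) (linarith, simp)
  then show "\<forall>\<^sub>F l in sequentially. x - (1 / 2) ^ l \<le> (1 / 2) ^ l * real_of_int \<lfloor>2 ^ l * x\<rfloor>"
    by (simp add: power_one_over algebra_simps)
  have "(\<lambda>l. x - (1 / 2) ^ l) \<longlonglongrightarrow> x - 0"
    by (intro tendsto_intros LIMSEQ_power_zero) simp
  then show "(\<lambda>l. x - (1 / 2) ^ l) \<longlonglongrightarrow> x" by simp
qed simp

lemma dyadic_floor_tendsto: "(\<lambda>l. (1 / 2) ^ l *\<^sub>R grid_pt (dyadic_floor l x)) \<longlonglongrightarrow> x"
  using tendsto_Pair[OF dyadic_floor_1_tendsto[of "fst x"] dyadic_floor_1_tendsto[of "snd x"]]
  by (simp add: grid_pt_def dyadic_floor_def)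

lemmas limit_function_at = limit_function_along[OF _ dyadic_floor_tendsto]

lemma limit_function_unique:
  assumes "is_limit_function c k f g" "is_limit_function c k f h"
  shows "g = h"
  using limit_function_at[OF assms(1)] limit_function_at[OF assms(2)]
  by (intro ext) (rule LIMSEQ_unique)

lemma basic_limit_eqI:
  assumes "is_limit_function c k delta g"
  shows "basic_limit c k = g"
  unfolding basic_limit_def delta_def[symmetric]
  using assms limit_function_unique by (intro the_equality) auto

lemma basic_limit_const: "basic_limit (\<lambda>_. a) k = basic_limit (\<lambda>_. a) k'"
proof -
  have "is_limit_function (\<lambda>_. a) k f = is_limit_function (\<lambda>_. a) k' f" for f
    by (intro ext is_limit_function_const)
  then show ?thesis unfolding basic_limit_def by (simp only:)
qed

section \<open>Convergent stationary schemes\<close>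

locale convergent_mask =
  fixes cbar :: mask
  assumes uniform_cbar: "uniform_support (\<lambda>_. cbar)"
    and convergent_cbar: "convergent_regular (\<lambda>_. cbar)"
begin

abbreviation "phibar \<equiv> basic_limit (\<lambda>_. cbar) 1"

lemma ex_radius: "\<exists>R\<ge>0. supported_within R cbar"
  using uniform_support_within[OF uniform_cbar] by blast

definition radius :: int where
  "radius = (SOME R. R \<ge> 0 \<and> supported_within R cbar)"

lemma radius: "radius \<ge> 0" "supported_within radius cbar"
  using someI_ex[OF ex_radius] by (simp_all add: radius_def)

lemma finite_cbar: "finite {\<gamma>. cbar \<gamma> \<noteq> 0}"
  by (rule supported_within_finite[OF radius(2)])

lemma ex_limit_function:
  assumes "\<And>\<alpha>. \<bar>f \<alpha>\<bar> \<le> B"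
  shows "\<exists>g. is_limit_function (\<lambda>_. cbar) k f g"
proof -
  have "bounded (range f)" using assms by (auto simp: bounded_iff)
  then show ?thesis
    using convergent_cbar is_limit_function_const[of cbar k f _ 1]
    unfolding convergent_regular_def by simp
qed

lemma phibar_limit: "is_limit_function (\<lambda>_. cbar) k delta phibar"
proof -
  have "\<bar>delta \<alpha>\<bar> \<le> 1" for \<alpha> by (simp add: delta_def)
  from ex_limit_function[OF this, of 1] obtain g where g: "is_limit_function (\<lambda>_. cbar) 1 delta g" ..
  with basic_limit_eqI[OF g] show ?thesis by (simp add: is_limit_function_const[of cbar k _ _ 1])
qed

text \<open>Scaled by \<open>(1 / 2) ^ l\<close>, the reach \<open>radius * (2 ^ l - 1)\<close>
  stays below \<open>radius\<close>. Lying strictly outside is an open condition, hence it holds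
  eventually for the dyadic approximations of \<open>x\<close>, where the refined
  \<open>delta\<close> is zero.\<close>

lemma phibar_eq_0:
  assumes "\<bar>fst x\<bar> > real_of_int radius \<or> \<bar>snd x\<bar> > real_of_int radius"
  shows "phibar x = 0"
proof -
  let ?a = "\<lambda>l. (1 / 2) ^ l *\<^sub>R grid_pt (dyadic_floor l x)"
  have vanish: "refine (\<lambda>_. cbar) 1 delta l (dyadic_floor l x) = 0"
    if "\<bar>fst (?a l)\<bar> > real_of_int radius \<or> \<bar>snd (?a l)\<bar> > real_of_int radius" for l
  proof (rule refine_delta_eq_0[OF radius(2)])
    have *: "\<bar>z\<bar> > radius * (2 ^ l - 1)" if "\<bar>(1 / 2) ^ l * real_of_int z\<bar> > real_of_int radius" for z :: int
    proof -
      have "real_of_int radius * 2 ^ l < real_of_int \<bar>z\<bar>"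
        using that by (simp add: abs_mult power_one_over field_simps)
      then have "radius * 2 ^ l < \<bar>z\<bar>"
        by (metis of_int_less_iff of_int_mult of_int_numeral of_int_power)
      then show ?thesis using radius(1) by (simp add: algebra_simps)
    qed
    show "radius * (2 ^ l - 1) < \<bar>fst (dyadic_floor l x)\<bar> \<or> radius * (2 ^ l - 1) < \<bar>snd (dyadic_floor l x)\<bar>"
      using that by (auto simp: grid_pt_def intro!: *)
  qed
  have lim: "(\<lambda>l. \<bar>fst (?a l)\<bar>) \<longlonglongrightarrow> \<bar>fst x\<bar>" "(\<lambda>l. \<bar>snd (?a l)\<bar>) \<longlonglongrightarrow> \<bar>snd x\<bar>"
    by (intro tendsto_intros dyadic_floor_tendsto)+
  have "\<forall>\<^sub>F l in sequentially. \<bar>fst (?a l)\<bar> > real_of_int radius \<or> \<bar>snd (?a l)\<bar> > real_of_int radius"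
    using assms
  proof
    assume "\<bar>fst x\<bar> > real_of_int radius"
    from order_tendstoD(1)[OF lim(1) this] show ?thesis by eventually_elim simp
  next
    assume "\<bar>snd x\<bar> > real_of_int radius"
    from order_tendstoD(1)[OF lim(2) this] show ?thesis by eventually_elim simp
  qed
  then have "\<forall>\<^sub>F l in sequentially. refine (\<lambda>_. cbar) 1 delta l (dyadic_floor l x) = 0"
    by eventually_elim (rule vanish)
  then have "(\<lambda>l. refine (\<lambda>_. cbar) 1 delta l (dyadic_floor l x)) \<longlonglongrightarrow> 0"
    by (rule tendsto_eventually)
  with limit_function_at[OF phibar_limit] show ?thesis by (rule LIMSEQ_unique)
qed

lemma phibar_bounded: "\<exists>B. \<forall>x. \<bar>phibar x\<bar> \<le> B"
proof -
  let ?K = "{-real_of_int radius..real_of_int radius} \<times> {-real_of_int radius..real_of_int radius}"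
  have "continuous_on ?K phibar"
    using phibar_limit unfolding is_limit_function_def by (meson continuous_on_subset subset_UNIV)
  moreover have "compact ?K" by (intro compact_Times compact_Icc)
  ultimately have "bounded (phibar ` ?K)" by (intro compact_imp_bounded compact_continuous_image)
  then obtain B where B: "\<And>x. x \<in> ?K \<Longrightarrow> \<bar>phibar x\<bar> \<le> B" by (auto simp: bounded_iff)
  have "\<bar>phibar x\<bar> \<le> max B 0" for x
  proof (cases "x \<in> ?K")
    case False
    then have "phibar x = 0" by (intro phibar_eq_0) (auto simp: mem_Times_iff)
    then show ?thesis by simp
  qed (use B[of x] in auto)
  then show ?thesis by blast
qed

text \<open>From level \<open>l0\<close> on the values are within 1 of the bounded limit function;
  the finitely many earlier levels are covered by the sum of the powers of the operator
  norm.\<close>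

lemma refine_delta_bounded: "\<exists>M\<ge>0. \<forall>l \<alpha>. \<bar>refine (\<lambda>_. cbar) 0 delta l \<alpha>\<bar> \<le> M"
proof -
  obtain B where B: "\<And>x. \<bar>phibar x\<bar> \<le> B" using phibar_bounded by blast
  obtain l0 where l0: "\<And>l \<alpha>. l \<ge> l0 \<Longrightarrow>
      \<bar>phibar ((1 / 2) ^ l *\<^sub>R grid_pt \<alpha>) - refine (\<lambda>_. cbar) 0 delta l \<alpha>\<bar> \<le> 1"
    using phibar_limit[of 0, unfolded is_limit_function_iff, THEN conjunct2, THEN spec, THEN mp, of 1]
    unfolding eventually_sequentially by auto
  have nn: "0 \<le> subdiv_norm cbar" by (rule subdiv_norm_nonneg[OF finite_cbar])
  have pow: "\<bar>refine (\<lambda>_. cbar) 0 delta l \<alpha>\<bar> \<le> subdiv_norm cbar ^ l" for l \<alpha>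
  proof (induction l arbitrary: \<alpha>)
    case 0
    show ?case by (simp add: delta_def)
  next
    case (Suc l)
    from abs_subdiv_le[OF finite_cbar Suc] show ?case by simp
  qed
  have "\<bar>refine (\<lambda>_. cbar) 0 delta l \<alpha>\<bar> \<le> \<bar>B\<bar> + 1 + (\<Sum>i<l0. subdiv_norm cbar ^ i)" for l \<alpha>
  proof (cases "l \<ge> l0")
    case True
    have "0 \<le> (\<Sum>i<l0. subdiv_norm cbar ^ i)" by (intro sum_nonneg) (simp add: nn)
    with l0[OF True, of \<alpha>] B[of "(1 / 2) ^ l *\<^sub>R grid_pt \<alpha>"] show ?thesis by linarith
  next
    case False
    then have "subdiv_norm cbar ^ l \<le> (\<Sum>i<l0. subdiv_norm cbar ^ i)"
      by (intro member_le_sum) (auto simp: nn)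
    with pow[of l \<alpha>] show ?thesis by linarith
  qed
  moreover have "0 \<le> \<bar>B\<bar> + 1 + (\<Sum>i<l0. subdiv_norm cbar ^ i)"
    by (intro add_nonneg_nonneg sum_nonneg) (auto simp: nn)
  ultimately show ?thesis by blast
qed

text \<open>Locality leaves boundedly many translates of the refined \<open>delta\<close> at each point, which
  makes an appeal to uniform boundedness principles unnecessary.\<close>

lemma ex_stability:
  "\<exists>M\<ge>0. \<forall>k f B l \<alpha>. (\<forall>\<beta>. \<bar>f \<beta>\<bar> \<le> B) \<longrightarrow> \<bar>refine (\<lambda>_. cbar) k f l \<alpha>\<bar> \<le> M * B"
proof -
  obtain D where D: "D \<ge> 0" "\<And>l \<alpha>. \<bar>refine (\<lambda>_. cbar) 0 delta l \<alpha>\<bar> \<le> D"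
    using refine_delta_bounded by blast
  let ?M = "(2 * real_of_int radius + 2)\<^sup>2 * D"
  have "\<bar>refine (\<lambda>_. cbar) k f l \<alpha>\<bar> \<le> ?M * B" if f: "\<And>\<beta>. \<bar>f \<beta>\<bar> \<le> B" for k f B l \<alpha>
  proof -
    have B: "0 \<le> B" using f[of 0] by linarith
    have "\<bar>refine (\<lambda>_. cbar) k f l \<alpha>\<bar> = \<bar>refine (\<lambda>_. cbar) 0 f l \<alpha>\<bar>"
      by (simp add: refine_const[of cbar k f l 0])
    also have "\<dots> \<le> (\<Sum>\<beta>\<in>near radius l \<alpha>. \<bar>f \<beta> * refine (\<lambda>_. cbar) 0 delta l (\<alpha> - dscale l \<beta>)\<bar>)"
      by (subst refine_eq_sum[OF radius(2) finite_near[OF radius(1)] order_refl]) (rule sum_abs)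
    also have "\<dots> \<le> (\<Sum>\<beta>\<in>near radius l \<alpha>. B * D)"
      by (intro sum_mono) (simp add: abs_mult mult_mono f D B)
    also have "\<dots> = real (card (near radius l \<alpha>)) * (B * D)" by simp
    also have "\<dots> \<le> (2 * real_of_int radius + 2)\<^sup>2 * (B * D)"
      by (intro mult_right_mono card_near_le radius(1)) (simp add: B D)
    finally show ?thesis by (simp add: algebra_simps)
  qed
  moreover have "?M \<ge> 0" using D by simp
  ultimately show ?thesis by blast
qed

definition stability :: real where
  "stability = (SOME M. M \<ge> 0 \<and> (\<forall>k f B l \<alpha>. (\<forall>\<beta>. \<bar>f \<beta>\<bar> \<le> B) \<longrightarrow> \<bar>refine (\<lambda>_. cbar) k f l \<alpha>\<bar> \<le> M * B))"

lemma stability_nonneg: "0 \<le> stability"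
  and refine_cbar_le: "(\<And>\<beta>. \<bar>f \<beta>\<bar> \<le> B) \<Longrightarrow> \<bar>refine (\<lambda>_. cbar) k f l \<alpha>\<bar> \<le> stability * B"
  using someI_ex[OF ex_stability] unfolding stability_def by blast+

text \<open>The control points at levels \<open>l\<close> and \<open>l + 1\<close> that belong to a neighbourhood of a point
  \<open>x\<close> with \<open>g x \<noteq> 0\<close> are all close to \<open>g x\<close>, so that the weights of the mask sum to one.\<close>

lemma subdiv_cbar_one: "subdiv cbar (\<lambda>_. 1) = (\<lambda>_. 1)"
proof
  fix \<alpha> :: "int \<times> int"
  obtain f g where g: "is_limit_function (\<lambda>_. cbar) 1 f g" and "g \<noteq> (\<lambda>_. 0)"
    using convergent_cbar unfolding convergent_regular_def by blast
  then obtain x where x: "g x \<noteq> 0" by blast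
  let ?J = "{\<beta>. cbar (\<alpha> - (\<beta> + \<beta>)) \<noteq> 0}"
  have fin: "finite ?J" by (rule finite_support_shift[OF finite_cbar])
  define a where "a l = dyadic_floor l x" for l
  have a: "(\<lambda>l. (1 / 2) ^ l *\<^sub>R grid_pt (a l)) \<longlonglongrightarrow> x" unfolding a_def by (rule dyadic_floor_tendsto)
  have small: "(\<lambda>l. (1 / 2) ^ l *\<^sub>R grid_pt \<beta>) \<longlonglongrightarrow> 0" for \<beta>
  proof -
    have "(\<lambda>l. (1 / 2 :: real) ^ l *\<^sub>R grid_pt \<beta>) \<longlonglongrightarrow> 0 *\<^sub>R grid_pt \<beta>"
      by (intro tendsto_intros LIMSEQ_power_zero) simp
    then show ?thesis by simp
  qed
  have "(\<lambda>l. refine (\<lambda>_. cbar) 1 f l (\<beta> + a l)) \<longlonglongrightarrow> g x" for \<beta>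
    using tendsto_add[OF small[of \<beta>] a]
    by (intro limit_function_along[OF g]) (simp add: grid_pt_add scaleR_add_right)
  then have 1: "(\<lambda>l. \<Sum>\<beta>\<in>?J. cbar (\<alpha> - (\<beta> + \<beta>)) * refine (\<lambda>_. cbar) 1 f l (\<beta> + a l))
      \<longlonglongrightarrow> (\<Sum>\<beta>\<in>?J. cbar (\<alpha> - (\<beta> + \<beta>)) * g x)"
    by (intro tendsto_intros)
  have "(\<lambda>l. (1 / 2) ^ Suc l *\<^sub>R grid_pt (\<alpha> + (a l + a l))) \<longlonglongrightarrow> 0 + x"
  proof -
    have "(1 / 2) ^ Suc l *\<^sub>R grid_pt (\<alpha> + (a l + a l))
        = (1 / 2) ^ Suc l *\<^sub>R grid_pt \<alpha> + (1 / 2) ^ l *\<^sub>R grid_pt (a l)" for l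
      by (simp add: grid_pt_def algebra_simps)
    then show ?thesis using tendsto_add[OF LIMSEQ_Suc[OF small[of \<alpha>]] a] by (simp del: power_Suc)
  qed
  \<comment> \<open>\<open>limit_function_along\<close> wants the index at level \<open>l\<close>,
    while the approximation found concerns level \<open>Suc l\<close>. The truncated
    \<open>l - 1\<close> at \<open>l = 0\<close> does not affect the limit.\<close>
  then have "(\<lambda>l. (1 / 2) ^ l *\<^sub>R grid_pt (\<alpha> + (a (l - 1) + a (l - 1)))) \<longlonglongrightarrow> x"
    by (subst filterlim_sequentially_Suc[symmetric]) (simp del: power_Suc)
  from LIMSEQ_Suc[OF limit_function_along[OF g this]]
  have 2: "(\<lambda>l. subdiv cbar (refine (\<lambda>_. cbar) 1 f l) (\<alpha> + (a l + a l))) \<longlonglongrightarrow> g x" by simp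
  have "subdiv cbar h (\<alpha> + (b + b)) = (\<Sum>\<beta>\<in>?J. cbar (\<alpha> - (\<beta> + \<beta>)) * h (\<beta> + b))" for h b
  proof -
    have "subdiv cbar h (\<alpha> + (b + b)) = subdiv cbar (\<lambda>\<beta>. h (\<beta> + b)) \<alpha>"
      using fun_cong[OF subdiv_translate[of cbar h "- b"], of \<alpha>] by (simp add: algebra_simps)
    also have "\<dots> = (\<Sum>\<beta>\<in>?J. cbar (\<alpha> - (\<beta> + \<beta>)) * h (\<beta> + b))"
      by (rule subdiv_eq_sum[OF fin]) simp
    finally show ?thesis .
  qed
  with 2 have "(\<lambda>l. \<Sum>\<beta>\<in>?J. cbar (\<alpha> - (\<beta> + \<beta>)) * refine (\<lambda>_. cbar) 1 f l (\<beta> + a l)) \<longlonglongrightarrow> g x"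
    by (simp only:)
  with 1 have "(\<Sum>\<beta>\<in>?J. cbar (\<alpha> - (\<beta> + \<beta>)) * g x) = g x"
    by (rule LIMSEQ_unique)
  then have "(\<Sum>\<beta>\<in>?J. cbar (\<alpha> - (\<beta> + \<beta>))) = 1"
    using x by (simp add: sum_distrib_right[symmetric])
  then show "subdiv cbar (\<lambda>_. 1) \<alpha> = 1"
    by (subst subdiv_eq_sum[OF fin]) auto
qed

lemma refine_cbar_one: "refine (\<lambda>_. cbar) k (\<lambda>_. 1) l = (\<lambda>_. 1)"
  by (induction l) (simp_all add: subdiv_cbar_one)

text \<open>The constant sequence 1 is reproduced at every level; expanding it in translates of
  \<open>delta\<close> and letting the level grow gives the identity for the limit
  functions.\<close>

lemma phibar_partition_of_unity:
  assumes "finite J" and J: "\<And>\<beta>. phibar (x - grid_pt \<beta>) \<noteq> 0 \<Longrightarrow> \<beta> \<in> J"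
  shows "(\<Sum>\<beta>\<in>J. phibar (x - grid_pt \<beta>)) = 1"
proof -
  \<comment> \<open>This set contains the influencing indices of every level, because
    \<open>\<lfloor>2 ^ l * y\<rfloor> div 2 ^ l = \<lfloor>y\<rfloor>\<close>. Terms outside
    \<open>J\<close> may be nonzero at finite levels and vanish only in the limit, hence the union
    \<open>J \<union> box\<close>.\<close>
  define box where "box = {\<lfloor>fst x\<rfloor> - radius - 2..\<lfloor>fst x\<rfloor> + radius + 2} \<times>
                          {\<lfloor>snd x\<rfloor> - radius - 2..\<lfloor>snd x\<rfloor> + radius + 2}"
  have fin: "finite (J \<union> box)" using assms by (simp add: box_def)
  have near: "near radius l (dyadic_floor l x) \<subseteq> J \<union> box" for l
  proof -
    have *: "b \<in> {\<lfloor>y\<rfloor> - radius - 2..\<lfloor>y\<rfloor> + radius + 2}"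
      if "\<bar>2 ^ l * b - \<lfloor>2 ^ l * y\<rfloor>\<bar> \<le> radius * (2 ^ l - 1)" for b :: int and y :: real
    proof -
      have "\<lfloor>2 ^ l * y\<rfloor> div 2 ^ l = \<lfloor>2 ^ l * y / real_of_int (2 ^ l)\<rfloor>"
        by (rule floor_divide_real_eq_div[symmetric]) simp
      then have "\<lfloor>2 ^ l * y\<rfloor> div 2 ^ l = \<lfloor>y\<rfloor>" by simp
      then show ?thesis
        using subsetD[OF near_subset_box[OF radius(1), of l "(\<lfloor>2 ^ l * y\<rfloor>, \<lfloor>2 ^ l * y\<rfloor>)"], of "(b, b)"] that
        by (auto simp: near_def)
    qed
    show ?thesis unfolding near_def box_def dyadic_floor_def using * by auto
  qed
  have "(\<lambda>l. refine (\<lambda>_. cbar) 1 delta l (dyadic_floor l x - dscale l \<beta>)) \<longlonglongrightarrow> phibar (x - grid_pt \<beta>)" for \<beta>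
  proof -
    have "dyadic_floor l x - dscale l \<beta> = dyadic_floor l (x - grid_pt \<beta>)" for l
    proof -
      have "\<lfloor>2 ^ l * (y - real_of_int b)\<rfloor> = \<lfloor>2 ^ l * y\<rfloor> - 2 ^ l * b" for y :: real and b :: int
        using floor_diff_of_int[of "2 ^ l * y" "2 ^ l * b"] by (simp add: algebra_simps)
      then show ?thesis by (simp add: dyadic_floor_def dscale_def grid_pt_def)
    qed
    then show ?thesis using limit_function_at[OF phibar_limit[of 1], of "x - grid_pt \<beta>"] by simp
  qed
  then have "(\<lambda>l. \<Sum>\<beta>\<in>J \<union> box. 1 * refine (\<lambda>_. cbar) 1 delta l (dyadic_floor l x - dscale l \<beta>))
      \<longlonglongrightarrow> (\<Sum>\<beta>\<in>J \<union> box. 1 * phibar (x - grid_pt \<beta>))"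
    by (intro tendsto_intros)
  moreover have "(\<Sum>\<beta>\<in>J \<union> box. 1 * refine (\<lambda>_. cbar) 1 delta l (dyadic_floor l x - dscale l \<beta>)) = 1" for l
    using refine_eq_sum[OF radius(2) fin near, of 1 "\<lambda>_. 1" l] by (simp add: refine_cbar_one)
  ultimately have "(\<lambda>l :: nat. 1) \<longlonglongrightarrow> (\<Sum>\<beta>\<in>J \<union> box. 1 * phibar (x - grid_pt \<beta>))"
    by (simp only:)
  from LIMSEQ_unique[OF this tendsto_const]
  have "(\<Sum>\<beta>\<in>J \<union> box. phibar (x - grid_pt \<beta>)) = 1" by simp
  moreover have "(\<Sum>\<beta>\<in>J \<union> box. phibar (x - grid_pt \<beta>)) = (\<Sum>\<beta>\<in>J. phibar (x - grid_pt \<beta>))"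
    using J fin by (intro sum.mono_neutral_right) auto
  ultimately show ?thesis by simp
qed

end

section \<open>Asymptotically equivalent schemes\<close>

locale asymptotically_equivalent_masks = convergent_mask +
  fixes c :: "nat \<Rightarrow> mask"
  assumes uniform_c: "uniform_support c"
    and summable_defect: "summable (\<lambda>k. subdiv_norm (\<lambda>\<alpha>. c (Suc k) \<alpha> - cbar \<alpha>))"
begin

definition defect :: "nat \<Rightarrow> real" where
  "defect k = subdiv_norm (\<lambda>\<alpha>. c k \<alpha> - cbar \<alpha>)"

text \<open>For \<open>k \<ge> 1\<close> this is the sum of \<open>defect j\<close> over all
  \<open>j \<ge> k\<close>; the form with \<open>Suc\<close> keeps index 0 out of the
  series.\<close>

definition defect_tail :: "nat \<Rightarrow> real" where
  "defect_tail k = (\<Sum>i. defect (Suc (i + (k - 1))))"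

lemma finite_c: "k \<ge> 1 \<Longrightarrow> finite {\<gamma>. c k \<gamma> \<noteq> 0}"
  using uniform_support_within[OF uniform_c] supported_within_finite by metis

lemma finite_c_diff: "k \<ge> 1 \<Longrightarrow> finite {\<gamma>. c k \<gamma> - cbar \<gamma> \<noteq> 0}"
  by (rule finite_subset[OF _ finite_UnI[OF finite_c[of k] finite_cbar]]) auto

lemma defect_nonneg: "k \<ge> 1 \<Longrightarrow> 0 \<le> defect k"
  unfolding defect_def by (rule subdiv_norm_nonneg[OF finite_c_diff])

lemma summable_defect_shift: "summable (\<lambda>i. defect (Suc (i + m)))"
  using summable_ignore_initial_segment[OF summable_defect, of m] by (simp add: defect_def)

lemma sum_defect_le:
  assumes "k \<ge> 1"
  shows "(\<Sum>j<l. defect (k + j)) \<le> defect_tail k"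
proof -
  have "(\<Sum>j<l. defect (k + j)) = (\<Sum>j<l. defect (Suc (j + (k - 1))))"
    using assms by (intro sum.cong) (auto simp: algebra_simps)
  also have "\<dots> \<le> defect_tail k"
    unfolding defect_tail_def
    by (intro sum_le_suminf summable_defect_shift) (auto intro: defect_nonneg)
  finally show ?thesis .
qed

lemma defect_tail_tendsto: "defect_tail \<longlonglongrightarrow> 0"
proof -
  have "(\<lambda>k. \<Sum>i. defect (Suc (i + k))) \<longlonglongrightarrow> 0"
    using suminf_exist_split[OF _ summable_defect_shift[of 0]] by (intro LIMSEQ_I) simp
  then show ?thesis
    by (subst filterlim_sequentially_Suc[symmetric]) (simp add: defect_tail_def)
qed

lemma defect_tail_le: "k \<ge> 1 \<Longrightarrow> defect_tail k \<le> defect_tail 1"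
proof -
  assume k: "k \<ge> 1"
  have "defect_tail 1 = (\<Sum>i. defect (Suc (i + (k - 1)))) + (\<Sum>i<k - 1. defect (Suc i))"
    using suminf_split_initial_segment[OF summable_defect_shift[of 0], of "k - 1"]
    by (simp add: defect_tail_def)
  moreover have "0 \<le> (\<Sum>i<k - 1. defect (Suc i))" by (intro sum_nonneg defect_nonneg) simp
  ultimately show ?thesis by (simp add: defect_tail_def)
qed

text \<open>Discrete Duhamel formula: the defect of the mask at step \<open>j\<close> acts on the
  perturbed sequence and is then transported by the remaining \<open>l - Suc j\<close> stationary
  steps.\<close>

lemma refine_telescope:
  assumes "k \<ge> 1"
  shows "refine c k f l = (\<lambda>\<alpha>. refine (\<lambda>_. cbar) 0 f l \<alpha> + (\<Sum>j<l.
    refine (\<lambda>_. cbar) 0 (subdiv (\<lambda>\<gamma>. c (k + j) \<gamma> - cbar \<gamma>) (refine c k f j)) (l - Suc j) \<alpha>))"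
    (is "_ = (\<lambda>\<alpha>. _ + (\<Sum>j<l. ?d l j \<alpha>))")
proof (induction l)
  case 0
  show ?case by simp
next
  case (Suc l)
  let ?D = "subdiv (\<lambda>\<gamma>. c (k + l) \<gamma> - cbar \<gamma>) (refine c k f l)"
  have step: "subdiv cbar (?d l j) = ?d (Suc l) j" if "j < l" for j
  proof -
    from that have "Suc l - Suc j = Suc (l - Suc j)" by simp
    then show ?thesis by simp
  qed
  have "refine c k f (Suc l) \<alpha> = refine (\<lambda>_. cbar) 0 f (Suc l) \<alpha> + (\<Sum>j<Suc l. ?d (Suc l) j \<alpha>)" for \<alpha>
  proof -
    have "refine c k f (Suc l) \<alpha> = subdiv cbar (refine c k f l) \<alpha> + ?D \<alpha>"
      using subdiv_mask_diff[OF finite_c[of "k + l"] finite_cbar, of "refine c k f l" \<alpha>] assms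
      by simp
    also have "subdiv cbar (refine c k f l) \<alpha>
        = subdiv cbar (\<lambda>\<alpha>. refine (\<lambda>_. cbar) 0 f l \<alpha> + (\<Sum>j<l. 1 * ?d l j \<alpha>)) \<alpha>"
      by (subst Suc.IH) simp
    also have "\<dots> = refine (\<lambda>_. cbar) 0 f (Suc l) \<alpha> + (\<Sum>j<l. 1 * subdiv cbar (?d l j) \<alpha>)"
      by (subst subdiv_add[OF finite_cbar], subst subdiv_sum[OF finite_cbar]) simp
    also have "(\<Sum>j<l. 1 * subdiv cbar (?d l j) \<alpha>) = (\<Sum>j<l. ?d (Suc l) j \<alpha>)"
      by (intro sum.cong refl) (use step in \<open>simp del: refine.simps\<close>)
    finally show ?thesis by (simp del: refine.simps(2))
  qed
  then show ?case by (rule ext)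
qed

text \<open>The Gronwall constant: the product of the factors
  \<open>1 + stability * defect j\<close> is bounded by an exponential, and the tail from level 1
  dominates all later tails, so the bound is uniform in the starting level.\<close>

definition growth :: real where
  "growth = stability * exp (stability * defect_tail 1)"

lemma growth_nonneg: "0 \<le> growth"
  by (simp add: growth_def stability_nonneg)

lemma refine_telescope_term_le:
  assumes "k \<ge> 1" and "\<And>\<beta>. \<bar>h \<beta>\<bar> \<le> E"
  shows "\<bar>refine (\<lambda>_. cbar) 0 (subdiv (\<lambda>\<gamma>. c k \<gamma> - cbar \<gamma>) h) l \<alpha>\<bar> \<le> stability * defect k * E"
  using refine_cbar_le[OF abs_subdiv_le[OF finite_c_diff[OF assms(1)] assms(2)]]
  by (simp add: defect_def mult.assoc)

lemma refine_bounded: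
  assumes k: "k \<ge> 1" and f: "\<And>\<beta>. \<bar>f \<beta>\<bar> \<le> B"
  shows "\<bar>refine c k f l \<alpha>\<bar> \<le> growth * B"
proof -
  have B: "0 \<le> B" using f[of 0] by linarith
  have "\<forall>\<alpha>. \<bar>refine c k f l \<alpha>\<bar> \<le> stability * B * (\<Prod>j<l. 1 + stability * defect (k + j))"
  proof (rule discrete_gronwall[where bnd = "\<lambda>l E. \<forall>\<alpha>. \<bar>refine c k f l \<alpha>\<bar> \<le> E"], intro allI)
    fix l E \<alpha>
    assume E: "\<And>j. j < l \<Longrightarrow> \<forall>\<alpha>. \<bar>refine c k f j \<alpha>\<bar> \<le> E j"
    have "\<bar>refine (\<lambda>_. cbar) 0 f l \<alpha>\<bar> \<le> stability * B" by (rule refine_cbar_le[OF f])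
    moreover have "\<bar>\<Sum>j<l. refine (\<lambda>_. cbar) 0
        (subdiv (\<lambda>\<gamma>. c (k + j) \<gamma> - cbar \<gamma>) (refine c k f j)) (l - Suc j) \<alpha>\<bar>
        \<le> (\<Sum>j<l. stability * defect (k + j) * E j)"
      using k E by (intro order_trans[OF sum_abs] sum_mono refine_telescope_term_le) auto
    ultimately show "\<bar>refine c k f l \<alpha>\<bar> \<le> stability * B + (\<Sum>j<l. stability * defect (k + j) * E j)"
      by (subst refine_telescope[OF k]) linarith
  qed
  then have "\<bar>refine c k f l \<alpha>\<bar> \<le> stability * B * (\<Prod>j<l. 1 + stability * defect (k + j))" by blast
  also have "\<dots> \<le> stability * B * exp (\<Sum>j<l. stability * defect (k + j))"
    using k by (intro mult_left_mono prod_one_plus_le_exp mult_nonneg_nonneg stability_nonneg B defect_nonneg) auto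
  also have "\<dots> \<le> stability * B * exp (stability * defect_tail 1)"
  proof (intro mult_left_mono mult_nonneg_nonneg stability_nonneg B)
    have "(\<Sum>j<l. defect (k + j)) \<le> defect_tail 1"
      using sum_defect_le[OF k] defect_tail_le[OF k] by (rule order_trans)
    then show "exp (\<Sum>j<l. stability * defect (k + j)) \<le> exp (stability * defect_tail 1)"
      by (simp add: sum_distrib_left[symmetric] mult_left_mono stability_nonneg)
  qed
  finally show ?thesis by (simp add: growth_def mult_ac)
qed

text \<open>The Duhamel formula once more, now with the perturbed sequence known to be bounded. The
  estimate is uniform in the number of steps and small for a late starting level
  \<open>k\<close>.\<close>

lemma refine_diff_le:
  assumes k: "k \<ge> 1" and f: "\<And>\<beta>. \<bar>f \<beta>\<bar> \<le> B"
  shows "\<bar>refine (\<lambda>_. cbar) k' f l \<alpha> - refine c k f l \<alpha>\<bar> \<le> stability * growth * B * defect_tail k"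
proof -
  have B: "0 \<le> B" using f[of 0] by linarith
  have "\<bar>refine (\<lambda>_. cbar) k' f l \<alpha> - refine c k f l \<alpha>\<bar>
      = \<bar>\<Sum>j<l. refine (\<lambda>_. cbar) 0
          (subdiv (\<lambda>\<gamma>. c (k + j) \<gamma> - cbar \<gamma>) (refine c k f j)) (l - Suc j) \<alpha>\<bar>"
    by (subst refine_telescope[OF k]) (simp add: refine_const[of cbar k' f l 0])
  also have "\<dots> \<le> (\<Sum>j<l. stability * defect (k + j) * (growth * B))"
    using k by (intro order_trans[OF sum_abs] sum_mono refine_telescope_term_le refine_bounded f) auto
  also have "\<dots> = stability * growth * B * (\<Sum>j<l. defect (k + j))"
    by (simp add: sum_distrib_left mult_ac)
  also have "\<dots> \<le> stability * growth * B * defect_tail k"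
    by (intro mult_left_mono sum_defect_le k mult_nonneg_nonneg stability_nonneg growth_nonneg B)
  finally show ?thesis .
qed

text \<open>The limit is the uniform limit, as \<open>m\<close> tends to infinity, of the limit functions
  obtained by switching to the stationary scheme after \<open>m\<close> steps.\<close>

lemma ex_limit_function_c:
  assumes k: "k \<ge> 1" and f: "\<And>\<beta>. \<bar>f \<beta>\<bar> \<le> B"
  shows "\<exists>g. is_limit_function c k f g"
proof -
  define F where "F = refine c k f"
  \<comment> \<open>The bound of \<open>refine_diff_le\<close> for the data \<open>F m\<close>,
    which are bounded by \<open>growth * B\<close>, refined from level \<open>k + m\<close>
    on.\<close>
  define \<eta> where "\<eta> m = stability * growth * (growth * B) * defect_tail (k + m)" for m
  have F: "\<bar>F m \<beta>\<bar> \<le> growth * B" for m \<beta>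
    unfolding F_def by (rule refine_bounded[OF k f])
  have "\<exists>g. is_limit_function (\<lambda>_. cbar) 1 (F m) g" for m
    by (rule ex_limit_function[OF F])
  then obtain G where G: "\<And>m. is_limit_function (\<lambda>_. cbar) 1 (F m) (G m)" by metis
  \<comment> \<open>\<open>G m\<close> lives in coordinates where the grid of step \<open>m\<close>
    has unit mesh; the factor \<open>2 ^ m\<close> returns to the initial grid.\<close>
  define g where "g m x = G m (2 ^ m *\<^sub>R x)" for m x
  have cont: "continuous_on UNIV (g m)" for m
  proof -
    have "continuous_on UNIV (G m)" using G unfolding is_limit_function_def by blast
    then show ?thesis unfolding g_def
      by (rule continuous_on_compose2[of UNIV]) (auto intro!: continuous_intros)
  qed
  have \<eta>: "\<eta> \<longlonglongrightarrow> 0"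
  proof -
    have "(\<lambda>m. defect_tail (k + m)) \<longlonglongrightarrow> 0"
      using LIMSEQ_ignore_initial_segment[OF defect_tail_tendsto, of k] by (simp add: add.commute)
    from tendsto_mult_right_zero[OF this] show ?thesis unfolding \<eta>_def .
  qed
  have approx: "\<forall>\<^sub>F l in sequentially. \<forall>\<alpha>. \<bar>g m ((1 / 2) ^ l *\<^sub>R grid_pt \<alpha>) - F l \<alpha>\<bar> \<le> \<eta> m + e"
    if e: "e > 0" for m e
  proof -
    from G[of m, unfolded is_limit_function_iff, THEN conjunct2, THEN spec, THEN mp, OF e]
    obtain l0 where l0: "\<And>l \<alpha>. l \<ge> l0 \<Longrightarrow>
        \<bar>G m ((1 / 2) ^ l *\<^sub>R grid_pt \<alpha>) - refine (\<lambda>_. cbar) 1 (F m) l \<alpha>\<bar> \<le> e"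
      unfolding eventually_sequentially by blast
    have "\<bar>g m ((1 / 2) ^ l *\<^sub>R grid_pt \<alpha>) - F l \<alpha>\<bar> \<le> \<eta> m + e" if "l \<ge> m + l0" for l \<alpha>
    proof -
      from that obtain i where l: "l = m + i" and i: "i \<ge> l0" using le_Suc_ex by force
      have "(2 :: real) ^ m * (1 / 2) ^ l = (1 / 2) ^ i" by (simp add: l power_add power_one_over)
      then have "g m ((1 / 2) ^ l *\<^sub>R grid_pt \<alpha>) = G m ((1 / 2) ^ i *\<^sub>R grid_pt \<alpha>)"
        by (simp add: g_def)
      moreover have "\<bar>refine (\<lambda>_. cbar) 1 (F m) i \<alpha> - F l \<alpha>\<bar> \<le> \<eta> m"
        using refine_diff_le[of "k + m", OF _ F] k by (simp add: \<eta>_def F_def l refine_add)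
      ultimately show ?thesis using l0[OF i, of \<alpha>] by linarith
    qed
    then show ?thesis unfolding eventually_sequentially by blast
  qed
  \<comment> \<open>Along the dyadic approximations of \<open>x\<close> both functions are compared
    with the same values \<open>F l\<close>; continuity transfers the estimate to
    \<open>x\<close>.\<close>
  have cauchy: "\<bar>g m x - g m' x\<bar> \<le> \<eta> m + \<eta> m'" for m m' x
  proof (rule field_le_epsilon)
    fix e :: real assume "e > 0"
    then have e: "e / 2 > 0" by simp
    let ?x = "\<lambda>l. (1 / 2) ^ l *\<^sub>R grid_pt (dyadic_floor l x)"
    have g: "(\<lambda>l. g m (?x l)) \<longlonglongrightarrow> g m x" for m
      using cont[of m] unfolding continuous_on_eq_continuous_at[OF open_UNIV]
      by (intro isCont_tendsto_compose[OF _ dyadic_floor_tendsto]) blast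
    have lim: "(\<lambda>l. \<bar>g m (?x l) - g m' (?x l)\<bar>) \<longlonglongrightarrow> \<bar>g m x - g m' x\<bar>"
      by (intro tendsto_intros g)
    have ev: "\<forall>\<^sub>F l in sequentially. \<bar>g m (?x l) - g m' (?x l)\<bar> \<le> \<eta> m + \<eta> m' + e"
      using approx[OF e, of m] approx[OF e, of m']
    proof eventually_elim
      case (elim l)
      from elim(1)[rule_format, of "dyadic_floor l x"] elim(2)[rule_format, of "dyadic_floor l x"]
      show ?case by linarith
    qed
    show "\<bar>g m x - g m' x\<bar> \<le> \<eta> m + \<eta> m' + e"
      by (rule tendsto_upperbound[OF lim ev]) simp
  qed
  have "uniformly_Cauchy_on UNIV g"
  proof (rule uniformly_Cauchy_onI)
    fix e :: real assume "e > 0"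
    then have "\<forall>\<^sub>F m in sequentially. \<eta> m < e / 2" by (intro order_tendstoD(2)[OF \<eta>]) simp
    then obtain M where M: "\<And>m. m \<ge> M \<Longrightarrow> \<eta> m < e / 2" unfolding eventually_sequentially by blast
    have "dist (g m x) (g n x) < e" if "m \<ge> M" "n \<ge> M" for m n x
      using M[OF that(1)] M[OF that(2)] cauchy[of m x n] by (simp add: dist_real_def)
    then show "\<exists>M. \<forall>x\<in>UNIV. \<forall>m\<ge>M. \<forall>n\<ge>M. dist (g m x) (g n x) < e" by blast
  qed
  then obtain g' where g': "uniform_limit UNIV g g' sequentially"
    using Cauchy_uniformly_convergent uniformly_convergent_on_def by blast
  have "continuous_on UNIV g'"
    by (rule uniform_limit_theorem[OF _ g']) (simp_all add: cont)
  moreover have close: "\<bar>g m x - g' x\<bar> \<le> \<eta> m" for m x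
  proof -
    have "(\<lambda>m'. \<bar>g m x - g m' x\<bar>) \<longlonglongrightarrow> \<bar>g m x - g' x\<bar>"
      by (intro tendsto_intros tendsto_uniform_limitI[OF g']) simp
    moreover have "(\<lambda>m'. \<eta> m + \<eta> m') \<longlonglongrightarrow> \<eta> m + 0" by (intro tendsto_intros \<eta>)
    ultimately have "\<bar>g m x - g' x\<bar> \<le> \<eta> m + 0" by (rule LIMSEQ_le) (use cauchy in blast)
    then show ?thesis by simp
  qed
  moreover have "\<forall>\<^sub>F l in sequentially. \<forall>\<alpha>. \<bar>g' ((1 / 2) ^ l *\<^sub>R grid_pt \<alpha>) - F l \<alpha>\<bar> \<le> e"
    if "e > 0" for e
  proof -
    have "\<forall>\<^sub>F m in sequentially. \<eta> m < e / 4" using that by (intro order_tendstoD(2)[OF \<eta>]) simp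
    then obtain m where m: "\<eta> m < e / 4" unfolding eventually_sequentially by blast
    have "e / 2 > 0" using that by simp
    from approx[OF this, of m] show ?thesis
    proof eventually_elim
      case (elim l)
      show ?case
      proof
        fix \<alpha>
        from elim[rule_format, of \<alpha>] close[of m "(1 / 2) ^ l *\<^sub>R grid_pt \<alpha>"] m
        show "\<bar>g' ((1 / 2) ^ l *\<^sub>R grid_pt \<alpha>) - F l \<alpha>\<bar> \<le> e" by linarith
      qed
    qed
  qed
  ultimately show ?thesis unfolding is_limit_function_iff F_def by blast
qed

text \<open>The bound in \<open>refine_diff_le\<close> does not involve the number of steps, so it
  survives the passage to the limit.\<close>

lemma basic_limit_close:
  assumes k: "k \<ge> 1"
  shows "\<bar>basic_limit c k x - phibar x\<bar> \<le> stability * growth * defect_tail k"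
proof -
  have d: "\<bar>delta \<beta>\<bar> \<le> 1" for \<beta> by (simp add: delta_def)
  from ex_limit_function_c[OF k d] obtain g where g: "is_limit_function c k delta g" ..
  have lim: "(\<lambda>l. \<bar>refine c k delta l (dyadic_floor l x) - refine (\<lambda>_. cbar) k delta l (dyadic_floor l x)\<bar>)
      \<longlonglongrightarrow> \<bar>basic_limit c k x - phibar x\<bar>"
    unfolding basic_limit_eqI[OF g]
    by (intro tendsto_intros limit_function_at[OF g] limit_function_at[OF phibar_limit])
  show ?thesis
  proof (rule LIMSEQ_le_const2[OF lim], intro exI allI impI)
    fix l
    from refine_diff_le[OF k d, where k' = k and l = l and \<alpha> = "dyadic_floor l x"]
    show "\<bar>refine c k delta l (dyadic_floor l x) - refine (\<lambda>_. cbar) k delta l (dyadic_floor l x)\<bar>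
        \<le> stability * growth * defect_tail k" by (simp add: abs_minus_commute)
  qed
qed

text \<open>Existence of limits comes from the asymptotic equivalence. Non-singularity supplies a
  nonzero one: the limit of \<open>delta\<close> cannot vanish.\<close>

lemma convergent_regular_c:
  assumes "\<And>f. bounded (range f) \<Longrightarrow> is_limit_function c 1 f (\<lambda>_. 0) \<Longrightarrow> f = (\<lambda>_. 0)"
  shows "convergent_regular c"
proof -
  have ex: "\<exists>g. is_limit_function c 1 f g" if "bounded (range f)" for f
  proof -
    from that obtain B where "\<And>\<beta>. \<bar>f \<beta>\<bar> \<le> B" by (auto simp: bounded_iff)
    then show ?thesis by (intro ex_limit_function_c) auto
  qed
  have bd: "bounded (range delta)" by (auto simp: delta_def bounded_iff intro!: exI[of _ 1])
  from ex[OF bd] obtain g where g: "is_limit_function c 1 delta g" ..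
  have "delta 0 \<noteq> 0" by (simp add: delta_def)
  with assms[OF bd] g have "g \<noteq> (\<lambda>_. 0)" by metis
  with ex bd g show ?thesis unfolding convergent_regular_def by blast
qed

end

section \<open>Powers of an observable matrix\<close>

text \<open>Vectors are functions on all naturals, so that iterates are plain \<open>funpow\<close>
  without carrier conditions. Values at indices beyond the rows carry no meaning, hence the
  restrictions \<open>i < N\<close> below.\<close>

definition mat_app :: "'a :: comm_ring_1 mat \<Rightarrow> (nat \<Rightarrow> 'a) \<Rightarrow> nat \<Rightarrow> 'a" where
  "mat_app A v i = (\<Sum>j<dim_col A. A $$ (i, j) * v j)"

lemma mat_app_carrier: "A \<in> carrier_mat m n \<Longrightarrow> mat_app A v i = (\<Sum>j<n. A $$ (i, j) * v j)"
  by (simp add: mat_app_def)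

lemma mat_app_cong: "(\<And>j. j < dim_col A \<Longrightarrow> v j = w j) \<Longrightarrow> mat_app A v i = mat_app A w i"
  by (simp add: mat_app_def)

lemma mat_app_add: "mat_app A (\<lambda>j. v j + w j) = (\<lambda>i. mat_app A v i + mat_app A w i)"
  by (simp add: mat_app_def fun_eq_iff sum.distrib distrib_left)

lemma mat_app_scale: "mat_app A (\<lambda>j. c * v j) = (\<lambda>i. c * mat_app A v i)"
  by (simp add: mat_app_def fun_eq_iff sum_distrib_left mult_ac)

lemma mat_app_diff: "mat_app A (\<lambda>j. v j - w j) = (\<lambda>i. mat_app A v i - mat_app A w i)"
  by (simp add: mat_app_def fun_eq_iff sum_subtractf right_diff_distrib)

lemma mat_app_sum: "mat_app A (\<lambda>j. \<Sum>k\<in>K. v k j) i = (\<Sum>k\<in>K. mat_app A (v k) i)"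
  unfolding mat_app_def by (simp add: sum_distrib_left) (rule sum.swap)

lemma index_mult_mat_app:
  assumes "A \<in> carrier_mat m n" "B \<in> carrier_mat n l" "i < m" "j < l"
  shows "(A * B) $$ (i, j) = mat_app A (\<lambda>r. B $$ (r, j)) i"
  using assms by (simp add: mat_app_def scalar_prod_def lessThan_atLeast0)

lemma mat_app_mult:
  assumes "A \<in> carrier_mat m n" "B \<in> carrier_mat n l" "i < m"
  shows "mat_app (A * B) v i = mat_app A (mat_app B v) i"
proof -
  have "mat_app (A * B) v i = (\<Sum>j<l. v j * mat_app A (\<lambda>r. B $$ (r, j)) i)"
    unfolding mat_app_carrier[OF mult_carrier_mat[OF assms(1,2)]]
    by (intro sum.cong refl) (metis assms index_mult_mat_app lessThan_iff mult.commute)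
  also have "\<dots> = mat_app A (\<lambda>r. \<Sum>j<l. v j * B $$ (r, j)) i"
    by (simp only: mat_app_sum mat_app_scale)
  also have "(\<lambda>r. \<Sum>j<l. v j * B $$ (r, j)) = mat_app B v"
    using assms(2) by (simp add: mat_app_def fun_eq_iff mult.commute)
  finally show ?thesis .
qed

lemma power_mat_app:
  assumes A: "A \<in> carrier_mat n n" and "i < n"
  shows "mat_app (A ^\<^sub>m k) v i = (mat_app A ^^ k) v i"
proof (induction k arbitrary: v)
  case 0
  have "mat_app (1\<^sub>m n) v i = (\<Sum>j<n. if i = j then v j else 0)"
    unfolding mat_app_carrier[OF one_carrier_mat] using \<open>i < n\<close> by (intro sum.cong) auto
  also have "\<dots> = v i" using \<open>i < n\<close> by simp
  finally show ?case using A by simp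
next
  case (Suc k)
  have "mat_app (A ^\<^sub>m Suc k) v i = mat_app (A ^\<^sub>m k) (mat_app A v) i"
    using mat_app_mult[OF pow_carrier_mat[OF A] A \<open>i < n\<close>] by simp
  also have "\<dots> = (mat_app A ^^ k) (mat_app A v) i" by (rule Suc)
  finally show ?case by (simp add: funpow_swap1)
qed

text \<open>The constant \<open>D = K / (q - norm l)\<close> balances the forcing in
  \<open>norm l * D + K = q * D\<close>. A rate \<open>q\<close> strictly above both
  \<open>norm l\<close> and \<rho> avoids the polynomial factor that arises when these
  coincide.\<close>

lemma geometric_contraction:
  fixes b :: "nat \<Rightarrow> complex"
  assumes step: "\<And>k. norm (b (Suc k) - l * b k) \<le> K * \<rho> ^ k"
    and "0 < \<rho>" "\<rho> < q" "norm l < q" "0 \<le> K"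
  shows "norm (b k) \<le> (norm (b 0) + K / (q - norm l)) * q ^ k"
proof (induction k)
  case 0
  show ?case using assms by simp
next
  case (Suc k)
  let ?M = "norm (b 0) + K / (q - norm l)"
  have q: "0 < q" using assms by linarith
  define D where "D = K / (q - norm l)"
  have "K = D * (q - norm l)" using assms by (simp add: D_def)
  then have "norm l * ?M + K = norm l * norm (b 0) + D * q"
    by (simp add: D_def[symmetric] algebra_simps)
  also have "\<dots> \<le> q * norm (b 0) + D * q" using assms by (intro add_right_mono mult_right_mono) auto
  finally have M: "norm l * ?M + K \<le> ?M * q" by (simp add: D_def[symmetric] algebra_simps)
  have "norm (b (Suc k)) \<le> norm l * norm (b k) + norm (b (Suc k) - l * b k)"
    using norm_triangle_ineq[of "l * b k" "b (Suc k) - l * b k"] by (simp add: norm_mult)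
  also have "\<dots> \<le> norm l * (?M * q ^ k) + K * q ^ k"
    using assms by (intro add_mono mult_left_mono Suc order_trans[OF step] power_mono) auto
  also have "\<dots> = (norm l * ?M + K) * q ^ k" by (simp add: algebra_simps)
  also have "\<dots> \<le> ?M * q * q ^ k" using M q by (intro mult_right_mono) auto
  finally show ?case by simp
qed

text \<open>For \<open>1 \<le> norm l\<close> the quotients \<open>b k / l ^ k\<close> have summable
  increments \<open>e k\<close>; \<open>w\<close> is their limit, and the error is a tail of that
  series.\<close>

lemma geometric_expansion:
  fixes b :: "nat \<Rightarrow> complex"
  assumes step: "\<And>k. norm (b (Suc k) - l * b k) \<le> K * \<rho> ^ k"
    and \<rho>: "0 < \<rho>" "\<rho> < 1" and l: "1 \<le> norm l" and K: "0 \<le> K"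
  shows "\<exists>w. \<forall>k. norm (b k - l ^ k * w) \<le> K / (1 - \<rho>) * \<rho> ^ k"
proof -
  have l0: "l \<noteq> 0" using l by auto
  define e where "e k = (b (Suc k) - l * b k) / l ^ Suc k" for k
  have sum_e: "b 0 + (\<Sum>j<k. e j) = b k / l ^ k" for k
  proof (induction k)
    case (Suc k)
    have "e k = b (Suc k) / l ^ Suc k - b k / l ^ k" using l0 by (simp add: e_def field_simps)
    then have "b 0 + (\<Sum>j<Suc k. e j) = (b 0 + (\<Sum>j<k. e j)) + (b (Suc k) / l ^ Suc k - b k / l ^ k)" by simp
    then show ?case unfolding Suc by simp
  qed simp
  \<comment> \<open>Multiplication by \<open>l ^ k\<close> cancels against the denominator of
    \<open>e (i + k)\<close> and leaves \<open>l ^ Suc i\<close>, so the tail is not amplified even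
    if \<open>norm l > 1\<close>.\<close>
  have bound: "norm (l ^ k * e (i + k)) \<le> K * \<rho> ^ k * \<rho> ^ i" for i k
  proof -
    have "l ^ k * e (i + k) = (b (Suc (i + k)) - l * b (i + k)) / l ^ Suc i"
      using l0 by (simp add: e_def power_add field_simps)
    then have "norm (l ^ k * e (i + k)) = norm (b (Suc (i + k)) - l * b (i + k)) / norm l ^ Suc i"
      by (simp add: norm_divide norm_power norm_mult)
    also have "\<dots> \<le> norm (b (Suc (i + k)) - l * b (i + k)) / 1"
      using one_le_power[OF l, of "Suc i"] by (intro frac_le) simp_all
    also have "\<dots> \<le> K * \<rho> ^ (i + k)" using step by simp
    finally show ?thesis by (simp add: power_add mult_ac)
  qed
  have geo: "summable (\<lambda>i. K * \<rho> ^ k * \<rho> ^ i)" for k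
    using \<rho> by (intro summable_mult summable_geometric) simp
  have sm: "summable e"
    by (rule summable_comparison_test[OF _ geo[of 0]])
      (intro exI allI impI, use bound[of 0] in simp)
  define w where "w = b 0 + suminf e"
  have "norm (b k - l ^ k * w) \<le> K / (1 - \<rho>) * \<rho> ^ k" for k
  proof -
    have "w = b 0 + (\<Sum>j<k. e j) + (\<Sum>i. e (i + k))"
      by (simp add: w_def suminf_split_initial_segment[OF sm, of k])
    then have "l ^ k * w = b k + (\<Sum>i. l ^ k * e (i + k))"
      using l0 suminf_mult[OF summable_ignore_initial_segment[OF sm, of k], of "l ^ k"]
      by (simp add: sum_e distrib_left)
    then have "norm (b k - l ^ k * w) = norm (\<Sum>i. l ^ k * e (i + k))" by (simp add: norm_minus_commute)
    also have "\<dots> \<le> (\<Sum>i. K * \<rho> ^ k * \<rho> ^ i)"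
    proof -
      have s: "summable (\<lambda>i. norm (l ^ k * e (i + k)))"
        by (rule summable_comparison_test[OF _ geo[of k]])
          (intro exI allI impI, use bound in simp)
      show ?thesis by (rule order_trans[OF summable_norm[OF s] suminf_le[OF bound s geo]])
    qed
    also have "\<dots> = K * \<rho> ^ k * (1 / (1 - \<rho>))"
      using \<rho> by (subst suminf_mult) (auto simp: suminf_geometric intro: summable_geometric)
    finally show ?thesis by (simp add: mult_ac)
  qed
  then show ?thesis by blast
qed

text \<open>Consecutive differences of a convergent sequence tend to zero, but here their norm is at
  least \<open>norm q * norm (l - 1)\<close>.\<close>

lemma unimodular_power_convergent:
  fixes l q :: complex
  assumes "1 \<le> norm l" "l \<noteq> 1" and lim: "(\<lambda>k. l ^ k * q) \<longlonglongrightarrow> t"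
  shows "q = 0"
proof (rule ccontr)
  assume "q \<noteq> 0"
  have "(\<lambda>k. norm (l ^ Suc k * q - l ^ k * q)) \<longlonglongrightarrow> norm (t - t)"
    by (intro tendsto_intros LIMSEQ_Suc[OF lim] lim)
  moreover have "norm (l ^ Suc k * q - l ^ k * q) \<ge> norm q * norm (l - 1)" for k
  proof -
    have "l ^ Suc k * q - l ^ k * q = l ^ k * (q * (l - 1))" by (simp add: algebra_simps)
    then have "norm (l ^ Suc k * q - l ^ k * q) = norm l ^ k * (norm q * norm (l - 1))"
      by (simp add: norm_mult norm_power)
    moreover have "1 * (norm q * norm (l - 1)) \<le> norm l ^ k * (norm q * norm (l - 1))"
      using assms by (intro mult_right_mono one_le_power) auto
    ultimately show ?thesis by simp
  qed
  ultimately have "norm q * norm (l - 1) \<le> norm (t - t)" by (intro LIMSEQ_le_const) auto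
  then show False using \<open>q \<noteq> 0\<close> \<open>l \<noteq> 1\<close> by (simp add: mult_le_0_iff)
qed

lemma geometric_tendsto_0:
  assumes "\<And>k. norm (f k :: complex) \<le> K * \<rho> ^ k" "0 < \<rho>" "\<rho> < 1"
  shows "f \<longlonglongrightarrow> 0"
proof (rule Lim_null_comparison)
  show "\<forall>\<^sub>F k in sequentially. norm (f k) \<le> K * \<rho> ^ k" using assms(1) by simp
  show "(\<lambda>k. K * \<rho> ^ k) \<longlonglongrightarrow> 0"
    using assms by (intro tendsto_mult_right_zero LIMSEQ_power_zero) auto
qed

text \<open>The observations of a vector are the values of the ring that it generates.\<close>

locale observed_matrix =
  fixes N :: nat and A :: "complex mat" and Z :: "'z set" and \<Phi> :: "'z \<Rightarrow> nat \<Rightarrow> complex"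
  assumes A: "A \<in> carrier_mat N N"
    and rows: "\<And>i. i < N \<Longrightarrow> (\<Sum>j<N. A $$ (i, j)) = 1"
    and partition: "\<And>z. z \<in> Z \<Longrightarrow> (\<Sum>i<N. \<Phi> z i) = 1"
    and observations_converge:
      "\<And>v. \<exists>r. \<forall>z\<in>Z. (\<lambda>k. \<Sum>i<N. (mat_app A ^^ k) v i * \<Phi> z i) \<longlonglongrightarrow> r"
    and observable: "\<And>ev w. ev \<noteq> 0 \<Longrightarrow> (\<And>i. i < N \<Longrightarrow> mat_app A w i = ev * w i) \<Longrightarrow>
      (\<And>z. z \<in> Z \<Longrightarrow> (\<Sum>i<N. w i * \<Phi> z i) = 0) \<Longrightarrow> (\<And>i. i < N \<Longrightarrow> w i = 0)"
begin

abbreviation "T \<equiv> mat_app A"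

definition obs :: "'z \<Rightarrow> (nat \<Rightarrow> complex) \<Rightarrow> complex" where
  "obs z v = (\<Sum>i<N. v i * \<Phi> z i)"

text \<open>All components share one limit, and the approach is geometric. Mere convergence would
  not pass through the induction, since an eigenvalue of modulus at least one requires the
  deviations of the forcing to be summable.\<close>

definition settles_to :: "(nat \<Rightarrow> complex) \<Rightarrow> complex \<Rightarrow> bool" where
  "settles_to v r \<longleftrightarrow> (\<exists>K \<rho>. 0 \<le> K \<and> 0 < \<rho> \<and> \<rho> < 1 \<and>
     (\<forall>k. \<forall>i<N. norm ((T ^^ k) v i - r) \<le> K * \<rho> ^ k))"

lemma T_cong: "(\<And>j. j < N \<Longrightarrow> v j = w j) \<Longrightarrow> T v = T w"
  using A by (intro ext mat_app_cong) auto

lemma funpow_T_cong: "(\<And>j. j < N \<Longrightarrow> v j = w j) \<Longrightarrow> i < N \<Longrightarrow> (T ^^ k) v i = (T ^^ k) w i"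
  by (cases k) (simp_all add: funpow_Suc_right T_cong[of v w] del: funpow.simps)

lemma funpow_T_add: "(T ^^ k) (\<lambda>j. v j + w j) = (\<lambda>i. (T ^^ k) v i + (T ^^ k) w i)"
  by (induction k) (simp_all add: mat_app_add)

lemma funpow_T_scale: "(T ^^ k) (\<lambda>j. c * v j) = (\<lambda>i. c * (T ^^ k) v i)"
  by (induction k) (simp_all add: mat_app_scale)

lemma T_const: "i < N \<Longrightarrow> T (\<lambda>_. s) i = s"
  using rows A by (simp add: mat_app_carrier[of A N N] sum_distrib_right[symmetric])

lemma obs_diff: "obs z (\<lambda>i. v i - w i) = obs z v - obs z w"
  by (simp add: obs_def sum_subtractf left_diff_distrib)

lemma obs_const: "z \<in> Z \<Longrightarrow> obs z (\<lambda>_. s) = s"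
  using partition by (simp add: obs_def sum_distrib_left[symmetric])

lemma tendsto_obs: "(\<And>i. i < N \<Longrightarrow> (\<lambda>k. v k i) \<longlonglongrightarrow> w i) \<Longrightarrow> (\<lambda>k. obs z (v k)) \<longlonglongrightarrow> obs z w"
  unfolding obs_def by (intro tendsto_intros) auto

lemma settles_to_add:
  assumes "settles_to v r" "settles_to w s"
  shows "settles_to (\<lambda>i. v i + w i) (r + s)"
proof -
  from assms obtain K \<rho> K' \<rho>' where v: "0 \<le> K" "0 < \<rho>" "\<rho> < 1" "\<And>k i. i < N \<Longrightarrow> norm ((T ^^ k) v i - r) \<le> K * \<rho> ^ k"
    and w: "0 \<le> K'" "0 < \<rho>'" "\<rho>' < 1" "\<And>k i. i < N \<Longrightarrow> norm ((T ^^ k) w i - s) \<le> K' * \<rho>' ^ k"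
    unfolding settles_to_def by blast
  have "norm ((T ^^ k) (\<lambda>i. v i + w i) i - (r + s)) \<le> (K + K') * max \<rho> \<rho>' ^ k" if i: "i < N" for k i
  proof -
    have "norm ((T ^^ k) (\<lambda>i. v i + w i) i - (r + s)) \<le> norm ((T ^^ k) v i - r) + norm ((T ^^ k) w i - s)"
      unfolding funpow_T_add by (rule order_trans[OF eq_refl norm_triangle_ineq]) (simp add: algebra_simps)
    also have "\<dots> \<le> K * max \<rho> \<rho>' ^ k + K' * max \<rho> \<rho>' ^ k"
      using v w i by (intro add_mono order_trans[OF v(4)] order_trans[OF w(4)] mult_left_mono power_mono) auto
    finally show ?thesis by (simp add: algebra_simps)
  qed
  then show ?thesis unfolding settles_to_def
    using v w by (intro exI[of _ "K + K'"] exI[of _ "max \<rho> \<rho>'"]) auto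
qed

lemma settles_to_scale:
  assumes "settles_to v r"
  shows "settles_to (\<lambda>i. c * v i) (c * r)"
proof -
  from assms obtain K \<rho> where v: "0 \<le> K" "0 < \<rho>" "\<rho> < 1" "\<And>k i. i < N \<Longrightarrow> norm ((T ^^ k) v i - r) \<le> K * \<rho> ^ k"
    unfolding settles_to_def by blast
  have "norm ((T ^^ k) (\<lambda>i. c * v i) i - c * r) \<le> norm c * K * \<rho> ^ k" if "i < N" for k i
    using mult_left_mono[OF v(4)[OF that] norm_ge_zero[of c]]
    by (simp add: funpow_T_scale right_diff_distrib[symmetric] norm_mult mult.assoc)
  then show ?thesis unfolding settles_to_def using v
    by (intro exI[of _ "norm c * K"] exI[of _ \<rho>]) auto
qed

lemma settles_to_zero: "\<exists>r. settles_to (\<lambda>_. 0) r"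
proof (intro exI)
  have "(T ^^ k) (\<lambda>_. 0) = (\<lambda>_. 0)" for k using funpow_T_scale[of k 0 "\<lambda>_. 0"] by simp
  then show "settles_to (\<lambda>_. 0) 0"
    unfolding settles_to_def by (intro exI[of _ 0] exI[of _ "1 / 2"]) simp
qed

lemma settles_to_sum:
  assumes "\<And>j. j \<in> J \<Longrightarrow> \<exists>r. settles_to (v j) r"
  shows "\<exists>r. settles_to (\<lambda>i. \<Sum>j\<in>J. c j * v j i) r"
  using assms
proof (induction J rule: infinite_finite_induct)
  case (insert j J)
  then obtain r s where r: "settles_to (v j) r" "settles_to (\<lambda>i. \<Sum>j\<in>J. c j * v j i) s" by blast
  from settles_to_add[OF settles_to_scale[OF r(1)] r(2)] insert.hyps show ?case by (intro exI) simp
qed (simp_all add: settles_to_zero)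

lemma settles_to_cong: "(\<And>j. j < N \<Longrightarrow> v j = w j) \<Longrightarrow> settles_to v r \<Longrightarrow> settles_to w r"
  unfolding settles_to_def using funpow_T_cong[of v w] by simp

text \<open>One step along the flag of the Schur decomposition. A component that does not decay
  would be an eigenvector for an eigenvalue of modulus at least one; the convergence of the
  observations leaves only the constant vectors.\<close>

lemma settles_step:
  assumes v: "\<And>i. i < N \<Longrightarrow> T v i = l * v i + u i" and u: "settles_to u r"
  shows "\<exists>s. settles_to v s"
proof (cases "N = 0")
  case True
  have "settles_to v 0" unfolding settles_to_def
    by (intro exI[of _ 0] exI[of _ "1 / 2"]) (simp add: True)
  then show ?thesis ..
next
  case False
  from u obtain K \<rho> where K: "0 \<le> K" and \<rho>: "0 < \<rho>" "\<rho> < 1"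
    and U: "\<And>k i. i < N \<Longrightarrow> norm ((T ^^ k) u i - r) \<le> K * \<rho> ^ k"
    unfolding settles_to_def by blast
  have rec: "(T ^^ Suc k) v i = l * (T ^^ k) v i + (T ^^ k) u i" if "i < N" for k i
  proof -
    have "(T ^^ Suc k) v i = (T ^^ k) (\<lambda>i. l * v i + u i) i"
      unfolding funpow_Suc_right comp_def using that by (intro funpow_T_cong v)
    then show ?thesis by (simp add: funpow_T_add funpow_T_scale)
  qed
  \<comment> \<open>The constant vector 1 is an eigenvector for eigenvalue 1, and without
    observation points it could not be observed.\<close>
  have "Z \<noteq> {}"
  proof
    assume "Z = {}"
    then have "(1 :: complex) = 0"
      using False by (intro observable[of 1 "\<lambda>_. 1" 0]) (auto simp: T_const)
    then show False by simp
  qed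
  then obtain z0 where z0: "z0 \<in> Z" by blast
  obtain rv where rv: "\<And>z. z \<in> Z \<Longrightarrow> (\<lambda>k. obs z ((T ^^ k) v)) \<longlonglongrightarrow> rv"
    using observations_converge[of v] unfolding obs_def by blast
  \<comment> \<open>Subtracting a fixed point \<open>s\<close> removes the constant part of the
    forcing. For \<open>l = 1\<close> it exists only if \<open>r = 0\<close>: the increments of the
    observations of \<open>v\<close> are observations of the iterates of \<open>u\<close> and tend
    to \<open>r\<close>, but they also tend to 0 because the observations converge.\<close>
  have ex_fix: "\<exists>s. s = l * s + r"
  proof (cases "l = 1")
    case True
    have "(\<lambda>k. (T ^^ k) u i) \<longlonglongrightarrow> r" if "i < N" for i
      using geometric_tendsto_0[OF U[OF that] \<rho>] by (simp add: LIM_zero_iff)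
    then have "(\<lambda>k. obs z0 ((T ^^ k) u)) \<longlonglongrightarrow> obs z0 (\<lambda>_. r)" by (intro tendsto_obs)
    moreover have "obs z0 ((T ^^ Suc k) v) - obs z0 ((T ^^ k) v) = obs z0 ((T ^^ k) u)" for k
      unfolding obs_def sum_subtractf[symmetric] left_diff_distrib[symmetric] using rec True
      by (intro sum.cong refl) (simp del: funpow.simps)
    moreover have "(\<lambda>k. obs z0 ((T ^^ Suc k) v) - obs z0 ((T ^^ k) v)) \<longlonglongrightarrow> rv - rv"
      by (intro tendsto_intros LIMSEQ_Suc[OF rv[OF z0]] rv[OF z0])
    ultimately have "obs z0 (\<lambda>_. r) = rv - rv" by (simp only: LIMSEQ_unique)
    then have "r = 0" by (simp add: obs_const[OF z0])
    then show ?thesis by simp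
  next
    case False
    then show ?thesis by (intro exI[of _ "r / (1 - l)"]) (simp add: field_simps)
  qed
  then obtain s where s: "s = l * s + r" ..
  define b where "b k i = (T ^^ k) v i - s" for k i
  have step: "norm (b (Suc k) i - l * b k i) \<le> K * \<rho> ^ k" if "i < N" for k i
  proof -
    have "b (Suc k) i - l * b k i = (T ^^ k) u i - r"
      unfolding b_def rec[OF that] using s by (simp add: algebra_simps)
    with U[OF that] show ?thesis by simp
  qed
  show ?thesis
  proof (cases "norm l < 1")
    case True
    \<comment> \<open>Halfway between 1 and the larger of the two rates, hence strictly above both
      and still below 1.\<close>
    define q where "q = (1 + max \<rho> (norm l)) / 2"
    have q: "\<rho> < q" "norm l < q" "q < 1" "0 < q" using \<rho> True by (auto simp: q_def)
    define B where "B = (\<Sum>i<N. norm (b 0 i)) + K / (q - norm l)"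
    have B0: "0 \<le> B" using K q by (auto simp: B_def intro!: add_nonneg_nonneg sum_nonneg)
    have "norm ((T ^^ k) v i - s) \<le> B * q ^ k" if i: "i < N" for k i
    proof -
      have "norm (b k i) \<le> (norm (b 0 i) + K / (q - norm l)) * q ^ k"
        using step[OF i] \<rho> q K by (intro geometric_contraction[of "\<lambda>k. b k i"])
      also have "\<dots> \<le> B * q ^ k" unfolding B_def
        using q i by (intro mult_right_mono add_right_mono member_le_sum) auto
      finally show ?thesis by (simp add: b_def)
    qed
    then show ?thesis unfolding settles_to_def using B0 q by blast
  next
    case False
    then have l: "1 \<le> norm l" by simp
    have "\<exists>w. \<forall>k. norm (b k i - l ^ k * w) \<le> K / (1 - \<rho>) * \<rho> ^ k" if "i < N" for i
      using step[OF that] \<rho> l K by (intro geometric_expansion[of "\<lambda>k. b k i"])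
    then obtain w where w: "\<And>i k. i < N \<Longrightarrow> norm (b k i - l ^ k * w i) \<le> K / (1 - \<rho>) * \<rho> ^ k"
      using choice[of "\<lambda>i w. i < N \<longrightarrow> (\<forall>k. norm (b k i - l ^ k * w) \<le> K / (1 - \<rho>) * \<rho> ^ k)"]
      by blast
    have w0: "(\<lambda>k. b k i - l ^ k * w i) \<longlonglongrightarrow> 0" if "i < N" for i
      using w[OF that] \<rho> by (intro geometric_tendsto_0)
    \<comment> \<open>The recurrence makes \<open>l ^ k * (T w i - l * w i)\<close> tend to 0; as
      \<open>norm l \<ge> 1\<close>, the constant factor must vanish.\<close>
    have eigen: "T w i = l * w i" if i: "i < N" for i
    proof -
      have Tb: "T (b k) i = b (Suc k) i" for k
        using T_const[OF i, of s] by (simp add: b_def[abs_def] mat_app_diff)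
      have "(\<lambda>k. T (\<lambda>j. b k j - l ^ k * w j) i) \<longlonglongrightarrow> (\<Sum>j<N. A $$ (i, j) * 0)"
        unfolding mat_app_carrier[OF A] using w0 by (intro tendsto_intros) auto
      from tendsto_diff[OF LIMSEQ_Suc[OF w0[OF i]] this]
      have "(\<lambda>k. b (Suc k) i - l ^ Suc k * w i - T (\<lambda>j. b k j - l ^ k * w j) i) \<longlonglongrightarrow> 0" by simp
      moreover have "b (Suc k) i - l ^ Suc k * w i - T (\<lambda>j. b k j - l ^ k * w j) i
          = l ^ k * (T w i - l * w i)" for k
        unfolding mat_app_diff mat_app_scale Tb by (simp add: algebra_simps)
      ultimately have "(\<lambda>k. l ^ k * (T w i - l * w i)) \<longlonglongrightarrow> 0" by (simp only:)
      then have "(\<lambda>k. norm (l ^ k * (T w i - l * w i))) \<longlonglongrightarrow> 0" by (rule tendsto_norm_zero)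
      moreover have "norm (T w i - l * w i) \<le> norm (l ^ k * (T w i - l * w i))" for k
      proof -
        have "1 * norm (T w i - l * w i) \<le> norm l ^ k * norm (T w i - l * w i)"
          using l by (intro mult_right_mono one_le_power) auto
        then show ?thesis by (simp add: norm_mult norm_power)
      qed
      ultimately have "norm (T w i - l * w i) \<le> 0" by (intro LIMSEQ_le_const) auto
      then show ?thesis by simp
    qed
    have obs_w: "(\<lambda>k. l ^ k * obs z w) \<longlonglongrightarrow> rv - s" if z: "z \<in> Z" for z
    proof -
      have "(\<lambda>k. obs z (\<lambda>i. b k i - l ^ k * w i)) \<longlonglongrightarrow> obs z (\<lambda>_. 0)"
        using w0 by (intro tendsto_obs)
      then have "(\<lambda>k. obs z (\<lambda>i. b k i - l ^ k * w i)) \<longlonglongrightarrow> 0" by (simp add: obs_def)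
      moreover have "obs z (\<lambda>i. b k i - l ^ k * w i) = obs z ((T ^^ k) v) - s - l ^ k * obs z w" for k
        unfolding obs_diff b_def by (simp add: obs_const[OF z]) (simp add: obs_def sum_distrib_left mult.assoc)
      ultimately have "(\<lambda>k. obs z ((T ^^ k) v) - s - l ^ k * obs z w) \<longlonglongrightarrow> 0" by simp
      from tendsto_diff[OF tendsto_diff[OF rv[OF z] tendsto_const[of s]] this] show ?thesis by simp
    qed
    \<comment> \<open>For \<open>l = 1\<close> all observations of \<open>w\<close> equal
      \<open>rv - s\<close>, so subtracting this constant leaves an unobservable eigenvector, which
      is zero. For \<open>l \<noteq> 1\<close> convergence of the observations forces them to
      vanish, so \<open>w\<close> itself is zero.\<close>
    have "\<exists>t. \<forall>i<N. \<forall>k. l ^ k * w i = t"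
    proof (cases "l = 1")
      case True
      define t where "t = rv - s"
      have "w i - t = 0" if "i < N" for i
      proof (rule observable[of 1 "\<lambda>i. w i - t"])
        show "T (\<lambda>i. w i - t) i = 1 * (w i - t)" if "i < N" for i
          using eigen[OF that] T_const[OF that, of t] True by (simp add: mat_app_diff)
        show "(\<Sum>i<N. (w i - t) * \<Phi> z i) = 0" if "z \<in> Z" for z
        proof -
          have "obs z w = t"
            using LIMSEQ_unique[OF obs_w[OF that], of "obs z w"] True by (simp add: t_def)
          then show ?thesis using obs_diff[of z w "\<lambda>_. t"] obs_const[OF that, of t] by (simp add: obs_def)
        qed
      qed (use that in auto)
      then show ?thesis using True by auto
    next
      case False
      have "w i = 0" if "i < N" for i
      proof (rule observable[of l w])
        show "(\<Sum>i<N. w i * \<Phi> z i) = 0" if "z \<in> Z" for z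
          using unimodular_power_convergent[OF l False obs_w[OF that]] by (simp add: obs_def)
      qed (use l eigen that in auto)
      then show ?thesis by auto
    qed
    then obtain t where t: "\<And>i k. i < N \<Longrightarrow> l ^ k * w i = t" by blast
    have "norm ((T ^^ k) v i - (s + t)) \<le> K / (1 - \<rho>) * \<rho> ^ k" if "i < N" for i k
      using w[OF that, of k] t[OF that] by (simp add: b_def algebra_simps)
    moreover have "0 \<le> K / (1 - \<rho>)" using K \<rho> by simp
    ultimately show ?thesis unfolding settles_to_def using \<rho> by blast
  qed
qed

text \<open>\<open>A * P = P * B\<close> with \<open>B\<close> upper triangular maps each column of
  \<open>P\<close> to a multiple of itself plus a combination of earlier columns, as
  \<open>settles_step\<close> requires. The columns span, with coefficients given by
  \<open>Q\<close>; no Jordan form is involved.\<close>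

lemma all_settle: "\<exists>r. settles_to v r"
proof -
  obtain es where es: "char_poly A = (\<Prod>e\<leftarrow>es. [:- e, 1:])"
    using char_poly_factorized[OF A] by blast
  obtain B P Q where "schur_decomposition A es = (B, P, Q)" by (cases "schur_decomposition A es")
  from schur_decomposition[OF A es this]
  have sim: "similar_mat_wit A B P Q" and ut: "upper_triangular B" by auto
  then have B: "B \<in> carrier_mat N N" and P: "P \<in> carrier_mat N N" and Q: "Q \<in> carrier_mat N N"
    and PQ: "P * Q = 1\<^sub>m N" and QP: "Q * P = 1\<^sub>m N" and AB: "A = P * B * Q"
    using A unfolding similar_mat_wit_def Let_def by auto
  have "A * P = P * B * (Q * P)"
    unfolding AB by (rule assoc_mult_mat[OF mult_carrier_mat[OF P B] Q P])
  then have AP: "A * P = P * B" using B P by (simp add: QP)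
  have col: "\<exists>r. settles_to (\<lambda>i. P $$ (i, j)) r" if "j < N" for j
    using that
  proof (induction j rule: less_induct)
    case (less j)
    have "\<exists>r. settles_to (\<lambda>i. \<Sum>m\<in>{..<j}. B $$ (m, j) * P $$ (i, m)) r"
      using less by (intro settles_to_sum) auto
    then obtain r where r: "settles_to (\<lambda>i. \<Sum>m\<in>{..<j}. B $$ (m, j) * P $$ (i, m)) r" ..
    have "T (\<lambda>i. P $$ (i, j)) i = B $$ (j, j) * P $$ (i, j) + (\<Sum>m<j. B $$ (m, j) * P $$ (i, m))"
      if i: "i < N" for i
    proof -
      have "T (\<lambda>i. P $$ (i, j)) i = (P * B) $$ (i, j)"
        using index_mult_mat_app[OF A P i less.prems] by (simp add: AP)
      also have "\<dots> = (\<Sum>m<N. P $$ (i, m) * B $$ (m, j))"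
        using index_mult_mat_app[OF P B i less.prems] by (simp add: mat_app_carrier[OF P])
      also have "\<dots> = (\<Sum>m<Suc j. P $$ (i, m) * B $$ (m, j))"
        using less.prems B upper_triangularD[OF ut] by (intro sum.mono_neutral_right) auto
      finally show ?thesis by (simp add: mult.commute)
    qed
    from settles_step[OF this r] show ?case .
  qed
  have "\<exists>r. settles_to (\<lambda>i. \<Sum>j<N. mat_app Q v j * P $$ (i, j)) r"
    using col by (intro settles_to_sum) auto
  then obtain r where r: "settles_to (\<lambda>i. \<Sum>j<N. mat_app Q v j * P $$ (i, j)) r" ..
  have "(\<Sum>j<N. mat_app Q v j * P $$ (i, j)) = v i" if "i < N" for i
  proof -
    have "(\<Sum>j<N. mat_app Q v j * P $$ (i, j)) = mat_app (1\<^sub>m N) v i"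
      using mat_app_mult[OF P Q that, of v] by (simp add: PQ mat_app_carrier[OF P] mult.commute)
    also have "\<dots> = v i" using power_mat_app[OF A that, of 0 v] A by simp
    finally show ?thesis .
  qed
  from settles_to_cong[OF this r] show ?thesis ..
qed

text \<open>Apply \<open>all_settle\<close> to the unit vectors: since all components settle to the
  same number, the limit of entry \<open>(i, j)\<close> depends on \<open>j\<close> only.\<close>

lemma powers_converge: "\<exists>x. \<forall>i<N. \<forall>j<N. (\<lambda>k. (A ^\<^sub>m k) $$ (i, j)) \<longlonglongrightarrow> x j"
proof -
  let ?e = "\<lambda>j l. if l = j then 1 else 0 :: complex"
  have "\<exists>r. settles_to (?e j) r" for j by (rule all_settle)
  then obtain x where x: "\<And>j. settles_to (?e j) (x j)" by metis
  have "(\<lambda>k. (A ^\<^sub>m k) $$ (i, j)) \<longlonglongrightarrow> x j" if i: "i < N" and j: "j < N" for i j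
  proof -
    from x[of j] obtain K \<rho> where \<rho>: "0 < \<rho>" "\<rho> < 1"
      and *: "\<And>k. norm ((T ^^ k) (?e j) i - x j) \<le> K * \<rho> ^ k"
      unfolding settles_to_def using i by blast
    have "(T ^^ k) (?e j) i = (A ^\<^sub>m k) $$ (i, j)" for k
    proof -
      have "(T ^^ k) (?e j) i = (\<Sum>m<N. (A ^\<^sub>m k) $$ (i, m) * ?e j m)"
        using power_mat_app[OF A i, of k "?e j"] A by (simp add: mat_app_carrier[of "A ^\<^sub>m k" N N])
      also have "\<dots> = (\<Sum>m<N. if m = j then (A ^\<^sub>m k) $$ (i, m) else 0)" by (intro sum.cong) auto
      finally show ?thesis using j by simp
    qed
    with geometric_tendsto_0[OF * \<rho>] show ?thesis by (simp add: LIM_zero_iff)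
  qed
  then show ?thesis by blast
qed

end

section \<open>Summable perturbations of a convergent sequence of powers\<close>

lemma sum_single:
  fixes f :: "nat \<Rightarrow> real"
  assumes "j < N" shows "(\<Sum>m<N. f m * (if m = j then 1 else 0)) = f j"
proof -
  have "(\<Sum>m<N. f m * (if m = j then 1 else 0)) = (\<Sum>m<N. if m = j then f m else 0)"
    by (intro sum.cong) auto
  with assms show ?thesis by simp
qed

locale perturbed_matrices =
  fixes N :: nat and S :: "real mat" and M :: "nat \<Rightarrow> real mat" and x :: "nat \<Rightarrow> real"
    and C \<sigma> :: real
  assumes S: "S \<in> carrier_mat N N" and M: "\<And>k. k \<ge> 1 \<Longrightarrow> M k \<in> carrier_mat N N"
    and powers: "\<And>i j. i < N \<Longrightarrow> j < N \<Longrightarrow> (\<lambda>k. (S ^\<^sub>m k) $$ (i, j)) \<longlonglongrightarrow> x j"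
    and C: "0 \<le> C" and \<sigma>: "1 < \<sigma>"
    and perturbation: "\<And>k i. k \<ge> 1 \<Longrightarrow> i < N \<Longrightarrow> (\<Sum>j<N. \<bar>(M k - S) $$ (i, j)\<bar>) \<le> C / \<sigma> ^ k"
begin

abbreviation "T \<equiv> mat_app S"

primrec traj :: "(nat \<Rightarrow> real) \<Rightarrow> nat \<Rightarrow> nat \<Rightarrow> real" where
  "traj v 0 = v"
| "traj v (Suc k) = mat_app (M (Suc k)) (traj v k)"

definition incr :: "(nat \<Rightarrow> real) \<Rightarrow> nat \<Rightarrow> nat \<Rightarrow> real" where
  "incr v k = mat_app (M (Suc k) - S) (traj v k)"

lemma M_Suc: "M (Suc k) \<in> carrier_mat N N"
  by (rule M) simp

lemma carrier_diff: "M (Suc k) - S \<in> carrier_mat N N"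
  using M_Suc S by auto

lemma power_sum: "i < N \<Longrightarrow> (T ^^ k) v i = (\<Sum>j<N. (S ^\<^sub>m k) $$ (i, j) * v j)"
  using power_mat_app[OF S, of i k v] by (simp add: mat_app_carrier[OF pow_carrier_mat[OF S]])

text \<open>The Duhamel formula for local matrices: the increment of step \<open>j\<close> is
  transported by the remaining powers of \<open>S\<close>.\<close>

lemma traj_telescope:
  assumes "i < N"
  shows "traj v k i = (T ^^ k) v i + (\<Sum>j<k. (T ^^ (k - Suc j)) (incr v j) i)"
  using assms
proof (induction k arbitrary: i)
  case (Suc k)
  have step: "T ((T ^^ (k - Suc j)) u) = (T ^^ (Suc k - Suc j)) u" if "j < k" for j u
  proof -
    from that have "Suc k - Suc j = Suc (k - Suc j)" by simp
    then show ?thesis by simp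
  qed
  have "traj v (Suc k) i = T (traj v k) i + incr v k i"
    using Suc.prems M_Suc[of k] S
    by (simp add: incr_def mat_app_carrier[OF S] mat_app_carrier[of "M (Suc k)" N N]
        mat_app_carrier[OF carrier_diff] sum.distrib[symmetric] algebra_simps)
  also have "T (traj v k) i = T (\<lambda>i. (T ^^ k) v i + (\<Sum>j<k. (T ^^ (k - Suc j)) (incr v j) i)) i"
    using S Suc.IH by (intro mat_app_cong) auto
  also have "\<dots> = (T ^^ Suc k) v i + (\<Sum>j<k. (T ^^ (Suc k - Suc j)) (incr v j) i)"
    unfolding mat_app_add mat_app_sum by (auto simp: step simp del: diff_Suc_Suc intro!: sum.cong)
  finally show ?case by simp
qed simp

lemma ex_power_bound: "\<exists>B\<ge>0. \<forall>k v E i. i < N \<longrightarrow> (\<forall>j<N. \<bar>v j\<bar> \<le> E) \<longrightarrow> \<bar>(T ^^ k) v i\<bar> \<le> B * E"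
proof -
  have "\<exists>b. \<forall>k. \<bar>(S ^\<^sub>m k) $$ (i, j)\<bar> \<le> b" if "i < N" "j < N" for i j
    using convergent_imp_Bseq[OF convergentI[OF powers[OF that]]]
    by (auto simp: Bseq_def)
  then obtain b where b: "\<And>i j k. i < N \<Longrightarrow> j < N \<Longrightarrow> \<bar>(S ^\<^sub>m k) $$ (i, j)\<bar> \<le> b i j" by metis
  have b0: "0 \<le> b i j" if "i < N" "j < N" for i j
    using order_trans[OF abs_ge_zero b[OF that, of 0]] .
  define B where "B = (\<Sum>i<N. \<Sum>j<N. b i j)"
  have "\<bar>(T ^^ k) v i\<bar> \<le> B * E" if i: "i < N" and v: "\<And>j. j < N \<Longrightarrow> \<bar>v j\<bar> \<le> E" for k v E i
  proof -
    have E: "0 \<le> E" using order_trans[OF abs_ge_zero v[OF i]] .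
    have "\<bar>(T ^^ k) v i\<bar> \<le> (\<Sum>j<N. b i j * E)"
      unfolding power_sum[OF i]
      using b[OF i] v b0[OF i] by (intro order_trans[OF sum_abs] sum_mono) (auto simp: abs_mult intro!: mult_mono)
    also have "\<dots> = (\<Sum>j<N. b i j) * E" by (simp add: sum_distrib_right)
    also have "(\<Sum>j<N. b i j) \<le> B"
      unfolding B_def using i b0 by (intro member_le_sum[of i _ "\<lambda>i. \<Sum>j<N. b i j"]) (auto intro: sum_nonneg)
    finally show ?thesis using E by (simp add: mult_right_mono)
  qed
  moreover have "0 \<le> B" unfolding B_def using b0 by (intro sum_nonneg) auto
  ultimately show ?thesis by blast
qed

lemma incr_le:
  assumes "\<And>j. j < N \<Longrightarrow> \<bar>traj v k j\<bar> \<le> E" and i: "i < N"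
  shows "\<bar>incr v k i\<bar> \<le> C / \<sigma> ^ Suc k * E"
proof -
  have E: "0 \<le> E" using order_trans[OF abs_ge_zero assms(1)[OF i]] .
  have "\<bar>incr v k i\<bar> \<le> (\<Sum>j<N. \<bar>(M (Suc k) - S) $$ (i, j)\<bar> * E)"
    unfolding incr_def mat_app_carrier[OF carrier_diff]
    using assms(1) by (intro order_trans[OF sum_abs] sum_mono) (auto simp only: abs_mult lessThan_iff intro!: mult_left_mono)
  also have "\<dots> = (\<Sum>j<N. \<bar>(M (Suc k) - S) $$ (i, j)\<bar>) * E" by (rule sum_distrib_right[symmetric])
  also have "\<dots> \<le> C / \<sigma> ^ Suc k * E"
    using perturbation[of "Suc k" i] i E by (intro mult_right_mono) auto
  finally show ?thesis .
qed

lemma summable_geometric_\<sigma>: "summable (\<lambda>k. c / \<sigma> ^ Suc k)"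
proof -
  have "summable (\<lambda>k. c / \<sigma> * (1 / \<sigma>) ^ k)"
    using \<sigma> by (intro summable_mult summable_geometric) simp
  then show ?thesis by (simp add: power_one_over)
qed

lemma traj_bounded: "\<exists>E\<ge>0. \<forall>k. \<forall>i<N. \<bar>traj v k i\<bar> \<le> E"
proof -
  obtain B where B: "B \<ge> 0" and pow: "\<And>k v E i. i < N \<Longrightarrow> (\<And>j. j < N \<Longrightarrow> \<bar>v j\<bar> \<le> E) \<Longrightarrow> \<bar>(T ^^ k) v i\<bar> \<le> B * E"
    using ex_power_bound by blast
  define V where "V = (\<Sum>j<N. \<bar>v j\<bar>)"
  have V: "\<bar>v j\<bar> \<le> V" if "j < N" for j unfolding V_def using that by (intro member_le_sum) auto
  have V0: "0 \<le> V" by (simp add: V_def sum_nonneg)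
  \<comment> \<open>Gronwall coefficients: power bound times perturbation. They are summable because
    \<sigma> exceeds 1.\<close>
  let ?b = "\<lambda>j. B * (C / \<sigma> ^ Suc j)"
  have b0: "0 \<le> ?b j" for j using B C \<sigma> by simp
  have gr: "\<forall>i<N. \<bar>traj v k i\<bar> \<le> B * V * (\<Prod>j<k. 1 + ?b j)" for k
  proof (rule discrete_gronwall[where bnd = "\<lambda>k E. \<forall>i<N. \<bar>traj v k i\<bar> \<le> E"], intro allI impI)
    fix k E i
    assume E: "\<And>j. j < k \<Longrightarrow> \<forall>i<N. \<bar>traj v j i\<bar> \<le> E j" and i: "i < N"
    have "\<bar>(T ^^ (k - Suc j)) (incr v j) i\<bar> \<le> ?b j * E j" if "j < k" for j
      using pow[OF i incr_le[of v j "E j"]] E[OF that] by (simp add: mult.assoc)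
    then have "\<bar>\<Sum>j<k. (T ^^ (k - Suc j)) (incr v j) i\<bar> \<le> (\<Sum>j<k. ?b j * E j)"
      by (intro order_trans[OF sum_abs] sum_mono) auto
    moreover have "\<bar>(T ^^ k) v i\<bar> \<le> B * V" by (rule pow[OF i V])
    ultimately show "\<bar>traj v k i\<bar> \<le> B * V + (\<Sum>j<k. ?b j * E j)"
      unfolding traj_telescope[OF i] by linarith
  qed
  have "\<bar>traj v k i\<bar> \<le> B * V * exp (\<Sum>j. ?b j)" if "i < N" for k i
  proof -
    have "(\<Prod>j<k. 1 + ?b j) \<le> exp (\<Sum>j<k. ?b j)" by (rule prod_one_plus_le_exp) (rule b0)
    also have "(\<Sum>j<k. ?b j) \<le> (\<Sum>j. ?b j)"
      by (rule sum_le_suminf[OF summable_mult[OF summable_geometric_\<sigma>] finite_lessThan b0])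
    finally have "(\<Prod>j<k. 1 + ?b j) \<le> exp (\<Sum>j. ?b j)" by simp
    then have "B * V * (\<Prod>j<k. 1 + ?b j) \<le> B * V * exp (\<Sum>j. ?b j)"
      using B V0 by (intro mult_left_mono) auto
    with gr[of k] that show ?thesis by (meson order_trans)
  qed
  moreover have "0 \<le> B * V * exp (\<Sum>j. ?b j)" using B V0 by simp
  ultimately show ?thesis by blast
qed

lemma power_tendsto: "i < N \<Longrightarrow> (\<lambda>k. (T ^^ k) v i) \<longlonglongrightarrow> (\<Sum>j<N. x j * v j)"
  unfolding power_sum by (intro tendsto_intros powers) auto

text \<open>The limit of the entries of \<open>perturbation_sum\<close> in one coordinate. Each row
  of the powers of \<open>S\<close> tends to \<open>x\<close>, so every increment finally
  contributes its \<open>x\<close>-weighted sum, the same in all rows.\<close>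

definition drift :: "(nat \<Rightarrow> real) \<Rightarrow> real" where
  "drift v = (\<Sum>j. \<Sum>m<N. x m * incr v j m)"

lemma perturbation_tendsto:
  assumes i: "i < N"
  shows "(\<lambda>k. \<Sum>j<k. (T ^^ (k - Suc j)) (incr v j) i) \<longlonglongrightarrow> drift v"
proof -
  obtain B where B: "B \<ge> 0" and pow: "\<And>k v E i. i < N \<Longrightarrow> (\<And>j. j < N \<Longrightarrow> \<bar>v j\<bar> \<le> E) \<Longrightarrow> \<bar>(T ^^ k) v i\<bar> \<le> B * E"
    using ex_power_bound by blast
  obtain E where E: "E \<ge> 0" "\<And>k i. i < N \<Longrightarrow> \<bar>traj v k i\<bar> \<le> E" using traj_bounded by blast
  \<comment> \<open>Padding with zeros makes the index set independent of \<open>k\<close>, as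
    Tannery's theorem requires. The majorant \<open>?M\<close> combines the power bound, the
    trajectory bound and the decay of the perturbation.\<close>
  let ?a = "\<lambda>j k. if j < k then (T ^^ (k - Suc j)) (incr v j) i else 0"
  let ?M = "\<lambda>j. B * E * C / \<sigma> ^ Suc j"
  have "(\<lambda>k. ?a j k) \<longlonglongrightarrow> (\<Sum>m<N. x m * incr v j m)" for j
  proof -
    have "(\<lambda>k. ?a j (k + Suc j)) \<longlonglongrightarrow> (\<Sum>m<N. x m * incr v j m)"
      using power_tendsto[OF i, of "incr v j"] by simp
    then show ?thesis by (rule LIMSEQ_offset)
  qed
  moreover have bound: "norm (?a j k) \<le> ?M j" for j k
  proof (cases "j < k")
    case True
    have "\<bar>(T ^^ (k - Suc j)) (incr v j) i\<bar> \<le> B * (C / \<sigma> ^ Suc j * E)"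
      using E(2) by (intro pow[OF i] incr_le)
    with True show ?thesis by (simp add: mult_ac)
  next
    case False
    have "0 \<le> ?M j" using B C E \<sigma> by simp
    with False show ?thesis by simp
  qed
  have "\<forall>\<^sub>F (j, k) in at_top \<times>\<^sub>F sequentially. norm (?a j k) \<le> ?M j"
  proof (rule always_eventually, rule allI)
    fix p :: "nat \<times> nat"
    show "case p of (j, k) \<Rightarrow> norm (?a j k) \<le> ?M j" by (cases p) (simp only: prod.case bound)
  qed
  ultimately have "(\<lambda>k. \<Sum>j. ?a j k) \<longlonglongrightarrow> drift v"
    unfolding drift_def using tannerys_theorem[of ?a _ sequentially ?M] summable_geometric_\<sigma>
    by (simp del: power_Suc)
  moreover have "(\<Sum>j. ?a j k) = (\<Sum>j<k. (T ^^ (k - Suc j)) (incr v j) i)" for k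
    by (subst suminf_finite[of "{..<k}"]) auto
  ultimately show ?thesis by simp
qed

lemma traj_tendsto: "i < N \<Longrightarrow> (\<lambda>k. traj v k i) \<longlonglongrightarrow> (\<Sum>j<N. x j * v j) + drift v"
  unfolding traj_telescope by (intro tendsto_add power_tendsto perturbation_tendsto)

section \<open>From trajectories to matrices of control points\<close>

lemma ctrl_after_carrier: "d \<in> carrier_mat N q \<Longrightarrow> ctrl_after M d k \<in> carrier_mat N q"
  by (induction k) (auto intro: mult_carrier_mat[OF M_Suc])

lemma ctrl_after_entry:
  assumes d: "d \<in> carrier_mat N q" and "r < N" "s < q"
  shows "ctrl_after M d k $$ (r, s) = traj (\<lambda>i. d $$ (i, s)) k r"
  using \<open>r < N\<close>
proof (induction k arbitrary: r)
  case (Suc k)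
  have "ctrl_after M d (Suc k) $$ (r, s) = mat_app (M (Suc k)) (\<lambda>i. ctrl_after M d k $$ (i, s)) r"
    using index_mult_mat_app[OF M_Suc[of k] ctrl_after_carrier[OF d, of k]] Suc.prems \<open>s < q\<close> by simp
  also have "\<dots> = mat_app (M (Suc k)) (traj (\<lambda>i. d $$ (i, s)) k) r"
    using Suc.IH M_Suc[of k] by (intro mat_app_cong) auto
  finally show ?case by simp
qed simp

lemma steps_carrier: "steps N M k \<in> carrier_mat N N"
  by (induction k) (auto intro: mult_carrier_mat[OF M_Suc])

lemma steps_app: "i < N \<Longrightarrow> mat_app (steps N M k) v i = traj v k i"
proof (induction k arbitrary: i)
  case 0
  then show ?case using power_mat_app[OF S, of i 0 v] S by simp
next
  case (Suc k)
  have "mat_app (steps N M (Suc k)) v i = mat_app (M (Suc k)) (mat_app (steps N M k) v) i"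
    using mat_app_mult[OF M_Suc[of k] steps_carrier] Suc.prems by simp
  also have "\<dots> = mat_app (M (Suc k)) (traj v k) i"
    using Suc.IH M_Suc[of k] by (intro mat_app_cong) auto
  finally show ?case by simp
qed

lemma perturbation_sum_entry:
  assumes d: "d \<in> carrier_mat N 3" and r: "r < N" and s: "s < 3"
  shows "perturbation_sum N S M d k $$ (r, s)
    = (\<Sum>j<k. (T ^^ (k - Suc j)) (incr (\<lambda>i. d $$ (i, s)) j) r)"
proof -
  let ?v = "\<lambda>i. d $$ (i, s)"
  have summand: "((S ^\<^sub>m l * (M (Suc j) - S) * steps N M j) * d) $$ (r, s) = (T ^^ l) (incr ?v j) r" for l j
  proof -
    note Sl = pow_carrier_mat[OF S, of l]
    note D = carrier_diff[of j]
    note SD = mult_carrier_mat[OF Sl D]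
    have "((S ^\<^sub>m l * (M (Suc j) - S) * steps N M j) * d) $$ (r, s)
        = mat_app (S ^\<^sub>m l * (M (Suc j) - S) * steps N M j) ?v r"
      by (rule index_mult_mat_app[OF mult_carrier_mat[OF SD steps_carrier] d r s])
    also have "\<dots> = mat_app (S ^\<^sub>m l * (M (Suc j) - S)) (mat_app (steps N M j) ?v) r"
      by (rule mat_app_mult[OF SD steps_carrier r])
    also have "\<dots> = mat_app (S ^\<^sub>m l) (mat_app (M (Suc j) - S) (mat_app (steps N M j) ?v)) r"
      by (rule mat_app_mult[OF Sl D r])
    also have "mat_app (M (Suc j) - S) (mat_app (steps N M j) ?v) = incr ?v j"
      unfolding incr_def using D by (intro ext mat_app_cong steps_app) auto
    also have "mat_app (S ^\<^sub>m l) (incr ?v j) r = (T ^^ l) (incr ?v j) r"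
      by (rule power_mat_app[OF S r])
    finally show ?thesis .
  qed
  have "perturbation_sum N S M d k $$ (r, s)
      = (\<Sum>j = 1..k. ((S ^\<^sub>m (k - j) * (M j - S) * steps N M (j - 1)) * d) $$ (r, s))"
    unfolding perturbation_sum_def by (subst index_mat(1)) (simp_all add: r s)
  \<comment> \<open>Matrix level \<open>j\<close> from 1 to \<open>k\<close> becomes step index
    \<open>j - 1\<close>, the index used by \<open>incr\<close>.\<close>
  also have "\<dots> = (\<Sum>j<k. ((S ^\<^sub>m (k - Suc j) * (M (Suc j) - S) * steps N M j) * d) $$ (r, s))"
    by (rule sum.reindex_bij_witness[of _ Suc "\<lambda>j. j - 1"]) auto
  also have "\<dots> = (\<Sum>j<k. (T ^^ (k - Suc j)) (incr ?v j) r)"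
    by (simp only: summand)
  finally show ?thesis .
qed

text \<open>\<open>xt\<close> is invariant under the transposed powers of \<open>S\<close>. In the
  limit these have equal rows \<open>x\<close>, so \<open>xt\<close> equals \<open>x\<close> times
  the sum of its own entries, which is 1.\<close>

lemma left_eigenvector_unique:
  assumes xt: "normalized_left_eigenvector N S xt" and j: "j < N"
  shows "xt $ j = x j"
proof -
  from xt have carrier: "xt \<in> carrier_vec N" and eig: "transpose_mat S *\<^sub>v xt = xt"
    and norm: "(\<Sum>i<N. xt $ i) = 1"
    by (auto simp: normalized_left_eigenvector_def ones_vec_def scalar_prod_def lessThan_atLeast0)
  have col: "(\<Sum>i<N. xt $ i * S $$ (i, m)) = xt $ m" if "m < N" for m
  proof -
    have "xt $ m = (transpose_mat S *\<^sub>v xt) $ m" by (simp add: eig)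
    also have "\<dots> = (\<Sum>i<N. S $$ (i, m) * xt $ i)"
      using S carrier that by (simp add: scalar_prod_def lessThan_atLeast0)
    finally show ?thesis by (simp add: mult.commute)
  qed
  have inv: "(\<Sum>i<N. xt $ i * T v i) = (\<Sum>i<N. xt $ i * v i)" for v
  proof -
    have "(\<Sum>i<N. xt $ i * T v i) = (\<Sum>i<N. \<Sum>m<N. xt $ i * S $$ (i, m) * v m)"
      by (simp add: mat_app_carrier[OF S] sum_distrib_left mult.assoc)
    also have "\<dots> = (\<Sum>m<N. (\<Sum>i<N. xt $ i * S $$ (i, m)) * v m)"
      by (subst sum.swap) (simp add: sum_distrib_right)
    finally show ?thesis by (simp add: col)
  qed
  let ?e = "\<lambda>m. if m = j then 1 else 0 :: real"
  have pow: "(\<Sum>i<N. xt $ i * (T ^^ k) ?e i) = xt $ j" for k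
    by (induction k) (simp_all only: funpow.simps comp_def id_apply inv sum_single[OF j])
  have "(\<lambda>k. \<Sum>i<N. xt $ i * (T ^^ k) ?e i) \<longlonglongrightarrow> (\<Sum>i<N. xt $ i * (\<Sum>m<N. x m * ?e m))"
    by (intro tendsto_intros power_tendsto) auto
  then have "(\<lambda>k :: nat. xt $ j) \<longlonglongrightarrow> (\<Sum>i<N. xt $ i * x j)"
    by (simp only: pow sum_single[OF j])
  then have "xt $ j = (\<Sum>i<N. xt $ i * x j)" by (rule LIMSEQ_unique[OF tendsto_const])
  also have "\<dots> = x j" by (simp add: sum_distrib_right[symmetric] norm)
  finally show ?thesis .
qed

text \<open>\<open>S ^ k * S\<close> and \<open>S ^ (k + 1)\<close> have the same limit, so the
  limiting row \<open>x\<close> is fixed by \<open>S\<close> from the right. Any row shows this; row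
  0 is read off. The normalization holds because every power preserves the vector of ones.\<close>

lemma left_eigenvector_exists:
  assumes N: "0 < N" and rows: "\<And>i. i < N \<Longrightarrow> (\<Sum>j<N. S $$ (i, j)) = 1"
  shows "normalized_left_eigenvector N S (Matrix.vec N x)"
proof -
  have "(\<Sum>m<N. x m * S $$ (m, j)) = x j" if j: "j < N" for j
  proof -
    let ?e = "\<lambda>m. if m = j then 1 else 0 :: real"
    have Te: "T ?e m = S $$ (m, j)" for m by (simp only: mat_app_carrier[OF S] sum_single[OF j])
    have "(\<lambda>k. (T ^^ k) (T ?e) 0) \<longlonglongrightarrow> (\<Sum>m<N. x m * T ?e m)" by (rule power_tendsto[OF N])
    moreover have "(\<lambda>k. (T ^^ Suc k) ?e 0) \<longlonglongrightarrow> (\<Sum>m<N. x m * ?e m)"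
      by (rule LIMSEQ_Suc[OF power_tendsto[OF N]])
    ultimately have "(\<Sum>m<N. x m * T ?e m) = (\<Sum>m<N. x m * ?e m)"
      unfolding funpow_Suc_right comp_def by (rule LIMSEQ_unique)
    then show ?thesis by (simp only: Te sum_single[OF j])
  qed
  moreover have "(\<Sum>m<N. x m) = 1"
  proof -
    have "(T ^^ k) (\<lambda>_. 1) i = 1" if "i < N" for k i
      using that
    proof (induction k arbitrary: i)
      case (Suc k)
      have "(T ^^ Suc k) (\<lambda>_. 1) i = T (\<lambda>_. 1) i"
        unfolding funpow.simps comp_def using S Suc.IH by (intro mat_app_cong) auto
      also have "\<dots> = 1" using rows[OF Suc.prems] by (simp add: mat_app_carrier[OF S])
      finally show ?case .
    qed simp
    with power_tendsto[OF N, of "\<lambda>_. 1"] N have "(\<lambda>k :: nat. 1) \<longlonglongrightarrow> (\<Sum>m<N. x m)" by simp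
    from LIMSEQ_unique[OF this tendsto_const] show ?thesis .
  qed
  ultimately show ?thesis
    using S unfolding normalized_left_eigenvector_def
    by (auto simp: ones_vec_def scalar_prod_def lessThan_atLeast0 mult.commute intro!: eq_vecI)
qed

end

section \<open>Rings\<close>

lemma vec_norm_inf_le_iff:
  assumes "v \<in> carrier_vec 3"
  shows "vec_norm_inf v \<le> e \<longleftrightarrow> (\<forall>s<3. \<bar>v $ s\<bar> \<le> e)"
proof -
  have "0 \<in> {..<3 :: nat}" by simp
  then have "{..<3 :: nat} \<noteq> {}" by blast
  with assms show ?thesis by (auto simp: vec_norm_inf_def)
qed

lemma vec_norm_inf_nonneg:
  assumes "v \<in> carrier_vec 3"
  shows "0 \<le> vec_norm_inf v"
proof -
  have "\<bar>v $ 0\<bar> \<le> vec_norm_inf v" using vec_norm_inf_le_iff[OF assms, of "vec_norm_inf v"] by simp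
  then show ?thesis by linarith
qed

section \<open>Geometry of the cells and rings\<close>

lemma Omega_nonempty: "Omega T k \<noteq> {}"
proof -
  have "(2, 0) \<in> sector T - inner_sector T" by (cases T) auto
  then have "sector T - inner_sector T \<noteq> {}" by (metis empty_iff)
  then show ?thesis by (simp add: Omega_def closure_eq_empty)
qed

lemma closed_unit_cell: "closed (unit_cell T j)"
proof (cases T)
  case Quadrilateral
  then show ?thesis by (auto intro!: closed_Times)
next
  case Triangular
  have "closed {x :: real \<times> real. 1 \<le> fst x \<and> 0 \<le> snd x \<and> fst x + snd x \<le> 2}"
    "closed {x :: real \<times> real. fst x \<le> 1 \<and> snd x \<le> 1 \<and> 1 \<le> fst x + snd x}"
    "closed {x :: real \<times> real. 0 \<le> fst x \<and> 1 \<le> snd x \<and> fst x + snd x \<le> 2}"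
    by (intro closed_Collect_conj closed_Collect_le continuous_intros)+
  with Triangular show ?thesis by (simp add: case_prod_unfold)
qed

lemma closure_subset_unit_cells: "closure (sector T - inner_sector T) \<subseteq> (\<Union>j<3. unit_cell T j)"
proof (rule closure_minimal)
  show "closed (\<Union>j<3. unit_cell T j)" by (intro closed_UN ballI closed_unit_cell) simp
  show "sector T - inner_sector T \<subseteq> (\<Union>j<3. unit_cell T j)"
  proof
    fix x assume x: "x \<in> sector T - inner_sector T"
    obtain u v where uv: "x = (u, v)" by (cases x)
    have "x \<in> unit_cell T 0 \<or> x \<in> unit_cell T 1 \<or> x \<in> unit_cell T 2"
    proof (cases T)
      case Quadrilateral
      with x uv have "0 \<le> u" "u \<le> 2" "0 \<le> v" "v \<le> 2" "1 < u \<or> 1 < v" by auto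
      then show ?thesis unfolding uv Quadrilateral by simp linarith
    next
      case Triangular
      with x uv have "0 \<le> u" "0 \<le> v" "u + v \<le> 2" "1 < u + v" by auto
      then show ?thesis unfolding uv Triangular by simp linarith
    qed
    moreover have "0 < (3 :: nat)" "1 < (3 :: nat)" "2 < (3 :: nat)" by simp_all
    ultimately show "x \<in> (\<Union>j<3. unit_cell T j)" by blast
  qed
qed

lemma Omega_cell: "x \<in> Omega T k \<Longrightarrow> \<exists>j<3. x \<in> cell T k j"
  using closure_subset_unit_cells[of T] unfolding Omega_def cell_def by blast

lemma half_power_image_iff:
  "(1 / 2) ^ k *\<^sub>R x \<in> (\<lambda>y. (1 / 2) ^ k *\<^sub>R y) ` A \<longleftrightarrow> (x :: real \<times> real) \<in> A"
  by (rule inj_image_mem_iff) (simp add: inj_on_def)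

lemma cell_scale: "(1 / 2) ^ k *\<^sub>R x \<in> cell T (Suc k) j \<longleftrightarrow> x \<in> cell T 1 j"
  unfolding cell_def diff_Suc_1 half_power_image_iff by simp

lemma Omega_scale: "(1 / 2) ^ k *\<^sub>R x \<in> Omega T (Suc k) \<longleftrightarrow> x \<in> Omega T 1"
  unfolding Omega_def diff_Suc_1 half_power_image_iff by simp

lemma sum_patch_basis:
  assumes "finite (stencil pd)" and "selection pd ` stencil pd \<subseteq> {..<N}"
  shows "(\<Sum>m<N. w m * patch_basis N \<phi> pd k x $ m)
    = (\<Sum>\<alpha>\<in>stencil pd. w (selection pd \<alpha>) * cell_basis \<phi> pd k \<alpha> x)"
proof -
  have "(\<Sum>m<N. w m * patch_basis N \<phi> pd k x $ m) = (\<Sum>m<N. \<Sum>\<alpha> | \<alpha> \<in> stencil pd \<and> selection pd \<alpha> = m.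
      w (selection pd \<alpha>) * cell_basis \<phi> pd k \<alpha> x)"
    by (intro sum.cong refl) (auto simp: patch_basis_def sum_distrib_left intro!: sum.cong)
  also have "\<dots> = (\<Sum>\<alpha>\<in>stencil pd. w (selection pd \<alpha>) * cell_basis \<phi> pd k \<alpha> x)"
    using assms by (intro sum.group) auto
  finally show ?thesis .
qed

lemma dim_ring_basis: "dim_vec (ring_basis T N L c k z) = N"
  by (simp add: ring_basis_def patch_basis_def case_prod_beta)

lemma subdiv_ring_index:
  assumes "ctrl M d k \<in> carrier_mat N 3" and "s < 3"
  shows "subdiv_ring T N L c M d k z $ s
    = (\<Sum>m<N. ctrl M d k $$ (m, s) * ring_basis T N L c k z $ m)"
  using assms by (simp add: subdiv_ring_def scalar_prod_def dim_ring_basis lessThan_atLeast0)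

locale irregular_layout = convergent_mask cbar for cbar +
  fixes T :: mesh and n N P :: nat and L :: "nat \<Rightarrow> nat \<Rightarrow> patch_data"
  assumes layout: "admissible_layout T n N P L (basic_limit (\<lambda>_. cbar))"
    and n: "1 \<le> n"
begin

lemma ring_domain_nonempty: "ring_domain T n k \<noteq> {}"
  using n Omega_nonempty by (auto simp: ring_domain_def lessThan_empty_iff)

text \<open>The choice of the cell does not depend on the masks, so one pair \<open>i\<close>,
  \<open>j\<close> serves the perturbed and the stationary basis at the same point.\<close>

lemma ring_cell:
  assumes "z \<in> ring_domain T n k"
  obtains i j where "i < n" "j < 3" "fst z \<in> cell T k j"
    "\<And>c. ring_basis T N L c k z = patch_basis N (basic_limit c) (L i j) k (fst z)"
proof -
  from assms have z: "fst z \<in> Omega T k" "snd z < n" by (auto simp: ring_domain_def)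
  from Omega_cell[OF z(1)] obtain j where j: "j < 3" "fst z \<in> cell T k j" by blast
  let ?j = "LEAST j. fst z \<in> cell T k j"
  have "fst z \<in> cell T k ?j" using j(2) by (rule LeastI)
  moreover have "?j \<le> j" using j(2) by (rule Least_le)
  ultimately show thesis using that[of "snd z" ?j] z(2) j(1)
    by (simp add: ring_basis_def case_prod_beta)
qed

lemma stencil:
  assumes "i < n" "j < 3"
  shows "finite (stencil (L i j))" "card (stencil (L i j)) = P"
    "selection (L i j) ` stencil (L i j) \<subseteq> {..<N}"
  using layout assms unfolding admissible_layout_def by blast+

lemma cell_partition:
  assumes "k \<ge> 1" "i < n" "j < 3" "x \<in> cell T k j"
  shows "(\<Sum>\<alpha>\<in>stencil (L i j). cell_basis (basic_limit (\<lambda>_. cbar)) (L i j) k \<alpha> x) = 1"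
proof -
  have support: "cell_basis (basic_limit (\<lambda>_. cbar)) (L i j) k \<alpha> x \<noteq> 0 \<Longrightarrow> \<alpha> \<in> stencil (L i j)" for \<alpha>
    using layout assms unfolding admissible_layout_def by blast
  show ?thesis
    using phibar_partition_of_unity[OF stencil(1)[OF assms(2,3)],
        of "2 ^ (k - 1) *\<^sub>R chart (L i j) x - offset (L i j)"] support
    unfolding cell_basis_def basic_limit_const[of cbar k 1] by blast
qed

lemma ring_partition:
  assumes "k \<ge> 1" "z \<in> ring_domain T n k"
  shows "(\<Sum>m<N. ring_basis T N L (\<lambda>_. cbar) k z $ m) = 1"
proof -
  from ring_cell[OF assms(2)] obtain i j where ij: "i < n" "j < 3" "fst z \<in> cell T k j"
    and basis: "ring_basis T N L (\<lambda>_. cbar) k z = patch_basis N (basic_limit (\<lambda>_. cbar)) (L i j) k (fst z)"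
    by metis
  from sum_patch_basis[OF stencil(1,3)[OF ij(1,2)], of "\<lambda>_. 1"] cell_partition[OF assms(1) ij]
  show ?thesis by (simp add: basis)
qed

text \<open>The chart is linear, the stationary basic limit function does not depend on the level
  and the least cell number is invariant under scaling. All stationary rings thus use one basis, and
  their convergence becomes a statement on powers of \<open>S\<close>.\<close>

lemma stationary_ring_basis_scale:
  assumes x: "x \<in> Omega T 1" and i: "i < n"
  shows "ring_basis T N L (\<lambda>_. cbar) (Suc k) ((1 / 2) ^ k *\<^sub>R x, i) = ring_basis T N L (\<lambda>_. cbar) 1 (x, i)"
proof -
  from Omega_cell[OF x] have "\<exists>j. x \<in> cell T 1 j" by blast
  then have j: "(LEAST j. x \<in> cell T 1 j) < 3"
    using Omega_cell[OF x] by (meson Least_le le_less_trans)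
  have "linear (chart (L i j))" if "j < 3" for j
    using layout i that unfolding admissible_layout_def by blast
  then have "cell_basis (basic_limit (\<lambda>_. cbar)) (L i j) (Suc k) \<alpha> ((1 / 2) ^ k *\<^sub>R x)
      = cell_basis (basic_limit (\<lambda>_. cbar)) (L i j) 1 \<alpha> x" if "j < 3" for j \<alpha>
    using that by (simp add: cell_basis_def basic_limit_const[of cbar "Suc k" 1] linear_scale power_one_over)
  with j show ?thesis by (simp add: ring_basis_def cell_scale patch_basis_def del: One_nat_def)
qed

end

locale irregular_perturbation =
  irregular_layout cbar T n N P L + asymptotically_equivalent_masks cbar c
  for cbar T n N P L c
begin

definition limit_error :: "nat \<Rightarrow> real" where
  "limit_error k = stability * growth * defect_tail k"

lemma limit_error_tendsto: "limit_error \<longlonglongrightarrow> 0"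
  unfolding limit_error_def[abs_def] by (rule tendsto_mult_right_zero[OF defect_tail_tendsto])

text \<open>The stationary basis sums to one, so \<open>r\<close> can be expanded in it. The
  difference splits into the deviation of the control points, weighted by bounded basis functions,
  and \<open>r\<close> times the deviation of the two bases; \<open>P\<close> counts the
  stencil.\<close>

lemma ring_error:
  assumes k: "k \<ge> 1" and z: "z \<in> ring_domain T n k" and B: "\<And>x. \<bar>phibar x\<bar> \<le> B"
  shows "\<bar>(\<Sum>m<N. w m * ring_basis T N L c k z $ m) - r\<bar>
    \<le> real P * ((\<Sum>m<N. \<bar>w m - r\<bar>) * (B + limit_error k) + \<bar>r\<bar> * limit_error k)"
proof -
  from ring_cell[OF z] obtain i j where ij: "i < n" "j < 3" "fst z \<in> cell T k j"
    and basis: "ring_basis T N L c k z = patch_basis N (basic_limit c) (L i j) k (fst z)"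
    by metis
  let ?St = "stencil (L i j)" and ?w = "\<lambda>\<alpha>. w (selection (L i j) \<alpha>)"
  let ?f = "\<lambda>\<alpha>. cell_basis (basic_limit c) (L i j) k \<alpha> (fst z)"
  let ?g = "\<lambda>\<alpha>. cell_basis (basic_limit (\<lambda>_. cbar)) (L i j) k \<alpha> (fst z)"
  have close: "\<bar>?f \<alpha> - ?g \<alpha>\<bar> \<le> limit_error k" for \<alpha>
    unfolding cell_basis_def limit_error_def basic_limit_const[of cbar k 1]
    by (rule basic_limit_close[OF k])
  have g: "\<bar>?g \<alpha>\<bar> \<le> B" for \<alpha> unfolding cell_basis_def basic_limit_const[of cbar k 1] by (rule B)
  have f: "\<bar>?f \<alpha>\<bar> \<le> B + limit_error k" for \<alpha> using close[of \<alpha>] g[of \<alpha>] by linarith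
  have w: "\<bar>?w \<alpha> - r\<bar> \<le> (\<Sum>m<N. \<bar>w m - r\<bar>)" if "\<alpha> \<in> ?St" for \<alpha>
    using stencil(3)[OF ij(1,2)] that by (intro member_le_sum[of _ _ "\<lambda>m. \<bar>w m - r\<bar>"]) auto
  have "(\<Sum>m<N. w m * ring_basis T N L c k z $ m) - r = (\<Sum>\<alpha>\<in>?St. ?w \<alpha> * ?f \<alpha>) - r * (\<Sum>\<alpha>\<in>?St. ?g \<alpha>)"
    unfolding basis sum_patch_basis[OF stencil(1,3)[OF ij(1,2)]] cell_partition[OF k ij] by simp
  also have "\<dots> = (\<Sum>\<alpha>\<in>?St. (?w \<alpha> - r) * ?f \<alpha> + r * (?f \<alpha> - ?g \<alpha>))"
    by (simp add: sum_distrib_left sum_subtractf[symmetric] algebra_simps)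
  finally have "\<bar>(\<Sum>m<N. w m * ring_basis T N L c k z $ m) - r\<bar>
      \<le> (\<Sum>\<alpha>\<in>?St. \<bar>(?w \<alpha> - r) * ?f \<alpha> + r * (?f \<alpha> - ?g \<alpha>)\<bar>)"
    by (simp only: sum_abs)
  also have "\<dots> \<le> (\<Sum>\<alpha>\<in>?St. (\<Sum>m<N. \<bar>w m - r\<bar>) * (B + limit_error k) + \<bar>r\<bar> * limit_error k)"
  proof (rule sum_mono)
    fix \<alpha> assume \<alpha>: "\<alpha> \<in> ?St"
    have "\<bar>(?w \<alpha> - r) * ?f \<alpha> + r * (?f \<alpha> - ?g \<alpha>)\<bar> \<le> \<bar>?w \<alpha> - r\<bar> * \<bar>?f \<alpha>\<bar> + \<bar>r\<bar> * \<bar>?f \<alpha> - ?g \<alpha>\<bar>"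
      unfolding abs_mult[symmetric] by (rule abs_triangle_ineq)
    also have "\<dots> \<le> (\<Sum>m<N. \<bar>w m - r\<bar>) * (B + limit_error k) + \<bar>r\<bar> * limit_error k"
      by (intro add_mono mult_mono w[OF \<alpha>] f close mult_left_mono sum_nonneg) auto
    finally show "\<bar>(?w \<alpha> - r) * ?f \<alpha> + r * (?f \<alpha> - ?g \<alpha>)\<bar>
        \<le> (\<Sum>m<N. \<bar>w m - r\<bar>) * (B + limit_error k) + \<bar>r\<bar> * limit_error k" .
  qed
  also have "\<dots> = real P * ((\<Sum>m<N. \<bar>w m - r\<bar>) * (B + limit_error k) + \<bar>r\<bar> * limit_error k)"
    by (simp add: stencil(2)[OF ij(1,2)])
  finally show ?thesis .
qed

lemma ring_limit:
  assumes ctrl: "\<And>k. ctrl M d k \<in> carrier_mat N 3" and r: "r \<in> carrier_vec 3"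
    and lim: "\<And>m s. m < N \<Longrightarrow> s < 3 \<Longrightarrow> (\<lambda>k. ctrl M d k $$ (m, s)) \<longlonglongrightarrow> r $ s"
  shows "(\<lambda>k. SUP z\<in>ring_domain T n k. ereal (vec_norm_inf (subdiv_ring T N L c M d k z - r))) \<longlonglongrightarrow> 0"
proof -
  have carrier: "subdiv_ring T N L c M d k z - r \<in> carrier_vec 3" for k z
    by (intro carrier_vecI) (simp add: carrier_vecD[OF r])
  obtain B where B: "\<And>x. \<bar>phibar x\<bar> \<le> B" using phibar_bounded by blast
  define \<eta> where "\<eta> s k = real P * ((\<Sum>m<N. \<bar>ctrl M d k $$ (m, s) - r $ s\<bar>) * (B + limit_error k)
      + \<bar>r $ s\<bar> * limit_error k)" for s k
  have "(\<lambda>k. \<eta> s k) \<longlonglongrightarrow> real P * ((\<Sum>m<N. \<bar>r $ s - r $ s\<bar>) * (B + 0) + \<bar>r $ s\<bar> * 0)" if "s < 3" for s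
    unfolding \<eta>_def using that by (intro tendsto_intros lim limit_error_tendsto) auto
  then have \<eta>: "\<eta> s \<longlonglongrightarrow> 0" if "s < 3" for s using that by simp
  show ?thesis
  proof (subst SUP_ereal_tendsto_0_iff, goal_cases)
    case 3
    show ?case
    proof (intro allI impI)
      fix e :: real assume "e > 0"
      then have "\<forall>\<^sub>F k in sequentially. \<forall>s\<in>{..<3}. \<eta> s k < e"
        by (intro eventually_ball_finite) (auto intro: order_tendstoD(2)[OF \<eta>])
      with eventually_ge_at_top[of 1]
      show "\<forall>\<^sub>F k in sequentially. \<forall>z\<in>ring_domain T n k. vec_norm_inf (subdiv_ring T N L c M d k z - r) \<le> e"
      proof eventually_elim
        case (elim k)
        show ?case
        proof
          fix z assume z: "z \<in> ring_domain T n k"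
          show "vec_norm_inf (subdiv_ring T N L c M d k z - r) \<le> e"
            unfolding vec_norm_inf_le_iff[OF carrier]
          proof (intro allI impI)
            fix s :: nat assume s: "s < 3"
            have "(subdiv_ring T N L c M d k z - r) $ s
                = (\<Sum>m<N. ctrl M d k $$ (m, s) * ring_basis T N L c k z $ m) - r $ s"
              using r s by (simp add: subdiv_ring_index[OF ctrl])
            with ring_error[OF elim(1) z B, of "\<lambda>m. ctrl M d k $$ (m, s)" "r $ s"]
            have "\<bar>(subdiv_ring T N L c M d k z - r) $ s\<bar> \<le> \<eta> s k" by (simp add: \<eta>_def)
            moreover have "\<eta> s k < e" using elim(2) s by simp
            ultimately show "\<bar>(subdiv_ring T N L c M d k z - r) $ s\<bar> \<le> e" by linarith
          qed
        qed
      qed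
    qed
  qed (use ring_domain_nonempty vec_norm_inf_nonneg[OF carrier] in auto)
qed

end

section \<open>The local matrix of the stationary scheme\<close>

text \<open>A fixed point of the first ring is followed through its scaled copies in all later
  rings; the ring limit gives the same \<open>r\<close> for all points.\<close>

lemma (in irregular_layout) stationary_observations:
  assumes conv: "convergent_irregular T n N L (\<lambda>_. cbar) (\<lambda>_. S)"
    and S: "S \<in> carrier_mat N N" and d: "d \<in> carrier_mat N 3"
  shows "\<exists>r. \<forall>s<3. \<forall>z\<in>ring_domain T n 1.
    (\<lambda>k. \<Sum>m<N. (mat_app S ^^ k) (\<lambda>i. d $$ (i, s)) m * ring_basis T N L (\<lambda>_. cbar) 1 z $ m) \<longlonglongrightarrow> r s"
proof -
  from conv d obtain r where r: "r \<in> carrier_vec 3"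
    and lim: "(\<lambda>k. SUP z\<in>ring_domain T n k.
        ereal (vec_norm_inf (subdiv_ring T N L (\<lambda>_. cbar) (\<lambda>_. S) d k z - r))) \<longlonglongrightarrow> 0"
    unfolding convergent_irregular_def by blast
  have after: "ctrl_after (\<lambda>_. S) d k \<in> carrier_mat N 3" for k
    by (induction k) (use d in \<open>auto intro: mult_carrier_mat[OF S]\<close>)
  have entry: "ctrl_after (\<lambda>_. S) d k $$ (m, s) = (mat_app S ^^ k) (\<lambda>i. d $$ (i, s)) m"
    if "m < N" "s < 3" for k m s
    using that(1)
  proof (induction k arbitrary: m)
    case (Suc k)
    have "ctrl_after (\<lambda>_. S) d (Suc k) $$ (m, s) = mat_app S (\<lambda>i. ctrl_after (\<lambda>_. S) d k $$ (i, s)) m"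
      using index_mult_mat_app[OF S after Suc.prems that(2)] by simp
    also have "\<dots> = mat_app S ((mat_app S ^^ k) (\<lambda>i. d $$ (i, s))) m"
      using S Suc.IH by (intro mat_app_cong) auto
    finally show ?case by simp
  qed simp
  have carrier: "subdiv_ring T N L (\<lambda>_. cbar) (\<lambda>_. S) d k z - r \<in> carrier_vec 3" for k z
    by (intro carrier_vecI) (simp add: carrier_vecD[OF r])
  have small: "\<forall>e>0. \<forall>\<^sub>F k in sequentially. \<forall>z\<in>ring_domain T n k.
      vec_norm_inf (subdiv_ring T N L (\<lambda>_. cbar) (\<lambda>_. S) d k z - r) \<le> e"
    using lim by (subst (asm) SUP_ereal_tendsto_0_iff)
      (use ring_domain_nonempty vec_norm_inf_nonneg[OF carrier] in auto)
  have "(\<lambda>k. \<Sum>m<N. (mat_app S ^^ k) (\<lambda>i. d $$ (i, s)) m * ring_basis T N L (\<lambda>_. cbar) 1 z $ m) \<longlonglongrightarrow> r $ s"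
    (is "?obs \<longlonglongrightarrow> _") if s: "s < 3" and z: "z \<in> ring_domain T n 1" for s z
  proof (rule LIMSEQ_I)
    fix e :: real assume "e > 0"
    then have "e / 2 > 0" by simp
    with small obtain k0 where k0: "\<And>k z. k \<ge> k0 \<Longrightarrow> z \<in> ring_domain T n k \<Longrightarrow>
        vec_norm_inf (subdiv_ring T N L (\<lambda>_. cbar) (\<lambda>_. S) d k z - r) \<le> e / 2"
      unfolding eventually_sequentially by blast
    have "norm (?obs k - r $ s) < e" if "k \<ge> k0" for k
    proof -
      let ?z = "((1 / 2) ^ k *\<^sub>R fst z, snd z)"
      have z': "fst z \<in> Omega T 1" "snd z < n" using z by (auto simp: ring_domain_def)
      then have "?z \<in> ring_domain T n (Suc k)" using Omega_scale by (simp add: ring_domain_def)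
      with that have "vec_norm_inf (subdiv_ring T N L (\<lambda>_. cbar) (\<lambda>_. S) d (Suc k) ?z - r) \<le> e / 2"
        by (intro k0) simp
      then have "\<bar>(subdiv_ring T N L (\<lambda>_. cbar) (\<lambda>_. S) d (Suc k) ?z - r) $ s\<bar> \<le> e / 2"
        unfolding vec_norm_inf_le_iff[OF carrier] using s by blast
      moreover have "(subdiv_ring T N L (\<lambda>_. cbar) (\<lambda>_. S) d (Suc k) ?z - r) $ s = ?obs k - r $ s"
        using r s after[of k] entry[OF _ s] stationary_ring_basis_scale[OF z', of k]
        by (simp add: subdiv_ring_index[of "\<lambda>_. S" d "Suc k" N] ctrl_def)
      ultimately show ?thesis using \<open>e > 0\<close> by simp
    qed
    then show "\<exists>k0. \<forall>k\<ge>k0. norm (?obs k - r $ s) < e" by blast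
  qed
  then show ?thesis by blast
qed

text \<open>A real matrix acts separately on real and imaginary parts; this carries convergence of
  real rings over to complex vectors.\<close>

lemma complex_mat_app_power:
  fixes S :: "real mat"
  assumes S: "S \<in> carrier_mat N N" and "i < N"
  shows "(mat_app (map_mat complex_of_real S) ^^ k) v i
    = complex_of_real ((mat_app S ^^ k) (\<lambda>i. Re (v i)) i)
      + \<i> * complex_of_real ((mat_app S ^^ k) (\<lambda>i. Im (v i)) i)"
  using \<open>i < N\<close>
proof (induction k arbitrary: i)
  case 0
  show ?case by (simp add: complex_eq_iff)
next
  case (Suc k)
  let ?A = "map_mat complex_of_real S"
  have A: "?A \<in> carrier_mat N N" using S by simp
  have "(mat_app ?A ^^ Suc k) v i = mat_app ?A (\<lambda>i. complex_of_real ((mat_app S ^^ k) (\<lambda>i. Re (v i)) i)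
      + \<i> * complex_of_real ((mat_app S ^^ k) (\<lambda>i. Im (v i)) i)) i"
    unfolding funpow.simps comp_def using S Suc.IH by (intro mat_app_cong) auto
  also have "\<dots> = mat_app ?A (\<lambda>i. complex_of_real ((mat_app S ^^ k) (\<lambda>i. Re (v i)) i)) i
      + \<i> * mat_app ?A (\<lambda>i. complex_of_real ((mat_app S ^^ k) (\<lambda>i. Im (v i)) i)) i"
    by (simp only: mat_app_add mat_app_scale)
  also have "\<dots> = complex_of_real ((mat_app S ^^ Suc k) (\<lambda>i. Re (v i)) i)
      + \<i> * complex_of_real ((mat_app S ^^ Suc k) (\<lambda>i. Im (v i)) i)"
  proof -
    have "mat_app ?A (\<lambda>i. complex_of_real (h i)) i = complex_of_real (mat_app S h i)" for h
      unfolding mat_app_carrier[OF A] mat_app_carrier[OF S] using Suc.prems S by simp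
    then show ?thesis by (simp only: funpow.simps comp_def)
  qed
  finally show ?case .
qed

lemma (in irregular_layout) local_matrix_powers_converge:
  assumes conv: "convergent_irregular T n N L (\<lambda>_. cbar) (\<lambda>_. S)"
    and S: "S \<in> carrier_mat N N"
    and rows: "\<And>i. i < N \<Longrightarrow> (\<Sum>j<N. S $$ (i, j)) = 1"
    and effective: "no_ineffective_eigenvectors T n N L cbar S"
  shows "\<exists>x. \<forall>i<N. \<forall>j<N. (\<lambda>k. (S ^\<^sub>m k) $$ (i, j)) \<longlonglongrightarrow> x j"
proof -
  let ?A = "map_mat complex_of_real S"
  let ?\<Phi> = "\<lambda>z i. complex_of_real (ring_basis T N L (\<lambda>_. cbar) 1 z $ i)"
  have A: "?A \<in> carrier_mat N N" using S by simp
  interpret observed_matrix N ?A "ring_domain T n 1" ?\<Phi>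
  proof
    show "?A \<in> carrier_mat N N" by (rule A)
    show "(\<Sum>j<N. ?A $$ (i, j)) = 1" if "i < N" for i
    proof -
      have "(\<Sum>j<N. ?A $$ (i, j)) = complex_of_real (\<Sum>j<N. S $$ (i, j))" using that S by simp
      then show ?thesis by (simp only: rows[OF that] of_real_1)
    qed
    show "(\<Sum>i<N. ?\<Phi> z i) = 1" if "z \<in> ring_domain T n 1" for z
      unfolding of_real_sum[symmetric] ring_partition[OF order_refl that] by (rule of_real_1)
    show "\<exists>r. \<forall>z\<in>ring_domain T n 1. (\<lambda>k. \<Sum>i<N. (mat_app ?A ^^ k) v i * ?\<Phi> z i) \<longlonglongrightarrow> r" for v
    proof -
      \<comment> \<open>Columns 0 and 1 hold the real and imaginary parts, so that one spatial
        control net tests a complex vector; the third column is filler.\<close>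
      define d where "d = Matrix.mat N 3 (\<lambda>(i, s). if s = 0 then Re (v i) else Im (v i))"
      have d: "d \<in> carrier_mat N 3" by (simp add: d_def)
      from stationary_observations[OF conv S d] obtain r where
        r: "\<And>s z. s < 3 \<Longrightarrow> z \<in> ring_domain T n 1 \<Longrightarrow> (\<lambda>k. \<Sum>m<N. (mat_app S ^^ k) (\<lambda>i. d $$ (i, s)) m
            * ring_basis T N L (\<lambda>_. cbar) 1 z $ m) \<longlonglongrightarrow> r s" by blast
      have cong: "(mat_app S ^^ k) f m = (mat_app S ^^ k) g m"
        if "m < N" "\<And>i. i < N \<Longrightarrow> f i = g i" for f g :: "nat \<Rightarrow> real" and k m
      proof -
        have "mat_app (S ^\<^sub>m k) f m = mat_app (S ^\<^sub>m k) g m"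
          using that(2) S by (intro mat_app_cong) (auto split: if_splits)
        then show ?thesis using power_mat_app[OF S that(1)] by simp
      qed
      have "(\<lambda>k. \<Sum>i<N. (mat_app ?A ^^ k) v i * ?\<Phi> z i)
          \<longlonglongrightarrow> complex_of_real (r 0) + \<i> * complex_of_real (r 1)" if z: "z \<in> ring_domain T n 1" for z
      proof -
        have "(\<lambda>k. complex_of_real (\<Sum>m<N. (mat_app S ^^ k) (\<lambda>i. d $$ (i, 0)) m * ring_basis T N L (\<lambda>_. cbar) 1 z $ m)
            + \<i> * complex_of_real (\<Sum>m<N. (mat_app S ^^ k) (\<lambda>i. d $$ (i, 1)) m * ring_basis T N L (\<lambda>_. cbar) 1 z $ m))
          \<longlonglongrightarrow> complex_of_real (r 0) + \<i> * complex_of_real (r 1)"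
          using z by (intro tendsto_intros r) auto
        moreover have "(\<Sum>i<N. (mat_app ?A ^^ k) v i * ?\<Phi> z i)
            = complex_of_real (\<Sum>m<N. (mat_app S ^^ k) (\<lambda>i. d $$ (i, 0)) m * ring_basis T N L (\<lambda>_. cbar) 1 z $ m)
            + \<i> * complex_of_real (\<Sum>m<N. (mat_app S ^^ k) (\<lambda>i. d $$ (i, 1)) m * ring_basis T N L (\<lambda>_. cbar) 1 z $ m)"
          (is "_ = complex_of_real (\<Sum>m<N. ?a k m * ?b m) + \<i> * complex_of_real (\<Sum>m<N. ?a' k m * ?b m)") for k
        proof -
          have "(mat_app ?A ^^ k) v m * ?\<Phi> z m
              = complex_of_real (?a k m * ?b m) + \<i> * complex_of_real (?a' k m * ?b m)" if m: "m < N" for m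
          proof -
            have "?a k m = (mat_app S ^^ k) (\<lambda>i. Re (v i)) m"
              by (rule cong[OF m]) (simp add: d_def)
            moreover have "?a' k m = (mat_app S ^^ k) (\<lambda>i. Im (v i)) m"
              by (rule cong[OF m]) (simp add: d_def)
            ultimately show ?thesis
              unfolding complex_mat_app_power[OF S m] by (simp only: of_real_mult distrib_right mult.assoc)
          qed
          then show ?thesis by (simp add: sum.distrib sum_distrib_left)
        qed
        ultimately show ?thesis by (simp only:)
      qed
      then show ?thesis by blast
    qed
    show "w i = 0" if ev: "ev \<noteq> 0" and eigen: "\<And>i. i < N \<Longrightarrow> mat_app ?A w i = ev * w i"
      and zero: "\<And>z. z \<in> ring_domain T n 1 \<Longrightarrow> (\<Sum>i<N. w i * ?\<Phi> z i) = 0" and i: "i < N" for ev w i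
    proof (rule ccontr)
      assume "w i \<noteq> 0"
      let ?v = "Matrix.vec N w"
      have "?v \<noteq> 0\<^sub>v N"
      proof
        assume "?v = 0\<^sub>v N"
        then have "?v $ i = 0\<^sub>v N $ i" by simp
        with i \<open>w i \<noteq> 0\<close> show False by simp
      qed
      moreover have "?A *\<^sub>v ?v = ev \<cdot>\<^sub>v ?v"
      proof (rule eq_vecI)
        fix m assume "m < dim_vec (ev \<cdot>\<^sub>v ?v)"
        then have m: "m < N" by simp
        have "(?A *\<^sub>v ?v) $ m = mat_app ?A w m"
          unfolding mat_app_carrier[OF A] using m S by (simp add: scalar_prod_def lessThan_atLeast0)
        then show "(?A *\<^sub>v ?v) $ m = (ev \<cdot>\<^sub>v ?v) $ m" using eigen[OF m] m by simp
      qed (use S in simp)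
      ultimately have "eigenvector ?A ?v ev" using S by (simp add: eigenvector_def)
      with effective ev obtain z where z: "z \<in> ring_domain T n 1"
        and "scalar_prod ?v (map_vec complex_of_real (ring_basis T N L (\<lambda>_. cbar) 1 z)) \<noteq> 0"
        unfolding no_ineffective_eigenvectors_def by blast
      then show False using zero[OF z]
        by (simp add: scalar_prod_def dim_ring_basis lessThan_atLeast0)
    qed
  qed
  obtain x where x: "\<And>i j. i < N \<Longrightarrow> j < N \<Longrightarrow> (\<lambda>k. (?A ^\<^sub>m k) $$ (i, j)) \<longlonglongrightarrow> x j"
    using powers_converge by blast
  have "(\<lambda>k. (S ^\<^sub>m k) $$ (i, j)) \<longlonglongrightarrow> Re (x j)" if ij: "i < N" "j < N" for i j
  proof -
    have "(?A ^\<^sub>m k) $$ (i, j) = complex_of_real ((S ^\<^sub>m k) $$ (i, j))" for k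
      unfolding of_real_hom.mat_hom_pow[OF S, symmetric]
      by (rule index_map_mat(1)) (use ij S in simp_all)
    with tendsto_Re[OF x[OF ij]] show ?thesis by simp
  qed
  then show ?thesis by (intro exI[of _ "\<lambda>j. Re (x j)"]) blast
qed

section \<open>Convergence in the irregular region\<close>

lemma local_matrix_carrier:
  assumes "local_matrix kind n p A M"
  shows "M \<in> carrier_mat (n * block_size kind p) (n * block_size kind p)"
  using assms by (cases kind) (auto simp: block_circ_def)

lemma row_sum_le_mat_norm_inf:
  assumes "A \<in> carrier_mat m n" "i < m"
  shows "(\<Sum>j<n. \<bar>A $$ (i, j)\<bar>) \<le> mat_norm_inf A"
  unfolding mat_norm_inf_def using assms by (intro Max_ge) auto

theorem theorem4p1:
  fixes kind :: irregularity and T :: mesh and n p N P :: nat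
    and L :: "nat \<Rightarrow> nat \<Rightarrow> patch_data"
    and c :: "nat \<Rightarrow> mask" and cbar :: mask
    and St Sk :: "nat \<Rightarrow> real mat" and Sbart S :: "real mat"
    and C \<sigma> :: real
  assumes "1 \<le> n" and "1 \<le> p" and "N = n * block_size kind p"
    and "uniform_support c" and "uniform_support (\<lambda>_. cbar)"
    and "\<forall>k\<ge>1. local_matrix kind n p (St k) (Sk k)"
    and "local_matrix kind n p Sbart S"
    and "admissible_layout T n N P L (basic_limit c)"
    and "admissible_layout T n N P L (basic_limit (\<lambda>_. cbar))"
    and "nonsingular_scheme c St"
    and "no_ineffective_eigenvectors T n N L cbar S"
    and "S *\<^sub>v ones_vec N = ones_vec N"
    and "convergent_regular (\<lambda>_. cbar)"
    and "convergent_irregular T n N L (\<lambda>_. cbar) (\<lambda>_. S)"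
    and "summable (\<lambda>k. subdiv_norm (\<lambda>\<alpha>. c (Suc k) \<alpha> - cbar \<alpha>))"
    and "C > 0" and "\<sigma> > 1"
    and "\<forall>k\<ge>1. mat_norm_inf (Sk k - S) \<le> C / \<sigma> ^ k"
  shows "convergent_irregular T n N L c Sk \<and>
    (\<exists>xt. normalized_left_eigenvector N S xt) \<and>
    (\<forall>xt d. normalized_left_eigenvector N S xt \<and> d \<in> carrier_mat N 3 \<longrightarrow>
      (\<exists>Y\<in>carrier_mat N 3.
         mat_tendsto (\<lambda>k. perturbation_sum N S Sk d k) Y \<and>
         (let q0 = transpose_mat d *\<^sub>v xt;
              \<beta>0 = transpose_mat Y *\<^sub>v ((1 / real N) \<cdot>\<^sub>v ones_vec N)
          in \<forall>i<n. (\<lambda>k. SUP x\<in>Omega T (k + 1).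
               ereal (vec_norm_inf (subdiv_ring T N L c Sk d (k + 1) (x, i) - (q0 + \<beta>0))))
               \<longlonglongrightarrow> 0)))"
proof -
  note n = assms(1) and p = assms(2) and N = assms(3)
  have S: "S \<in> carrier_mat N N" using local_matrix_carrier[OF assms(7)] N by simp
  have Sk: "Sk k \<in> carrier_mat N N" if "k \<ge> 1" for k
    using local_matrix_carrier[of kind n p "St k" "Sk k"] assms(6) N that by simp
  have N0: "0 < N" using n p N by (cases kind) auto
  have rows: "(\<Sum>j<N. S $$ (i, j)) = 1" if "i < N" for i
  proof -
    have "(\<Sum>j<N. S $$ (i, j)) = (S *\<^sub>v ones_vec N) $ i"
      using that S by (simp add: ones_vec_def scalar_prod_def lessThan_atLeast0)
    also have "\<dots> = 1" unfolding assms(12) using that by (simp add: ones_vec_def)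
    finally show ?thesis .
  qed
  interpret irregular_perturbation cbar T n N P L c
    using assms by unfold_locales auto
  obtain x where x: "\<And>i j. i < N \<Longrightarrow> j < N \<Longrightarrow> (\<lambda>k. (S ^\<^sub>m k) $$ (i, j)) \<longlonglongrightarrow> x j"
    using local_matrix_powers_converge[OF assms(14) S rows assms(11)] by blast
  interpret perturbed_matrices N S Sk x C \<sigma>
  proof
    show "(\<Sum>j<N. \<bar>(Sk k - S) $$ (i, j)\<bar>) \<le> C / \<sigma> ^ k" if "k \<ge> 1" "i < N" for k i
      using row_sum_le_mat_norm_inf[of "Sk k - S" N N i] S assms(18) that by force
  qed (use S Sk x assms(16,17) in auto)
  \<comment> \<open>The \<open>x\<close>-weighted mean of the initial data will be identified with
    \<open>q0\<close>, and \<open>drift\<close> with \<beta>0.\<close>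
  define lim where "lim d = Matrix.vec 3 (\<lambda>s. (\<Sum>j<N. x j * d $$ (j, s)) + drift (\<lambda>i. d $$ (i, s)))"
    for d :: "real mat"
  have lim_carrier: "lim d \<in> carrier_vec 3" for d by (simp add: lim_def)
  have ctrl_carrier: "ctrl Sk d k \<in> carrier_mat N 3" if "d \<in> carrier_mat N 3" for d k
    unfolding ctrl_def by (rule ctrl_after_carrier[OF that])
  have rings: "(\<lambda>k. SUP z\<in>ring_domain T n k. ereal (vec_norm_inf (subdiv_ring T N L c Sk d k z - lim d)))
      \<longlonglongrightarrow> 0" if d: "d \<in> carrier_mat N 3" for d
  proof (rule ring_limit[OF ctrl_carrier[OF d] lim_carrier])
    fix m s :: nat assume ms: "m < N" "s < 3"
    \<comment> \<open>\<open>ctrl\<close> counts levels from 1 and \<open>ctrl_after\<close> counts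
      steps from 0, hence the shift.\<close>
    have "(\<lambda>k. ctrl Sk d (Suc k) $$ (m, s)) \<longlonglongrightarrow> lim d $ s"
      using traj_tendsto[OF ms(1), of "\<lambda>i. d $$ (i, s)"] ms(2)
      by (simp add: ctrl_def ctrl_after_entry[OF d ms] lim_def)
    then show "(\<lambda>k. ctrl Sk d k $$ (m, s)) \<longlonglongrightarrow> lim d $ s"
      by (subst (asm) filterlim_sequentially_Suc)
  qed
  have regular: "convergent_regular c"
    using assms(10) unfolding nonsingular_scheme_def by (intro convergent_regular_c) blast
  have sectors: "(\<lambda>k. SUP x\<in>Omega T (k + 1).
      ereal (vec_norm_inf (subdiv_ring T N L c Sk d (k + 1) (x, i) - lim d))) \<longlonglongrightarrow> 0"
    if d: "d \<in> carrier_mat N 3" and i: "i < n" for d i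
  proof -
    have carrier: "subdiv_ring T N L c Sk d k z - lim d \<in> carrier_vec 3" for k z
      by (intro carrier_vecI) (simp add: lim_def)
    have small: "\<forall>e>0. \<forall>\<^sub>F k in sequentially. \<forall>z\<in>ring_domain T n k.
        vec_norm_inf (subdiv_ring T N L c Sk d k z - lim d) \<le> e"
      using rings[OF d] by (subst (asm) SUP_ereal_tendsto_0_iff)
        (use ring_domain_nonempty vec_norm_inf_nonneg[OF carrier] in auto)
    show ?thesis
    proof (subst SUP_ereal_tendsto_0_iff, goal_cases)
      case 3
      show ?case
      proof (intro allI impI)
        fix e :: real assume "e > 0"
        with small obtain k0 where k0: "\<And>k z. k \<ge> k0 \<Longrightarrow> z \<in> ring_domain T n k \<Longrightarrow>
            vec_norm_inf (subdiv_ring T N L c Sk d k z - lim d) \<le> e"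
          unfolding eventually_sequentially by blast
        have "vec_norm_inf (subdiv_ring T N L c Sk d (k + 1) (x, i) - lim d) \<le> e"
          if "k \<ge> k0" "x \<in> Omega T (k + 1)" for k x
          using that i by (intro k0) (auto simp: ring_domain_def)
        then show "\<forall>\<^sub>F k in sequentially. \<forall>x\<in>Omega T (k + 1).
            vec_norm_inf (subdiv_ring T N L c Sk d (k + 1) (x, i) - lim d) \<le> e"
          unfolding eventually_sequentially by blast
      qed
    qed (use Omega_nonempty vec_norm_inf_nonneg[OF carrier] in auto)
  qed
  have limit_point: "\<exists>Y\<in>carrier_mat N 3. mat_tendsto (\<lambda>k. perturbation_sum N S Sk d k) Y \<and>
      transpose_mat d *\<^sub>v xt + transpose_mat Y *\<^sub>v ((1 / real N) \<cdot>\<^sub>v ones_vec N) = lim d"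
    if xt: "normalized_left_eigenvector N S xt" and d: "d \<in> carrier_mat N 3" for xt d
  proof (intro bexI conjI)
    \<comment> \<open>All rows of the limit agree, so averaging them with weights
      \<open>1 / real N\<close> returns \<open>drift\<close>.\<close>
    let ?Y = "Matrix.mat N 3 (\<lambda>(r, s). drift (\<lambda>i. d $$ (i, s)))"
    show "?Y \<in> carrier_mat N 3" by simp
    show "mat_tendsto (\<lambda>k. perturbation_sum N S Sk d k) ?Y"
      unfolding mat_tendsto_def
      using perturbation_tendsto by (simp add: perturbation_sum_entry[OF d])
    have xt_carrier: "xt \<in> carrier_vec N" using xt by (simp add: normalized_left_eigenvector_def)
    show "transpose_mat d *\<^sub>v xt + transpose_mat ?Y *\<^sub>v ((1 / real N) \<cdot>\<^sub>v ones_vec N) = lim d"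
    proof (rule eq_vecI)
      fix s assume "s < dim_vec (lim d)"
      then have s: "s < 3" by (simp add: lim_def)
      have "(transpose_mat d *\<^sub>v xt) $ s = (\<Sum>j<N. d $$ (j, s) * xt $ j)"
        using d s xt_carrier by (simp add: scalar_prod_def lessThan_atLeast0)
      also have "\<dots> = (\<Sum>j<N. x j * d $$ (j, s))"
        using left_eigenvector_unique[OF xt] by (intro sum.cong) auto
      finally have 1: "(transpose_mat d *\<^sub>v xt) $ s = (\<Sum>j<N. x j * d $$ (j, s))" .
      have 2: "(transpose_mat ?Y *\<^sub>v ((1 / real N) \<cdot>\<^sub>v ones_vec N)) $ s = drift (\<lambda>i. d $$ (i, s))"
        using s N0 by (simp add: scalar_prod_def ones_vec_def)
      show "(transpose_mat d *\<^sub>v xt + transpose_mat ?Y *\<^sub>v ((1 / real N) \<cdot>\<^sub>v ones_vec N)) $ s = lim d $ s"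
        using s by (simp add: 1 2 lim_def del: index_mult_mat_vec)
    qed (use d in \<open>simp add: lim_def\<close>)
  qed
  show ?thesis
  proof (intro conjI allI impI)
    show "convergent_irregular T n N L c Sk"
      unfolding convergent_irregular_def using regular rings lim_carrier by blast
    show "\<exists>xt. normalized_left_eigenvector N S xt"
      using left_eigenvector_exists[OF N0 rows] by blast
  next
    fix xt and d :: "real mat" assume "normalized_left_eigenvector N S xt \<and> d \<in> carrier_mat N 3"
    then have xt: "normalized_left_eigenvector N S xt" and d: "d \<in> carrier_mat N 3" by auto
    from limit_point[OF xt d] sectors[OF d] show "\<exists>Y\<in>carrier_mat N 3.
         mat_tendsto (\<lambda>k. perturbation_sum N S Sk d k) Y \<and>
         (let q0 = transpose_mat d *\<^sub>v xt;
              \<beta>0 = transpose_mat Y *\<^sub>v ((1 / real N) \<cdot>\<^sub>v ones_vec N)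
          in \<forall>i<n. (\<lambda>k. SUP x\<in>Omega T (k + 1).
               ereal (vec_norm_inf (subdiv_ring T N L c Sk d (k + 1) (x, i) - (q0 + \<beta>0))))
               \<longlonglongrightarrow> 0)"
      unfolding Let_def by (elim bexE) (intro bexI conjI; simp)
  qed
qed

end
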